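(* Let $T>0$ and let $V,H$ be separable Hilbert spaces over $\mathbb{C}$ with $V$ continuously and densely embedded in $H$. Let $\mathfrak a,\mathfrak b\colon[0,T]\times V\times V\to\mathbb{C}$ be non-autonomous $V$-bounded and quasi-coercive sesquilinear forms, and let $\mathcal A(t),\mathcal B(t)\in\mathcal L(V,V')$ be the operators associated with $\mathfrak a(t,\cdot,\cdot)$ and $\mathfrak b(t,\cdot,\cdot)$. Then for every $u_0\in V$, $u_1\in H$ and $f\in L^2(0,T;V')$ there exists a unique $u\in MR(V,V,V')$ such that $$\ddot u(t)+\mathcal B(t)\dot u(t)+\mathcal A(t)u(t)=f(t)\ \text{ in } V' \text{ for a.e. } t\in(0,T),\qquad u(0)=u_0,\quad \dot u(0)=u_1.$$ Moreover, there exists a constant $C>0$ (independent of $u_0,u_1,f$) such that $$\|u\|_{MR(V,V,V')}\le C\big[\|u_0\|_V+\|u_1\|_H+\|f\|_{L^2(0,T;V')}\big].$$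
   Context: $V'$ is the antidual of $V$, $\langle\cdot,\cdot\rangle$ is the duality between $V'$ and $V$, and $H$ is identified with a dense subspace of $V'$ via $\langle u,v\rangle=(u\mid v)_H$ for $u\in H$, $v\in V$. A family of sesquilinear forms $\mathfrak a\colon[0,T]\times V\times V\to\mathbb{C}$ is a $V$-bounded non-autonomous sesquilinear form if $\mathfrak a(\cdot,u,v)$ is measurable for all $u,v\in V$ and there is a constant $M$ with $|\mathfrak a(t,u,v)|\le M\|u\|_V\|v\|_V$ for all $t\in[0,T]$, $u,v\in V$. It is quasi-coercive if there are $\alpha>0$, $\omega\in\mathbb{R}$ with $\mathrm{Re}\,\mathfrak a(t,u,u)+\omega\|u\|_H^2\ge\alpha\|u\|_V^2$ for all $t\in[0,T]$, $u\in V$. The associated operator is defined by $\langle\mathcal A(t)u,v\rangle=\mathfrak a(t,u,v)$ for $u,v\in V$ (similarly $\mathcal B(t)$ for $\mathfrak b$). $MR(V,V,V'):=H^1(0,T;V)\cap H^2(0,T;V')$, with its natural norm, e.g. $\big(\|u\|_{L^2(0,T;V)}^2+\|\dot u\|_{L^2(0,T;V)}^2+\|\ddot u\|_{L^2(0,T;V')}^2\big)^{1/2}$. One has $MR(V,V,V')\hookrightarrow C([0,T];V)\cap C^1([0,T];H)$, so $u(0)\in V$ and $\dot u(0)\in H$ are well defined. *)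

theory Defs
  imports "HOL-Analysis.Analysis"
begin

section \<open>Complex Hilbert spaces\<close>

text \<open>
  The library has no complex inner product spaces. A complex Hilbert space is rendered as a real
  Hilbert space with a compatible complex scalar multiplication and a sesquilinear inner product
  (linear in the first argument) whose real part is the real inner product. In particular
  \<^term>\<open>norm x = sqrt (Re (cinner x x))\<close>, see \<open>norm_eq_sqrt_cinner\<close> below.
\<close>

class complex_hilbert = real_inner + banach +
  fixes scaleC :: "complex \<Rightarrow> 'a \<Rightarrow> 'a"  (infixr \<open>*\<^sub>C\<close> 75)
    and cinner :: "'a \<Rightarrow> 'a \<Rightarrow> complex"
  assumes scaleC_add_right: "c *\<^sub>C (x + y) = c *\<^sub>C x + c *\<^sub>C y"
    and scaleC_add_left: "(c + d) *\<^sub>C x = c *\<^sub>C x + d *\<^sub>C x"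
    and scaleC_scaleC: "c *\<^sub>C (d *\<^sub>C x) = (c * d) *\<^sub>C x"
    and scaleR_scaleC: "r *\<^sub>R x = complex_of_real r *\<^sub>C x"
    and cinner_commute: "cinner x y = cnj (cinner y x)"
    and cinner_add_left: "cinner (x + y) z = cinner x z + cinner y z"
    and cinner_scaleC_left: "cinner (c *\<^sub>C x) y = c * cinner x y"
    and inner_eq_Re_cinner: "inner x y = Re (cinner x y)"

instantiation complex :: complex_hilbert
begin

definition scaleC_complex :: "complex \<Rightarrow> complex \<Rightarrow> complex" where
  "scaleC_complex c x = c * x"

definition cinner_complex :: "complex \<Rightarrow> complex \<Rightarrow> complex" where
  "cinner_complex x y = x * cnj y"

instance
  by standard
    (auto simp: scaleC_complex_def cinner_complex_def algebra_simps scaleR_conv_of_real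
      inner_complex_def)

end

context complex_hilbert
begin

lemma cinner_add_right: "cinner x (y + z) = cinner x y + cinner x z"
  by (metis cinner_add_left cinner_commute complex_cnj_add)

lemma cinner_scaleC_right: "cinner x (c *\<^sub>C y) = cnj c * cinner x y"
  by (metis cinner_commute cinner_scaleC_left complex_cnj_mult)

lemma norm_eq_sqrt_cinner: "norm x = sqrt (Re (cinner x x))"
  by (simp add: norm_eq_sqrt_inner inner_eq_Re_cinner)

end

lemma Im_cinner: "Im (cinner x y) = inner x (\<i> *\<^sub>C y)"
  for x y :: "'a::complex_hilbert"
  by (simp add: inner_eq_Re_cinner cinner_scaleC_right)

lemma cinner_self: "cinner x x = complex_of_real ((norm x)\<^sup>2)"
  for x :: "'a::complex_hilbert"
proof -
  have "Im (cinner x x) = 0"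
    by (metis cinner_commute complex_cnj_cancel_iff complex_cnj_complex_of_real
        complex_is_Real_iff Reals_cnj_iff)
  then show ?thesis
    by (simp add: complex_eq_iff power2_norm_eq_inner inner_eq_Re_cinner)
qed

lemma norm_cinner_le: "cmod (cinner x y) \<le> norm x * norm y"
  for x y :: "'a::complex_hilbert"
proof (cases "cinner x y = 0")
  case False
  define c where "c = cnj (cinner x y) / cmod (cinner x y)"
  have c: "c * cinner x y = complex_of_real (cmod (cinner x y))" "cmod c = 1"
    using False
    by (auto simp: c_def norm_divide complex_norm_square[symmetric] power2_eq_square mult.commute)
  have "norm (c *\<^sub>C x) = norm x"
  proof -
    have "cinner (c *\<^sub>C x) (c *\<^sub>C x) = (c * cnj c) * cinner x x"
      by (simp add: cinner_scaleC_left cinner_scaleC_right)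
    also have "c * cnj c = 1"
      using c(2) by (metis complex_norm_square of_real_1 one_power2)
    finally show ?thesis
      by (simp add: norm_eq_sqrt_cinner)
  qed
  moreover have "cmod (cinner x y) = inner (c *\<^sub>C x) y"
    using c(1) by (simp add: inner_eq_Re_cinner cinner_scaleC_left)
  ultimately show ?thesis
    using norm_cauchy_schwarz[of "c *\<^sub>C x" y] by simp
qed simp


section \<open>The antidual\<close>

definition antilinear :: "('v::complex_hilbert \<Rightarrow> complex) \<Rightarrow> bool" where
  "antilinear F \<longleftrightarrow>
    (\<forall>x y. F (x + y) = F x + F y) \<and> (\<forall>c x. F (c *\<^sub>C x) = cnj c * F x)"

text \<open>
  The antidual carries the operator norm, inherited from the real-linear bounded maps.
\<close>

typedef (overloaded) ('v::complex_hilbert) antidual =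
  "{F :: 'v \<Rightarrow>\<^sub>L complex. antilinear (blinfun_apply F)}"
  by (rule exI[of _ 0]) (simp add: antilinear_def)

setup_lifting type_definition_antidual

lift_definition pairing :: "'v::complex_hilbert antidual \<Rightarrow> 'v \<Rightarrow> complex" is blinfun_apply .

instantiation antidual :: (complex_hilbert) real_normed_vector
begin

lift_definition norm_antidual :: "'a antidual \<Rightarrow> real" is norm .

lift_definition zero_antidual :: "'a antidual" is 0
  by (simp add: antilinear_def)

lift_definition plus_antidual :: "'a antidual \<Rightarrow> 'a antidual \<Rightarrow> 'a antidual" is "(+)"
  by (simp add: antilinear_def blinfun.bilinear_simps algebra_simps)

lift_definition minus_antidual :: "'a antidual \<Rightarrow> 'a antidual \<Rightarrow> 'a antidual" is "(-)"
  by (simp add: antilinear_def blinfun.bilinear_simps algebra_simps)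

lift_definition uminus_antidual :: "'a antidual \<Rightarrow> 'a antidual" is "uminus"
  by (simp add: antilinear_def blinfun.bilinear_simps algebra_simps)

lift_definition scaleR_antidual :: "real \<Rightarrow> 'a antidual \<Rightarrow> 'a antidual" is "(*\<^sub>R)"
  by (simp add: antilinear_def blinfun.bilinear_simps algebra_simps)

definition dist_antidual :: "'a antidual \<Rightarrow> 'a antidual \<Rightarrow> real" where
  "dist_antidual F G = norm (F - G)"

definition uniformity_antidual :: "('a antidual \<times> 'a antidual) filter" where
  "uniformity_antidual = (INF e\<in>{0 <..}. principal {(x, y). dist x y < e})"

definition open_antidual :: "'a antidual set \<Rightarrow> bool" where
  "open_antidual S = (\<forall>x\<in>S. \<forall>\<^sub>F (x', y) in uniformity. x' = x \<longrightarrow> y \<in> S)"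

definition sgn_antidual :: "'a antidual \<Rightarrow> 'a antidual" where
  "sgn_antidual x = scaleR (inverse (norm x)) x"

instance
  apply standard
  unfolding dist_antidual_def open_antidual_def sgn_antidual_def uniformity_antidual_def
  apply (rule refl | (transfer, force simp: algebra_simps norm_triangle_ineq))+
  done

end

lemma pairing_add_left: "pairing (F + G) v = pairing F v + pairing G v"
  by transfer (simp add: blinfun.bilinear_simps)

lemma pairing_diff_left: "pairing (F - G) v = pairing F v - pairing G v"
  by transfer (simp add: blinfun.bilinear_simps)

lemma pairing_scaleR_left: "pairing (r *\<^sub>R F) v = r *\<^sub>R pairing F v"
  by transfer (simp add: blinfun.bilinear_simps)

lemma antilinear_pairing: "antilinear (pairing F)"
  by transfer simp

lemma pairing_add_right: "pairing F (v + w) = pairing F v + pairing F w"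
  using antilinear_pairing[of F] by (auto simp: antilinear_def)

lemma pairing_scaleC_right: "pairing F (c *\<^sub>C v) = cnj c * pairing F v"
  using antilinear_pairing[of F] by (auto simp: antilinear_def)

lemma norm_pairing_le: "cmod (pairing F v) \<le> norm F * norm v"
  by transfer (rule norm_blinfun)

lemma antidual_eqI: "(\<And>v. pairing F v = pairing G v) \<Longrightarrow> F = G"
  by transfer (rule blinfun_eqI)

lemma bounded_linear_pairing_right: "bounded_linear (pairing F)"
  by (simp add: pairing.rep_eq blinfun.bounded_linear_right)

lemma antidual_norm_bound:
  "0 \<le> b \<Longrightarrow> (\<And>v. cmod (pairing F v) \<le> b * norm v) \<Longrightarrow> norm F \<le> b"
  by transfer (rule norm_blinfun_bound)

instance antidual :: (complex_hilbert) banach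
proof
  fix X :: "nat \<Rightarrow> 'a antidual"
  assume X: "Cauchy X"
  have dist: "dist (Rep_antidual F) (Rep_antidual G) = dist F G" for F G :: "'a antidual"
    by (simp add: dist_norm norm_antidual.rep_eq minus_antidual.rep_eq)
  from X have "Cauchy (\<lambda>n. Rep_antidual (X n))"
    by (simp add: Cauchy_def dist)
  then obtain L where L: "(\<lambda>n. Rep_antidual (X n)) \<longlonglongrightarrow> L"
    by (auto simp: Cauchy_convergent_iff convergent_def)
  have lim: "(\<lambda>n. pairing (X n) v) \<longlonglongrightarrow> blinfun_apply L v" for v
    unfolding pairing.rep_eq by (intro tendsto_intros L)
  have "blinfun_apply L (x + y) = blinfun_apply L x + blinfun_apply L y" for x y
    by (rule blinfun.add_right)
  moreover have "blinfun_apply L (c *\<^sub>C x) = cnj c * blinfun_apply L x" for c x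
  proof (rule LIMSEQ_unique)
    show "(\<lambda>n. pairing (X n) (c *\<^sub>C x)) \<longlonglongrightarrow> blinfun_apply L (c *\<^sub>C x)"
      by (rule lim)
    show "(\<lambda>n. pairing (X n) (c *\<^sub>C x)) \<longlonglongrightarrow> cnj c * blinfun_apply L x"
      unfolding pairing_scaleC_right by (intro tendsto_intros lim)
  qed
  ultimately have "Rep_antidual (Abs_antidual L) = L"
    by (intro Abs_antidual_inverse) (auto simp: antilinear_def)
  with L have "X \<longlonglongrightarrow> Abs_antidual L"
    by (simp add: tendsto_iff dist flip: dist)
  then show "convergent X"
    by (auto simp: convergent_def)
qed

text \<open>
  The antidual of a separable Hilbert space is separable (by the Riesz representation theorem).
  This makes the Bochner integral of the library available for functions with values in it.
\<close>

lemma riesz_real: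
  fixes g :: "'v::{real_inner, banach} \<Rightarrow> real"
  assumes g: "bounded_linear g"
  shows "\<exists>w. \<forall>v. g v = inner w v"
proof -
  interpret g: bounded_linear g by (rule g)
  define J where "J v = (norm v)\<^sup>2 - 2 * g v" for v
  obtain K where K: "\<And>v. norm (g v) \<le> norm v * K" using g.bounded by blast
  have J_ge: "J v \<ge> - K\<^sup>2" for v
  proof -
    have "0 \<le> (norm v - K)\<^sup>2" by simp
    moreover have "g v \<le> norm v * K" using K[of v] by auto
    ultimately show ?thesis unfolding J_def power2_diff by linarith
  qed
  define m where "m = (INF v. J v)"
  have bdd: "bdd_below (range J)" using J_ge by (auto intro!: bdd_belowI)
  have m_le: "m \<le> J v" for v unfolding m_def by (rule cINF_lower[OF bdd]) simp
  have "\<exists>v. J v < m + 1 / real (Suc n)" for n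
  proof -
    have "(INF v. J v) < m + 1 / real (Suc n)" by (simp add: m_def)
    then show ?thesis using cINF_less_iff[OF _ bdd] by auto
  qed
  then obtain x where x: "\<And>n. J (x n) < m + 1 / real (Suc n)" by metis
  have par: "(norm (a - b))\<^sup>2 \<le> 2 * (J a - m) + 2 * (J b - m)" for a b
  proof -
    have "(norm (a - b))\<^sup>2 = 2 * J a + 2 * J b - 4 * J ((1/2) *\<^sub>R (a + b))"
      by (simp add: J_def g.add g.scaleR power2_norm_eq_inner inner_simps inner_commute
          algebra_simps)
    then show ?thesis using m_le[of "(1/2) *\<^sub>R (a + b)"] by simp
  qed
  have "Cauchy x"
  proof (rule CauchyI)
    fix e :: real assume e: "0 < e"
    then obtain N where N: "1 / real (Suc N) < e\<^sup>2 / 4"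
      using nat_approx_posE[of "e\<^sup>2 / 4"] by auto
    have small: "J (x n) - m < e\<^sup>2 / 4" if "n \<ge> N" for n
    proof -
      have "1 / real (Suc n) \<le> 1 / real (Suc N)" using that by (simp add: frac_le)
      then show ?thesis using x[of n] N by linarith
    qed
    show "\<exists>M. \<forall>k\<ge>M. \<forall>n\<ge>M. norm (x k - x n) < e"
    proof (intro exI allI impI)
      fix k n assume "k \<ge> N" "n \<ge> N"
      then have "(norm (x k - x n))\<^sup>2 < e\<^sup>2"
        using par[of "x k" "x n"] small[of k] small[of n] by auto
      then show "norm (x k - x n) < e" using e by (simp add: power2_less_imp_less)
    qed
  qed
  then obtain w where w: "x \<longlonglongrightarrow> w" by (auto simp: Cauchy_convergent_iff convergent_def)
  have "J w \<le> m"
  proof (rule LIMSEQ_le)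
    show "(\<lambda>n. J (x n)) \<longlonglongrightarrow> J w" unfolding J_def by (intro tendsto_intros w g.tendsto)
    show "(\<lambda>n. m + 1 / real (Suc n)) \<longlonglongrightarrow> m"
      using tendsto_add[OF tendsto_const[of m] LIMSEQ_inverse_real_of_nat]
      by (simp add: inverse_eq_divide)
    show "\<exists>N. \<forall>n\<ge>N. J (x n) \<le> m + 1 / real (Suc n)" using x less_imp_le by blast
  qed
  have "g v = inner w v" for v
  proof (rule ccontr)
    assume ne: "g v \<noteq> inner w v"
    define d where "d = inner w v - g v"
    define s where "s = - d / (norm v)\<^sup>2"
    have v: "norm v > 0" using ne by auto
    have "J (w + s *\<^sub>R v) = J w + 2 * s * d + s\<^sup>2 * (norm v)\<^sup>2"
    proof -
      have "(norm (w + s *\<^sub>R v))\<^sup>2 = (norm w)\<^sup>2 + 2 * s * inner w v + s\<^sup>2 * (norm v)\<^sup>2"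
        unfolding power2_norm_eq_inner
        by (simp add: inner_simps inner_commute algebra_simps power2_eq_square)
      then show ?thesis by (simp add: J_def d_def g.add g.scaleR algebra_simps)
    qed
    also have "\<dots> = J w - d\<^sup>2 / (norm v)\<^sup>2"
      using v by (simp add: s_def field_simps power2_eq_square)
    also have "\<dots> < J w" using ne v by (simp add: d_def)
    finally show False using m_le[of "w + s *\<^sub>R v"] \<open>J w \<le> m\<close> by simp
  qed
  then show ?thesis by blast
qed

lemma riesz_antidual:
  fixes F :: "'v::complex_hilbert antidual"
  shows "\<exists>w. \<forall>v. pairing F v = cinner w v"
proof -
  have "bounded_linear (\<lambda>v. Re (pairing F v))"
    by (rule bounded_linear_compose[OF bounded_linear_Re bounded_linear_pairing_right])
  then obtain w where w: "\<And>v. Re (pairing F v) = inner w v" using riesz_real by blast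
  have "Im (pairing F v) = Im (cinner w v)" for v
    using w[of "\<i> *\<^sub>C v"] by (simp add: pairing_scaleC_right Im_cinner)
  with w show ?thesis by (auto simp: complex_eq_iff inner_eq_Re_cinner)
qed

text \<open>\<open>antidual_of g\<close> is \<open>g\<close> as an element of the antidual, provided \<open>g\<close> is bounded and antilinear.\<close>

definition antidual_of :: "('v::complex_hilbert \<Rightarrow> complex) \<Rightarrow> 'v antidual" where
  "antidual_of g = Abs_antidual (Blinfun g)"

lemma pairing_antidual_of:
  assumes "antilinear g" "\<And>v. cmod (g v) \<le> K * norm v"
  shows "pairing (antidual_of g) v = g v"
proof -
  have g: "bounded_linear g"
  proof (rule bounded_linear_intro)
    show "g (x + y) = g x + g y" for x y using assms(1) by (simp add: antilinear_def)
    show "g (r *\<^sub>R x) = r *\<^sub>R g x" for r x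
      using assms(1) by (simp add: antilinear_def scaleR_scaleC scaleC_complex_def)
    show "norm (g x) \<le> norm x * K" for x using assms(2)[of x] by (simp add: mult.commute)
  qed
  then show ?thesis
    using assms(1)
    by (simp add: antidual_of_def pairing.rep_eq Abs_antidual_inverse bounded_linear_Blinfun_apply)
qed

instance antidual :: ("{complex_hilbert, second_countable_topology}") second_countable_topology
proof
  define R :: "'a \<Rightarrow> 'a antidual" where "R w = antidual_of (cinner w)" for w
  have R: "pairing (R w) v = cinner w v" for w v
    unfolding R_def
    by (rule pairing_antidual_of[where K = "norm w"])
      (auto simp: antilinear_def cinner_add_right cinner_scaleC_right norm_cinner_le)
  have Rdiff: "R a - R b = R (a - b)" for a b
  proof (rule antidual_eqI)
    fix v
    have "cinner a v = cinner (a - b) v + cinner b v"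
      by (metis cinner_add_left diff_add_cancel)
    then show "pairing (R a - R b) v = pairing (R (a - b)) v"
      by (simp add: pairing_diff_left R)
  qed
  have normR: "norm (R a) = norm a" for a
  proof (rule antisym)
    show "norm (R a) \<le> norm a"
      by (rule antidual_norm_bound) (auto simp: R norm_cinner_le)
    show "norm a \<le> norm (R a)"
      using norm_pairing_le[of "R a" a]
      by (cases "a = 0") (auto simp: R cinner_self norm_mult power2_eq_square)
  qed
  have distR: "dist (R a) (R b) = dist a b" for a b
    by (simp add: dist_norm Rdiff normR)
  have surjR: "\<exists>w. F = R w" for F
    using riesz_antidual[of F] by (metis R antidual_eqI)
  have openR: "open (R ` S)" if "open S" for S
    unfolding open_dist
  proof safe
    fix s assume "s \<in> S"
    with that obtain e where "e > 0" "\<And>y. dist y s < e \<Longrightarrow> y \<in> S" by (auto simp: open_dist)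
    then show "\<exists>e>0. \<forall>y. dist y (R s) < e \<longrightarrow> y \<in> R ` S"
      by (metis distR image_eqI surjR)
  qed
  have contR: "continuous_on UNIV R"
    unfolding continuous_on_iff by (metis distR)
  obtain B :: "'a set set" where B: "countable B" "topological_basis B"
    using ex_countable_basis by blast
  have "topological_basis ((`) R ` B)"
  proof (rule topological_basisI)
    show "open B'" if "B' \<in> (`) R ` B" for B'
      using that openR topological_basis_open[OF B(2)] by auto
    fix U and F :: "'a antidual" assume U: "open U" "F \<in> U"
    obtain w where w: "F = R w" using surjR by blast
    have "open (R -` U)" using contR U(1) by (rule open_vimage[rotated])
    with B(2) obtain b where "b \<in> B" "w \<in> b" "b \<subseteq> R -` U"
      using U(2) w by (metis topological_basisE vimageI)
    then show "\<exists>B'\<in>(`) R ` B. F \<in> B' \<and> B' \<subseteq> U" using w by blast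
  qed
  then show "\<exists>B::'a antidual set set. countable B \<and> open = generate_topology B"
    using B(1) countable_image topological_basis_imp_subbasis by blast
qed


section \<open>The Gelfand triple\<close>

text \<open>
  \<open>V\<close> and \<open>H\<close> are distinct types; the inclusion of \<open>V\<close> in \<open>H\<close> is the map \<open>j\<close>.
\<close>

definition dense_embedding :: "('v::complex_hilbert \<Rightarrow> 'h::complex_hilbert) \<Rightarrow> bool" where
  "dense_embedding j \<longleftrightarrow>
    bounded_linear j \<and> (\<forall>c v. j (c *\<^sub>C v) = c *\<^sub>C j v) \<and> inj j \<and> closure (range j) = UNIV"

definition dual_embedding ::
    "('v::complex_hilbert \<Rightarrow> 'h::complex_hilbert) \<Rightarrow> 'h \<Rightarrow> 'v antidual" where
  "dual_embedding j h = antidual_of (\<lambda>v. cinner h (j v))"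

lemma pairing_dual_embedding:
  assumes "dense_embedding j"
  shows "pairing (dual_embedding j h) v = cinner h (j v)"
proof -
  have j: "bounded_linear j" "\<And>c v. j (c *\<^sub>C v) = c *\<^sub>C j v"
    using assms by (auto simp: dense_embedding_def)
  obtain K where K: "\<And>v. norm (j v) \<le> norm v * K" using bounded_linear.bounded[OF j(1)] by blast
  show ?thesis
    unfolding dual_embedding_def
  proof (rule pairing_antidual_of)
    show "antilinear (\<lambda>v. cinner h (j v))"
      by (simp add: antilinear_def cinner_add_right cinner_scaleC_right j
          linear_add[OF bounded_linear.linear[OF j(1)]])
    show "cmod (cinner h (j v)) \<le> (norm h * K) * norm v" for v
      using norm_cinner_le[of h "j v"] mult_left_mono[OF K[of v], of "norm h"]
      by (simp add: mult_ac)
  qed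
qed


section \<open>Non-autonomous forms\<close>

definition sesquilinear :: "('v::complex_hilbert \<Rightarrow> 'v \<Rightarrow> complex) \<Rightarrow> bool" where
  "sesquilinear b \<longleftrightarrow>
    (\<forall>u u' v. b (u + u') v = b u v + b u' v) \<and> (\<forall>c u v. b (c *\<^sub>C u) v = c * b u v) \<and>
    (\<forall>u. antilinear (b u))"

text \<open>A form is a function of \<open>t \<in> \<real>\<close> whose values outside \<open>[0,T]\<close> are irrelevant.\<close>

definition bounded_nonautonomous_form ::
    "real \<Rightarrow> (real \<Rightarrow> 'v::complex_hilbert \<Rightarrow> 'v \<Rightarrow> complex) \<Rightarrow> bool" where
  "bounded_nonautonomous_form T a \<longleftrightarrow>
    (\<forall>t\<in>{0..T}. sesquilinear (a t)) \<and>
    (\<forall>u v. (\<lambda>t. a t u v) \<in> borel_measurable (lebesgue_on {0..T})) \<and>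
    (\<exists>M. \<forall>t\<in>{0..T}. \<forall>u v. cmod (a t u v) \<le> M * norm u * norm v)"

definition quasi_coercive ::
    "real \<Rightarrow> ('v::complex_hilbert \<Rightarrow> 'h::complex_hilbert) \<Rightarrow>
      (real \<Rightarrow> 'v \<Rightarrow> 'v \<Rightarrow> complex) \<Rightarrow> bool" where
  "quasi_coercive T j a \<longleftrightarrow>
    (\<exists>\<alpha>>0. \<exists>\<omega>::real. \<forall>t\<in>{0..T}. \<forall>u.
      Re (a t u u) + \<omega> * (norm (j u))\<^sup>2 \<ge> \<alpha> * (norm u)\<^sup>2)"

definition assoc_operator ::
    "(real \<Rightarrow> 'v::complex_hilbert \<Rightarrow> 'v \<Rightarrow> complex) \<Rightarrow> real \<Rightarrow> 'v \<Rightarrow> 'v antidual" where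
  "assoc_operator a t u = antidual_of (a t u)"

lemma pairing_assoc_operator:
  assumes "bounded_nonautonomous_form T a" "t \<in> {0..T}"
  shows "pairing (assoc_operator a t u) v = a t u v"
proof -
  obtain M where "\<And>v. cmod (a t u v) \<le> (M * norm u) * norm v"
    using assms unfolding bounded_nonautonomous_form_def by blast
  then show ?thesis
    unfolding assoc_operator_def
    using assms by (intro pairing_antidual_of)
      (auto simp: bounded_nonautonomous_form_def sesquilinear_def)
qed

lemma bounded_linear_assoc_operator:
  assumes "bounded_nonautonomous_form T a" "t \<in> {0..T}"
  shows "bounded_linear (assoc_operator a t)"
    and "pairing (assoc_operator a t (c *\<^sub>C u)) v = c * pairing (assoc_operator a t u) v"
proof -
  note p = pairing_assoc_operator[OF assms]
  have s: "sesquilinear (a t)" using assms by (auto simp: bounded_nonautonomous_form_def)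
  obtain M where M: "\<And>u v. cmod (a t u v) \<le> M * norm u * norm v"
    using assms unfolding bounded_nonautonomous_form_def by blast
  show "bounded_linear (assoc_operator a t)"
  proof (rule bounded_linear_intro)
    show "assoc_operator a t (x + y) = assoc_operator a t x + assoc_operator a t y" for x y
      using s by (intro antidual_eqI) (simp add: p pairing_add_left sesquilinear_def)
    show "assoc_operator a t (r *\<^sub>R x) = r *\<^sub>R assoc_operator a t x" for r x
      using s by (intro antidual_eqI)
        (simp add: p pairing_scaleR_left sesquilinear_def scaleR_scaleC scaleC_complex_def)
    show "norm (assoc_operator a t x) \<le> norm x * \<bar>M\<bar>" for x
    proof (rule antidual_norm_bound)
      show "cmod (pairing (assoc_operator a t x) v) \<le> norm x * \<bar>M\<bar> * norm v" for v
      proof -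
        have "M * norm x * norm v \<le> \<bar>M\<bar> * norm x * norm v" by (intro mult_right_mono) auto
        then show ?thesis using M[of x v] by (simp add: p mult_ac)
      qed
    qed simp
  qed
  show "pairing (assoc_operator a t (c *\<^sub>C u)) v = c * pairing (assoc_operator a t u) v"
    using s by (simp add: p sesquilinear_def)
qed


section \<open>Vector-valued Sobolev spaces\<close>

text \<open>
  Elements of \<open>L\<^sup>2(0,T;X)\<close> and of the Sobolev spaces are represented by functions on the real
  line; two of them are identified if they agree almost everywhere on \<open>(0,T)\<close>. For separable
  \<open>X\<close>, Borel measurability coincides with strong measurability.
\<close>

definition L2 :: "real \<Rightarrow> (real \<Rightarrow> 'x::{banach, second_countable_topology}) \<Rightarrow> bool" where
  "L2 T u \<longleftrightarrow>
    u \<in> borel_measurable (lebesgue_on {0<..<T}) \<and>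
    integrable (lebesgue_on {0<..<T}) (\<lambda>t. (norm (u t))\<^sup>2)"

definition L2_norm :: "real \<Rightarrow> (real \<Rightarrow> 'x::{banach, second_countable_topology}) \<Rightarrow> real" where
  "L2_norm T u = sqrt (integral\<^sup>L (lebesgue_on {0<..<T}) (\<lambda>t. (norm (u t))\<^sup>2))"

definition test_function :: "real \<Rightarrow> (real \<Rightarrow> real) \<Rightarrow> bool" where
  "test_function T \<phi> \<longleftrightarrow>
    (\<forall>n t. (deriv ^^ n) \<phi> differentiable (at t)) \<and>
    (\<exists>a b. 0 < a \<and> b < T \<and> (\<forall>t. t \<notin> {a..b} \<longrightarrow> \<phi> t = 0))"

definition weak_deriv ::
    "real \<Rightarrow> (real \<Rightarrow> 'x::{banach, second_countable_topology}) \<Rightarrow> (real \<Rightarrow> 'x) \<Rightarrow> bool" where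
  "weak_deriv T u u' \<longleftrightarrow>
    (\<forall>\<phi>. test_function T \<phi> \<longrightarrow>
      integral\<^sup>L (lebesgue_on {0<..<T}) (\<lambda>t. deriv \<phi> t *\<^sub>R u t) =
      - integral\<^sup>L (lebesgue_on {0<..<T}) (\<lambda>t. \<phi> t *\<^sub>R u' t))"

definition H1 :: "real \<Rightarrow> (real \<Rightarrow> 'x::{banach, second_countable_topology}) \<Rightarrow> bool" where
  "H1 T u \<longleftrightarrow> L2 T u \<and> (\<exists>u'. L2 T u' \<and> weak_deriv T u u')"

text \<open>The derivative of an \<open>H\<^sup>1\<close> function; a representative of a class that is unique a.e.\<close>

definition wderiv ::
    "real \<Rightarrow> (real \<Rightarrow> 'x::{banach, second_countable_topology}) \<Rightarrow> real \<Rightarrow> 'x" where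
  "wderiv T u = (SOME u'. L2 T u' \<and> weak_deriv T u u')"

definition H2 :: "real \<Rightarrow> (real \<Rightarrow> 'x::{banach, second_countable_topology}) \<Rightarrow> bool" where
  "H2 T u \<longleftrightarrow> H1 T u \<and> H1 T (wderiv T u)"

text \<open>\<open>in_dual j u\<close> is the \<open>V\<close>-valued function \<open>u\<close> regarded as a \<open>V'\<close>-valued function.\<close>

definition in_dual ::
    "('v::complex_hilbert \<Rightarrow> 'h::complex_hilbert) \<Rightarrow> (real \<Rightarrow> 'v) \<Rightarrow> real \<Rightarrow> 'v antidual" where
  "in_dual j u t = dual_embedding j (j (u t))"

definition MR ::
    "real \<Rightarrow> ('v::{complex_hilbert, second_countable_topology} \<Rightarrow> 'h::complex_hilbert) \<Rightarrow>
      (real \<Rightarrow> 'v) \<Rightarrow> bool" where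
  "MR T j u \<longleftrightarrow> H1 T u \<and> H2 T (in_dual j u)"

definition MR_norm ::
    "real \<Rightarrow> ('v::{complex_hilbert, second_countable_topology} \<Rightarrow> 'h::complex_hilbert) \<Rightarrow>
      (real \<Rightarrow> 'v) \<Rightarrow> real" where
  "MR_norm T j u =
    sqrt ((L2_norm T u)\<^sup>2 + (L2_norm T (wderiv T u))\<^sup>2 + (L2_norm T (wderiv T (wderiv T (in_dual j u))))\<^sup>2)"

text \<open>The value at \<open>0\<close> is that of the representative which is continuous on \<open>[0,T]\<close>.\<close>

definition has_initial_value :: "real \<Rightarrow> (real \<Rightarrow> 'x::real_normed_vector) \<Rightarrow> 'x \<Rightarrow> bool" where
  "has_initial_value T u x \<longleftrightarrow>
    (\<exists>g. continuous_on {0..T} g \<and> (AE t in lebesgue_on {0<..<T}. u t = g t) \<and> g 0 = x)"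

definition solves_cauchy_problem ::
    "real \<Rightarrow> ('v::{complex_hilbert, second_countable_topology} \<Rightarrow> 'h::complex_hilbert) \<Rightarrow>
      (real \<Rightarrow> 'v \<Rightarrow> 'v antidual) \<Rightarrow> (real \<Rightarrow> 'v \<Rightarrow> 'v antidual) \<Rightarrow>
      (real \<Rightarrow> 'v antidual) \<Rightarrow> 'v \<Rightarrow> 'h \<Rightarrow> (real \<Rightarrow> 'v) \<Rightarrow> bool" where
  "solves_cauchy_problem T j A B f u0 u1 u \<longleftrightarrow>
    (AE t in lebesgue_on {0<..<T}.
      wderiv T (wderiv T (in_dual j u)) t + B t (wderiv T u t) + A t (u t) = f t) \<and>
    has_initial_value T u u0 \<and>
    has_initial_value T (\<lambda>t. j (wderiv T u t)) u1"

end

theory Submission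
  imports Defs
begin

text \<open>
  Identify the antidual of \<open>V\<close> with \<open>V\<close> by Riesz, so that \<open>V\<close> embeds into its antidual by
  \<open>J = j\<^sup>* j\<close>, a bounded positive operator on \<open>V\<close>. Integrated once in time, the problem for
  the velocity \<open>v = u'\<close> reads \<open>J v(t) = j\<^sup>* u\<^sub>1 + \<integral>\<^sub>0\<^sup>t (f - B v - A (u\<^sub>0 + \<integral> v))\<close>. After
  substituting \<open>v = exp(\<gamma> t) w\<close> with \<open>\<gamma>\<close> large, \<open>B\<close> becomes coercive on \<open>V\<close> and the memory term a
  small perturbation, so \<open>w\<close> solves a first order problem with an operator that is coercive on
  \<open>L\<^sup>2(0,T;V)\<close>. Existence is Lions' representation lemma, tested with \<open>\<phi>(t) = \<integral>\<^sub>t\<^sup>T \<psi>\<close>. Uniqueness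
  and the estimate follow from the energy identity
  \<open>|v(t)|\<^sup>2 - |v(0)|\<^sup>2 = 2 \<integral>\<^sub>0\<^sup>t \<langle>(J v)', v\<rangle>\<close>, which together with the continuity of \<open>v\<close> in \<open>H\<close>
  is proved by regularizing in space with a Neumann series for the inverse of \<open>J\<close>; no mollification
  in time is needed.
\<close>

section \<open>Square integrable functions\<close>

text \<open>A complex Hilbert space is treated as a real one with the real part of its inner
  product. An antilinear functional is determined by its real part, and so is a sesquilinear form;
  hence the equation is solved for the real parts of the forms and read back in the antidual only at
  the end. The obstacle is the chain rule for the squared \<open>H\<close>-norm of \<open>v\<close>:
  the derivative of \<open>J v\<close> is represented in \<open>V\<close>, but \<open>J\<close> has
  no bounded inverse in general, so \<open>v\<close> itself has no derivative. Polynomials in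
  \<open>J\<close> commute with \<open>J\<close>. Applied to the integrated equation they give
  absolutely continuous \<open>V\<close>-valued curves, to which the elementary chain rule applies,
  and their products with \<open>J\<close> are uniformly bounded and tend strongly to the identity.
  Integrating once also turns the initial velocity into an additive constant, so that existence
  becomes one equation \<open>\<Lambda> v = h\<close> in a fixed Hilbert space. The factor
  \<open>exp(\<gamma> t)\<close> contributes \<open>\<gamma> J\<close> to the operator, which
  absorbs the \<open>\<omega>\<close>-term in the coercivity of \<open>b\<close>, and leaves a
  memory term of norm at most \<open>Ka / \<gamma>\<close>.\<close>

abbreviation leb :: "real \<Rightarrow> real measure" where
  "leb T \<equiv> lebesgue_on {0<..<T}"

text \<open>The measure is a parameter because both the interval \<open>(0,T)\<close> and the whole
  line occur below.\<close>

definition sq_integrable ::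
    "'a measure \<Rightarrow> ('a \<Rightarrow> 'b::{banach, second_countable_topology}) \<Rightarrow> bool" where
  "sq_integrable M f \<longleftrightarrow> f \<in> borel_measurable M \<and> integrable M (\<lambda>x. (norm (f x))\<^sup>2)"

definition norm_L2 ::
    "'a measure \<Rightarrow> ('a \<Rightarrow> 'b::{banach, second_countable_topology}) \<Rightarrow> real" where
  "norm_L2 M f = sqrt (\<integral>x. (norm (f x))\<^sup>2 \<partial>M)"

lemma L2_iff: "L2 T f \<longleftrightarrow> sq_integrable (leb T) f"
  by (simp add: L2_def sq_integrable_def)

lemma L2_norm_eq: "L2_norm T f = norm_L2 (leb T) f"
  by (simp add: L2_norm_def norm_L2_def)

lemma sq_integrable_measurable [measurable_dest]: "sq_integrable M f \<Longrightarrow> f \<in> borel_measurable M"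
  by (simp add: sq_integrable_def)

lemma sq_integrable_norm_sq: "sq_integrable M f \<Longrightarrow> integrable M (\<lambda>x. (norm (f x))\<^sup>2)"
  by (simp add: sq_integrable_def)

lemma norm_L2_nonneg [simp]: "0 \<le> norm_L2 M f"
  by (simp add: norm_L2_def)

lemma norm_L2_sq: "(norm_L2 M f)\<^sup>2 = (\<integral>x. (norm (f x))\<^sup>2 \<partial>M)"
  by (simp add: norm_L2_def)

lemma sq_integrable_dominated:
  assumes f: "sq_integrable M f" and g: "g \<in> borel_measurable M"
    and le: "AE x in M. norm (g x) \<le> K * norm (f x)"
  shows "sq_integrable M g" and "norm_L2 M g \<le> \<bar>K\<bar> * norm_L2 M f"
proof -
  have le2: "AE x in M. (norm (g x))\<^sup>2 \<le> K\<^sup>2 * (norm (f x))\<^sup>2"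
    using le by eventually_elim (metis norm_ge_zero power_mono power_mult_distrib)
  have i: "integrable M (\<lambda>x. K\<^sup>2 * (norm (f x))\<^sup>2)"
    using f by (simp add: sq_integrable_def)
  have ig: "integrable M (\<lambda>x. (norm (g x))\<^sup>2)"
    by (rule Bochner_Integration.integrable_bound[OF i]) (use g le2 in auto)
  then show "sq_integrable M g" using g by (simp add: sq_integrable_def)
  have "(\<integral>x. (norm (g x))\<^sup>2 \<partial>M) \<le> K\<^sup>2 * (\<integral>x. (norm (f x))\<^sup>2 \<partial>M)"
    using integral_mono_AE[OF ig i le2] by simp
  then have "sqrt (\<integral>x. (norm (g x))\<^sup>2 \<partial>M) \<le> sqrt (K\<^sup>2 * (\<integral>x. (norm (f x))\<^sup>2 \<partial>M))"
    by (rule real_sqrt_le_mono)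
  then show "norm_L2 M g \<le> \<bar>K\<bar> * norm_L2 M f"
    by (simp add: norm_L2_def real_sqrt_mult)
qed

lemma sq_integrable_scaleR: "sq_integrable M f \<Longrightarrow> sq_integrable M (\<lambda>x. r *\<^sub>R f x)"
  by (rule sq_integrable_dominated(1)[where f = f and K = "\<bar>r\<bar>"])
    (auto simp: sq_integrable_def intro: borel_measurable_scaleR)

lemma sq_integrable_add:
  assumes "sq_integrable M f" "sq_integrable M g"
  shows "sq_integrable M (\<lambda>x. f x + g x)"
proof -
  have [measurable]: "f \<in> borel_measurable M" "g \<in> borel_measurable M"
    using assms by (auto simp: sq_integrable_def)
  have i: "integrable M (\<lambda>x. 2 * (norm (f x))\<^sup>2 + 2 * (norm (g x))\<^sup>2)"
    using assms by (simp add: sq_integrable_def)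
  have "(norm (f x + g x))\<^sup>2 \<le> 2 * (norm (f x))\<^sup>2 + 2 * (norm (g x))\<^sup>2" for x
  proof -
    have "(norm (f x + g x))\<^sup>2 \<le> (norm (f x) + norm (g x))\<^sup>2"
      by (simp add: norm_triangle_ineq power_mono)
    also have "\<dots> \<le> 2 * (norm (f x))\<^sup>2 + 2 * (norm (g x))\<^sup>2"
      using zero_le_power2[of "norm (f x) - norm (g x)"] by (simp add: power2_eq_square algebra_simps)
    finally show ?thesis .
  qed
  then have "integrable M (\<lambda>x. (norm (f x + g x))\<^sup>2)"
    by (intro Bochner_Integration.integrable_bound[OF i]) auto
  then show ?thesis by (simp add: sq_integrable_def)
qed

lemma sq_integrable_minus: "sq_integrable M f \<Longrightarrow> sq_integrable M (\<lambda>x. - f x)"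
  using sq_integrable_scaleR[of M f "-1"] by simp

lemma sq_integrable_diff:
  "sq_integrable M f \<Longrightarrow> sq_integrable M g \<Longrightarrow> sq_integrable M (\<lambda>x. f x - g x)"
  using sq_integrable_add[of M f "\<lambda>x. - g x"] sq_integrable_minus[of M g] by simp

lemma sq_integrable_zero [simp]: "sq_integrable M (\<lambda>x. 0)"
  by (simp add: sq_integrable_def)

lemma sq_integrable_bounded_linear:
  fixes L :: "'b::{banach, second_countable_topology} \<Rightarrow> 'c::{banach, second_countable_topology}"
  assumes "bounded_linear L" "sq_integrable M f"
  shows "sq_integrable M (\<lambda>x. L (f x))"
proof -
  obtain K where K: "\<And>v. norm (L v) \<le> norm v * K"
    using bounded_linear.bounded[OF assms(1)] by blast
  have "L \<in> borel_measurable borel"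
    by (intro borel_measurable_continuous_onI linear_continuous_on assms(1))
  then have "(\<lambda>x. L (f x)) \<in> borel_measurable M"
    using assms(2) by (intro measurable_compose[of f M borel L]) (auto simp: sq_integrable_def)
  with K show ?thesis
    by (intro sq_integrable_dominated(1)[OF assms(2), where K = K]) (auto simp: mult.commute)
qed

lemma sq_integrable_mult:
  assumes "sq_integrable M f" "sq_integrable M g"
  shows "integrable M (\<lambda>x. norm (f x) * norm (g x))"
proof -
  have i: "integrable M (\<lambda>x. (norm (f x))\<^sup>2 + (norm (g x))\<^sup>2)"
    using assms by (simp add: sq_integrable_def)
  have "norm (f x) * norm (g x) \<le> (norm (f x))\<^sup>2 + (norm (g x))\<^sup>2" for x
  proof -
    have "2 * (norm (f x) * norm (g x)) \<le> (norm (f x))\<^sup>2 + (norm (g x))\<^sup>2"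
      using zero_le_power2[of "norm (f x) - norm (g x)"] by (simp add: power2_eq_square algebra_simps)
    moreover have "0 \<le> norm (f x) * norm (g x)" by simp
    ultimately show ?thesis by linarith
  qed
  moreover have "(\<lambda>x. norm (f x) * norm (g x)) \<in> borel_measurable M"
    using assms[THEN sq_integrable_measurable] by measurable
  ultimately show ?thesis
    by (intro Bochner_Integration.integrable_bound[OF i]) auto
qed

lemma borel_measurable_bilinear:
  fixes f :: "'a \<Rightarrow> 'b::{real_normed_vector, second_countable_topology}"
    and g :: "'a \<Rightarrow> 'c::{real_normed_vector, second_countable_topology}"
  assumes B: "bounded_bilinear B" and "f \<in> borel_measurable M" "g \<in> borel_measurable M"
  shows "(\<lambda>x. B (f x) (g x)) \<in> borel_measurable M"
proof (rule borel_measurable_continuous_Pair[OF assms(2,3)])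
  show "continuous_on UNIV (\<lambda>x. B (fst x) (snd x))"
    by (intro bounded_bilinear.continuous_on[OF B] continuous_intros)
qed

lemma sq_integrable_bilinear:
  fixes B :: "'b::{banach, second_countable_topology} \<Rightarrow> 'c::{banach, second_countable_topology} \<Rightarrow>
    'd::{banach, second_countable_topology}"
  assumes B: "bounded_bilinear B" and fg: "sq_integrable M f" "sq_integrable M g"
  shows "integrable M (\<lambda>x. B (f x) (g x))"
proof -
  obtain K where K: "\<And>a b. norm (B a b) \<le> norm a * norm b * K"
    using bounded_bilinear.bounded[OF B] by blast
  have i: "integrable M (\<lambda>x. norm (f x) * norm (g x) * K)"
    using sq_integrable_mult[OF fg] by simp
  have "norm (B (f x) (g x)) \<le> norm (norm (f x) * norm (g x) * K)" for x
    using K[of "f x" "g x"] by (metis abs_ge_self order.trans real_norm_def)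
  moreover have "(\<lambda>x. B (f x) (g x)) \<in> borel_measurable M"
    using fg by (auto simp: sq_integrable_def intro!: borel_measurable_bilinear[OF B])
  ultimately show ?thesis
    by (intro Bochner_Integration.integrable_bound[OF i] AE_I2)
qed

lemma sq_integrable_inner:
  fixes f g :: "'a \<Rightarrow> 'b::{real_inner, banach, second_countable_topology}"
  assumes "sq_integrable M f" "sq_integrable M g"
  shows "integrable M (\<lambda>x. inner (f x) (g x))"
  by (rule sq_integrable_bilinear[OF bounded_bilinear_inner assms])

lemma norm_L2_Cauchy_Schwarz:
  assumes fg: "sq_integrable M f" "sq_integrable M g"
  shows "(\<integral>x. norm (f x) * norm (g x) \<partial>M) \<le> norm_L2 M f * norm_L2 M g"
proof -
  define A B C where "A = (\<integral>x. (norm (f x))\<^sup>2 \<partial>M)" and "B = (\<integral>x. (norm (g x))\<^sup>2 \<partial>M)"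
    and "C = (\<integral>x. norm (f x) * norm (g x) \<partial>M)"
  note i = sq_integrable_norm_sq[OF fg(1)] sq_integrable_norm_sq[OF fg(2)]
    sq_integrable_mult[OF fg]
  have "B \<ge> 0" "C \<ge> 0" "A \<ge> 0" unfolding A_def B_def C_def by (auto intro!: integral_nonneg_AE)
  have "C\<^sup>2 \<le> A * B"
  proof (cases "B = 0")
    case True
    then have "AE x in M. (norm (g x))\<^sup>2 = 0"
      using integral_nonneg_eq_0_iff_AE[OF i(2)] by (simp add: B_def)
    then have "C = 0" unfolding C_def by (intro integral_eq_zero_AE) auto
    then show ?thesis using True by simp
  next
    case False
    \<comment> \<open>The value of \<open>s\<close> that minimizes the mean square of
      \<open>norm (f x) - s * norm (g x)\<close>; the minimum \<open>A - C\<^sup>2 / B\<close> is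
      nonnegative.\<close>
    define s where "s = C / B"
    have "0 \<le> (\<integral>x. (norm (f x) - s * norm (g x))\<^sup>2 \<partial>M)" by (rule integral_nonneg_AE) simp
    also have "\<dots> = (\<integral>x. (norm (f x))\<^sup>2 - 2 * s * (norm (f x) * norm (g x)) + s\<^sup>2 * (norm (g x))\<^sup>2 \<partial>M)"
      by (rule Bochner_Integration.integral_cong) (auto simp: power2_eq_square algebra_simps)
    also have "\<dots> = A - 2 * s * C + s\<^sup>2 * B"
      using i by (simp add: A_def B_def C_def)
    also have "\<dots> = A - C\<^sup>2 / B" using False by (simp add: s_def power2_eq_square field_simps)
    finally show ?thesis using False \<open>B \<ge> 0\<close> by (simp add: field_simps)
  qed
  then have "sqrt (C\<^sup>2) \<le> sqrt (A * B)" by (rule real_sqrt_le_mono)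
  then show ?thesis using \<open>C \<ge> 0\<close> by (simp add: A_def B_def C_def norm_L2_def real_sqrt_mult)
qed

lemma integral_inner_le:
  fixes f g :: "'a \<Rightarrow> 'b::{real_inner, banach, second_countable_topology}"
  assumes fg: "sq_integrable M f" "sq_integrable M g"
  shows "\<bar>\<integral>x. inner (f x) (g x) \<partial>M\<bar> \<le> norm_L2 M f * norm_L2 M g"
proof -
  have "\<bar>\<integral>x. inner (f x) (g x) \<partial>M\<bar> \<le> (\<integral>x. \<bar>inner (f x) (g x)\<bar> \<partial>M)"
    by (rule integral_abs_bound)
  also have "\<dots> \<le> (\<integral>x. norm (f x) * norm (g x) \<partial>M)"
    by (intro integral_mono integrable_abs sq_integrable_inner fg sq_integrable_mult
        Cauchy_Schwarz_ineq2)
  finally show ?thesis using norm_L2_Cauchy_Schwarz[OF fg] by linarith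
qed

lemma norm_L2_triangle:
  assumes fg: "sq_integrable M f" "sq_integrable M g"
  shows "norm_L2 M (\<lambda>x. f x + g x) \<le> norm_L2 M f + norm_L2 M g"
proof (rule power2_le_imp_le)
  note i = sq_integrable_norm_sq[OF fg(1)] sq_integrable_norm_sq[OF fg(2)]
    sq_integrable_mult[OF fg]
  have "(norm_L2 M (\<lambda>x. f x + g x))\<^sup>2 \<le>
      (\<integral>x. (norm (f x))\<^sup>2 + 2 * (norm (f x) * norm (g x)) + (norm (g x))\<^sup>2 \<partial>M)"
    unfolding norm_L2_sq
  proof (rule integral_mono)
    show "integrable M (\<lambda>x. (norm (f x + g x))\<^sup>2)"
      using sq_integrable_add[OF fg] by (rule sq_integrable_norm_sq)
    show "(norm (f x + g x))\<^sup>2 \<le> (norm (f x))\<^sup>2 + 2 * (norm (f x) * norm (g x)) + (norm (g x))\<^sup>2" for x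
      using power_mono[OF norm_triangle_ineq[of "f x" "g x"], of 2]
      by (simp add: power2_sum algebra_simps)
  qed (use i in simp)
  also have "\<dots> = (norm_L2 M f)\<^sup>2 + 2 * (\<integral>x. norm (f x) * norm (g x) \<partial>M) + (norm_L2 M g)\<^sup>2"
    using i by (simp add: norm_L2_sq)
  also have "\<dots> \<le> (norm_L2 M f + norm_L2 M g)\<^sup>2"
    using norm_L2_Cauchy_Schwarz[OF fg] by (simp add: power2_sum)
  finally show "(norm_L2 M (\<lambda>x. f x + g x))\<^sup>2 \<le> (norm_L2 M f + norm_L2 M g)\<^sup>2" .
qed simp

lemma norm_L2_scaleR: "norm_L2 M (\<lambda>x. r *\<^sub>R f x) = \<bar>r\<bar> * norm_L2 M f"
  by (simp add: norm_L2_def power_mult_distrib real_sqrt_mult)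

lemma norm_L2_minus [simp]: "norm_L2 M (\<lambda>x. - f x) = norm_L2 M f"
  by (simp add: norm_L2_def)

lemma norm_L2_diff:
  assumes fg: "sq_integrable M f" "sq_integrable M g"
  shows "norm_L2 M (\<lambda>x. f x - g x) \<le> norm_L2 M f + norm_L2 M g"
  using norm_L2_triangle[OF fg(1) sq_integrable_minus[OF fg(2)]] by simp

lemma norm_L2_cong_AE:
  assumes "AE x in M. f x = g x" "f \<in> borel_measurable M" "g \<in> borel_measurable M"
  shows "norm_L2 M f = norm_L2 M g"
proof -
  have "AE x in M. (norm (f x))\<^sup>2 = (norm (g x))\<^sup>2"
    using assms(1) by eventually_elim simp
  moreover have "(\<lambda>x. (norm (f x))\<^sup>2) \<in> borel_measurable M" "(\<lambda>x. (norm (g x))\<^sup>2) \<in> borel_measurable M"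
    using assms(2,3) by measurable
  ultimately have "(\<integral>x. (norm (f x))\<^sup>2 \<partial>M) = (\<integral>x. (norm (g x))\<^sup>2 \<partial>M)"
    by (intro integral_cong_AE)
  then show ?thesis by (simp add: norm_L2_def)
qed

lemma norm_L2_eq_0:
  assumes "sq_integrable M f" "norm_L2 M f = 0"
  shows "AE x in M. f x = 0"
  using assms integral_nonneg_eq_0_iff_AE[OF sq_integrable_norm_sq[OF assms(1)]]
  by (simp add: norm_L2_def)

lemma (in finite_measure) sq_integrable_const [simp]: "sq_integrable M (\<lambda>x. c)"
  by (simp add: sq_integrable_def)

lemma (in finite_measure) sq_integrable_imp_integrable:
  assumes "sq_integrable M f"
  shows "integrable M f"
  using sq_integrable_bilinear[OF bounded_bilinear_scaleR sq_integrable_const[of "1::real"] assms]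
  by simp

lemma (in finite_measure) sq_integrable_bounded:
  assumes "f \<in> borel_measurable M" "\<And>x. x \<in> space M \<Longrightarrow> norm (f x) \<le> K"
  shows "sq_integrable M f"
  using assms
  by (intro sq_integrable_dominated(1)[OF sq_integrable_const[of "1::real"], where K = K]) auto


section \<open>Primitives\<close>

text \<open>The integral runs over the whole interval against an indicator. So the primitive is
  defined on all of the line, constant on either side of \<open>(0,T)\<close>, and dominated
  convergence and Fubini act on one fixed measure.\<close>

definition prim :: "real \<Rightarrow> (real \<Rightarrow> 'b::{banach, second_countable_topology}) \<Rightarrow> real \<Rightarrow> 'b" where
  "prim T g t = (\<integral>s. indicator {..t} s *\<^sub>R g s \<partial>leb T)"

lemma finite_measure_interval: "finite_measure (lebesgue_on {0<..<T::real})"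
  using finite_measure_lebesgue_on[of "box 0 T"] by (simp add: box_real)

lemma borel_measurable_lebesgue_onI:
  fixes f :: "'a::euclidean_space \<Rightarrow> 'b::topological_space"
  shows "f \<in> borel_measurable borel \<Longrightarrow> f \<in> borel_measurable (lebesgue_on S)"
  by (rule measurable_restrict_space1) (rule measurable_completion, simp)


lemma AE_lebesgue_on_ne: "AE s in lebesgue_on {0<..<T::real}. s \<noteq> t"
proof -
  have "AE s in lebesgue. s \<noteq> t"
    by (rule AE_completion) (rule AE_lborel_singleton)
  then show ?thesis by (subst AE_restrict_space_iff) auto
qed

lemma AE_lebesgue_onI: "(\<And>s. s \<in> S \<Longrightarrow> P s) \<Longrightarrow> AE s in lebesgue_on S. P s"
  by (rule AE_I2) simp

lemma prim_indicator_integrable: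
  fixes g :: "real \<Rightarrow> 'b::{banach, second_countable_topology}"
  assumes "integrable (leb T) g"
  shows "integrable (leb T) (\<lambda>s. indicator {..t} s *\<^sub>R g s)"
proof -
  have "{0<..<T} \<inter> {..t} \<in> sets (leb T)"
    by (subst sets_restrict_space) auto
  then have "integrable (leb T) (\<lambda>s. indicator ({0<..<T} \<inter> {..t}) s *\<^sub>R g s)"
    by (rule integrable_mult_indicator) (rule assms)
  also have "?this \<longleftrightarrow> ?thesis"
    by (rule Bochner_Integration.integrable_cong) (auto simp: indicator_def)
  finally show ?thesis .
qed

lemma prim_add:
  fixes f g :: "real \<Rightarrow> 'b::{banach, second_countable_topology}"
  assumes "integrable (leb T) f" "integrable (leb T) g"
  shows "prim T (\<lambda>s. f s + g s) t = prim T f t + prim T g t"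
  unfolding prim_def using assms[THEN prim_indicator_integrable]
  by (simp add: scaleR_add_right)

lemma prim_diff:
  fixes f g :: "real \<Rightarrow> 'b::{banach, second_countable_topology}"
  assumes "integrable (leb T) f" "integrable (leb T) g"
  shows "prim T (\<lambda>s. f s - g s) t = prim T f t - prim T g t"
  unfolding prim_def using assms[THEN prim_indicator_integrable]
  by (simp add: scaleR_diff_right)

lemma prim_bounded_linear:
  fixes L :: "'b::{banach, second_countable_topology} \<Rightarrow> 'c::{banach, second_countable_topology}"
  assumes "bounded_linear L" "integrable (leb T) g"
  shows "prim T (\<lambda>s. L (g s)) t = L (prim T g t)"
  unfolding prim_def
  using integral_bounded_linear[OF assms(1) prim_indicator_integrable[OF assms(2), of t]]
  by (simp add: linear_scale[OF bounded_linear.linear[OF assms(1)]])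

lemma prim_scaleR:
  fixes g :: "real \<Rightarrow> 'b::{banach, second_countable_topology}"
  shows "prim T (\<lambda>s. r *\<^sub>R g s) t = r *\<^sub>R prim T g t"
proof -
  have "(\<lambda>s. indicator {..t} s *\<^sub>R r *\<^sub>R g s) = (\<lambda>s. r *\<^sub>R indicator {..t} s *\<^sub>R g s)"
    by (simp add: fun_eq_iff mult.commute)
  then show ?thesis unfolding prim_def by (simp only: integral_scaleR_right)
qed

lemma prim_cong_AE:
  fixes f g :: "real \<Rightarrow> 'b::{banach, second_countable_topology}"
  assumes "AE s in leb T. f s = g s"
    and "integrable (leb T) f" "integrable (leb T) g"
  shows "prim T f t = prim T g t"
  unfolding prim_def
proof (rule integral_cong_AE)
  show "AE s in leb T. indicator {..t} s *\<^sub>R f s = indicator {..t} s *\<^sub>R g s"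
    using assms(1) by eventually_elim simp
qed (use assms(2,3)[THEN prim_indicator_integrable] in \<open>auto intro: borel_measurable_integrable\<close>)

lemma prim_0: "t \<le> 0 \<Longrightarrow> prim T g t = 0"
  unfolding prim_def by (rule integral_eq_zero_AE) (auto intro!: AE_lebesgue_onI simp: indicator_def)

lemma prim_end: "T \<le> t \<Longrightarrow> prim T g t = integral\<^sup>L (leb T) g"
  unfolding prim_def by (rule Bochner_Integration.integral_cong) (auto simp: indicator_def)

lemma norm_prim_le:
  fixes g :: "real \<Rightarrow> 'b::{banach, second_countable_topology}"
  assumes "integrable (leb T) g"
  shows "norm (prim T g t) \<le> (\<integral>s. norm (g s) \<partial>leb T)"
proof -
  have "norm (prim T g t) \<le> (\<integral>s. norm (indicator {..t} s *\<^sub>R g s) \<partial>leb T)"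
    unfolding prim_def by (rule integral_norm_bound)
  also have "\<dots> \<le> (\<integral>s. norm (g s) \<partial>leb T)"
    by (rule integral_mono[OF integrable_norm[OF prim_indicator_integrable] integrable_norm])
      (auto intro: assms simp: indicator_def)
  finally show ?thesis .
qed

text \<open>Dominated convergence along a sequence: the indicators of \<open>{..x n}\<close>
  converge to that of \<open>{..t}\<close> at every \<open>s\<close> except possibly
  \<open>s = t\<close>, a null set.\<close>

lemma continuous_on_prim:
  fixes g :: "real \<Rightarrow> 'b::{banach, second_countable_topology}"
  assumes g: "integrable (leb T) g"
  shows "continuous_on S (prim T g)"
proof -
  have "isCont (prim T g) t" for t
    unfolding continuous_at_sequentially
  proof (intro allI impI)
    fix x :: "nat \<Rightarrow> real" assume x: "x \<longlonglongrightarrow> t"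
    show "(prim T g \<circ> x) \<longlonglongrightarrow> prim T g t"
      unfolding prim_def o_def
    proof (rule integral_dominated_convergence[where w = "\<lambda>s. norm (g s)"])
      show "AE s in leb T.
          (\<lambda>n. indicator {..x n} s *\<^sub>R g s) \<longlonglongrightarrow> indicator {..t} s *\<^sub>R g s"
        using AE_lebesgue_on_ne[where T = T and t = t]
      proof eventually_elim
        case (elim s)
        have "eventually (\<lambda>n. indicator {..t} s *\<^sub>R g s = indicator {..x n} s *\<^sub>R g s) sequentially"
        proof (cases "s < t")
          case True
          show ?thesis
            using order_tendstoD(1)[OF x True]
            by (rule eventually_mono) (use True in \<open>simp add: indicator_def\<close>)
        next
          case False
          with elim have "t < s" by simp
          show ?thesis
            using order_tendstoD(2)[OF x \<open>t < s\<close>]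
            by (rule eventually_mono) (use \<open>t < s\<close> in \<open>simp add: indicator_def\<close>)
        qed
        then show ?case by (rule Lim_transform_eventually[OF tendsto_const])
      qed
      show "integrable (leb T) (\<lambda>s. norm (g s))" using g by simp
      show "AE s in leb T. norm (indicator {..x n} s *\<^sub>R g s) \<le> norm (g s)" for n
        by (rule AE_I2) (simp add: indicator_def)
    qed (rule borel_measurable_integrable[OF prim_indicator_integrable[OF g]])+
  qed
  then show ?thesis by (simp add: continuous_at_imp_continuous_on)
qed

lemma borel_measurable_prim:
  fixes g :: "real \<Rightarrow> 'b::{banach, second_countable_topology}"
  assumes "integrable (leb T) g"
  shows "prim T g \<in> borel_measurable (lebesgue_on S)"
  by (intro borel_measurable_lebesgue_onI borel_measurable_continuous_onI continuous_on_prim assms)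

lemma sq_integrable_prim:
  fixes g :: "real \<Rightarrow> 'b::{banach, second_countable_topology}"
  assumes "integrable (leb T) g"
  shows "sq_integrable (leb T) (prim T g)"
  using finite_measure.sq_integrable_bounded[OF finite_measure_interval
      borel_measurable_prim[OF assms] norm_prim_le[OF assms]] .

lemma norm_prim_le_L2:
  fixes g :: "real \<Rightarrow> 'b::{banach, second_countable_topology}"
  assumes T: "0 \<le> T" and g: "sq_integrable (leb T) g"
  shows "norm (prim T g t) \<le> sqrt T * norm_L2 (leb T) g"
proof -
  interpret finite_measure "leb T" by (rule finite_measure_interval)
  have "norm (prim T g t) \<le> (\<integral>s. norm (1::real) * norm (g s) \<partial>leb T)"
    using norm_prim_le[OF sq_integrable_imp_integrable[OF g]] by simp
  also have "\<dots> \<le> norm_L2 (leb T) (\<lambda>_. 1::real) * norm_L2 (leb T) g"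
    by (rule norm_L2_Cauchy_Schwarz) (simp_all add: g)
  also have "norm_L2 (leb T) (\<lambda>_. 1::real) = sqrt T"
    using T by (simp add: norm_L2_def measure_restrict_space)
  finally show ?thesis .
qed

section \<open>Integration by parts for primitives, by Fubini\<close>

lemma integrable_pair_bilinear:
  fixes B :: "'b::{banach, second_countable_topology} \<Rightarrow> 'c::{banach, second_countable_topology} \<Rightarrow>
    'd::{banach, second_countable_topology}"
  assumes B: "bounded_bilinear B" and M: "sigma_finite_measure M"
    and f: "integrable M f" and g: "integrable M g"
  shows "integrable (M \<Otimes>\<^sub>M M) (\<lambda>(s, r). B (f s) (g r))"
proof -
  interpret M: sigma_finite_measure M by (rule M)
  interpret MM: pair_sigma_finite M M ..
  have [measurable]: "f \<in> borel_measurable M" "g \<in> borel_measurable M" using f g by auto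
  obtain K where K: "\<And>a b. norm (B a b) \<le> norm a * norm b * K"
    using bounded_bilinear.bounded[OF B] by blast
  have i: "integrable (M \<Otimes>\<^sub>M M) (\<lambda>(s, r). norm (f s) * norm (g r) * K)"
  proof (rule MM.Fubini_integrable)
    show "(\<lambda>(s, r). norm (f s) * norm (g r) * K) \<in> borel_measurable (M \<Otimes>\<^sub>M M)"
      by measurable
    show "AE s in M. integrable M (\<lambda>r. case (s, r) of (s, r) \<Rightarrow> norm (f s) * norm (g r) * K)"
      using g by simp
    show "integrable M (\<lambda>s. \<integral>r. norm (case (s, r) of (s, r) \<Rightarrow> norm (f s) * norm (g r) * K) \<partial>M)"
      using f g by (simp add: abs_mult)
  qed
  show ?thesis
  proof (rule Bochner_Integration.integrable_bound[OF i])
    have "(\<lambda>p. B (f (fst p)) (g (snd p))) \<in> borel_measurable (M \<Otimes>\<^sub>M M)"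
      by (rule borel_measurable_bilinear[OF B]) measurable
    then show "(\<lambda>(s, r). B (f s) (g r)) \<in> borel_measurable (M \<Otimes>\<^sub>M M)"
      by (simp add: split_beta)
    show "AE p in M \<Otimes>\<^sub>M M. norm (case p of (s, r) \<Rightarrow> B (f s) (g r)) \<le>
        norm (case p of (s, r) \<Rightarrow> norm (f s) * norm (g r) * K)"
      using K by (auto intro!: AE_I2 intro: order_trans[OF _ abs_ge_self] simp: split_beta)
  qed
qed

text \<open>Integration by parts without differentiation: the left side is a double integral over a
  square, which the diagonal cuts into the triangles \<open>r \<le> s\<close> and
  \<open>s < r\<close>. Fubini, integrating first in the smaller variable, yields the two
  terms.\<close>

lemma integral_bilinear_prim:
  fixes B :: "'b::{banach, second_countable_topology} \<Rightarrow> 'c::{banach, second_countable_topology} \<Rightarrow>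
    'd::{banach, second_countable_topology}"
  assumes B: "bounded_bilinear B"
    and f: "integrable (leb T) f" and g: "integrable (leb T) g"
  defines "M \<equiv> leb T"
  shows "B (\<integral>s. f s \<partial>M) (\<integral>s. g s \<partial>M) =
    (\<integral>s. B (f s) (prim T g s) \<partial>M) + (\<integral>s. B (prim T f s) (g s) \<partial>M)"
proof -
  interpret M: finite_measure M unfolding M_def by (rule finite_measure_interval)
  interpret MM: pair_sigma_finite M M ..
  note f' = f[folded M_def] and g' = g[folded M_def]
  have sb: "space M = {0<..<T}" by (simp add: M_def)
  have [measurable]: "(\<lambda>x. x) \<in> borel_measurable M"
    unfolding M_def by (rule borel_measurable_lebesgue_onI) simp
  have le [measurable]: "{p \<in> space (M \<Otimes>\<^sub>M M). snd p \<le> fst p} \<in> sets (M \<Otimes>\<^sub>M M)"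
    "{p \<in> space (M \<Otimes>\<^sub>M M). fst p < snd p} \<in> sets (M \<Otimes>\<^sub>M M)"
    by (rule borel_measurable_le borel_measurable_less; measurable)+
  note h = integrable_pair_bilinear[OF B M.sigma_finite_measure_axioms f' g']
  have l: "integrable (M \<Otimes>\<^sub>M M) (\<lambda>(s, r). indicator {..s} r *\<^sub>R B (f s) (g r))"
    by (rule iffD1[OF Bochner_Integration.integrable_cong[OF refl]
          integrable_mult_indicator[OF le(1) h]]) (auto simp: indicator_def)
  have u: "integrable (M \<Otimes>\<^sub>M M) (\<lambda>(s, r). indicator {..<r} s *\<^sub>R B (f s) (g r))"
    by (rule iffD1[OF Bochner_Integration.integrable_cong[OF refl]
          integrable_mult_indicator[OF le(2) h]]) (auto simp: indicator_def)
  note lin_r = bounded_bilinear.bounded_linear_right[OF B]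
    and lin_l = bounded_bilinear.bounded_linear_left[OF B]
  have L: "(\<integral>r. indicator {..s} r *\<^sub>R B (f s) (g r) \<partial>M) = B (f s) (prim T g s)" for s
    using integral_bounded_linear[OF lin_r[of "f s"] prim_indicator_integrable[OF g, where t = s]]
    by (simp add: M_def prim_def bounded_bilinear.scaleR_right[OF B])
  \<comment> \<open>The two triangles must be disjoint, so this one is strict, while
    \<open>prim\<close> uses the closed half-line; the difference is the null set
    \<open>s = r\<close>.\<close>
  have U: "(\<integral>s. indicator {..<r} s *\<^sub>R B (f s) (g r) \<partial>M) = B (prim T f r) (g r)" for r
  proof -
    have "(\<integral>s. indicator {..<r} s *\<^sub>R B (f s) (g r) \<partial>M) = (\<integral>s. B (indicator {..r} s *\<^sub>R f s) (g r) \<partial>M)"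
    proof (rule integral_cong_AE)
      show "AE s in M. indicator {..<r} s *\<^sub>R B (f s) (g r) = B (indicator {..r} s *\<^sub>R f s) (g r)"
        using AE_lebesgue_on_ne[where T = T and t = r] unfolding M_def
        by eventually_elim (auto simp: indicator_def bounded_bilinear.zero_left[OF B])
      have "(\<lambda>s. B (f s) (g r)) \<in> borel_measurable M"
        by (rule borel_measurable_bilinear[OF B]) (use f' in auto)
      then show "(\<lambda>s. indicator {..<r} s *\<^sub>R B (f s) (g r)) \<in> borel_measurable M"
        by measurable
      show "(\<lambda>s. B (indicator {..r} s *\<^sub>R f s) (g r)) \<in> borel_measurable M"
        by (rule borel_measurable_bilinear[OF B])
          (use prim_indicator_integrable[OF f, of r] in \<open>auto simp: M_def\<close>)
    qed
    also have "\<dots> = B (prim T f r) (g r)"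
      using integral_bounded_linear[OF lin_l[of "g r"] prim_indicator_integrable[OF f, where t = r]]
      by (simp add: M_def prim_def)
    finally show ?thesis .
  qed
  have "(\<integral>s. B (f s) (prim T g s) \<partial>M) + (\<integral>s. B (prim T f s) (g s) \<partial>M) =
      (\<integral>p. (case p of (s, r) \<Rightarrow> indicator {..s} r *\<^sub>R B (f s) (g r)) \<partial>(M \<Otimes>\<^sub>M M)) +
      (\<integral>p. (case p of (s, r) \<Rightarrow> indicator {..<r} s *\<^sub>R B (f s) (g r)) \<partial>(M \<Otimes>\<^sub>M M))"
    using MM.integral_fst'[OF l] MM.integral_snd[OF u] by (simp add: L U)
  also have "\<dots> = (\<integral>p. (case p of (s, r) \<Rightarrow> B (f s) (g r)) \<partial>(M \<Otimes>\<^sub>M M))"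
    by (subst Bochner_Integration.integral_add[symmetric, OF l u])
      (rule Bochner_Integration.integral_cong, auto simp: indicator_def)
  also have "\<dots> = (\<integral>s. B (f s) (\<integral>r. g r \<partial>M) \<partial>M)"
    using MM.integral_fst'[OF h] integral_bounded_linear[OF lin_r g'] by simp
  also have "\<dots> = B (\<integral>s. f s \<partial>M) (\<integral>s. g s \<partial>M)"
    by (rule integral_bounded_linear[OF lin_l f'])
  finally show ?thesis by simp
qed

text \<open>Cutting both factors off at \<open>t\<close> turns their total integrals into the values
  of the primitives at \<open>t\<close> and leaves the primitives up to \<open>t\<close> unchanged,
  so the formula for the whole interval applies.\<close>

lemma prim_product:
  fixes B :: "'b::{banach, second_countable_topology} \<Rightarrow> 'c::{banach, second_countable_topology} \<Rightarrow>
    'd::{banach, second_countable_topology}"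
  assumes B: "bounded_bilinear B"
    and f: "integrable (leb T) f" and g: "integrable (leb T) g"
  shows "B (prim T f t) (prim T g t) =
    prim T (\<lambda>s. B (f s) (prim T g s)) t + prim T (\<lambda>s. B (prim T f s) (g s)) t"
proof -
  define ft gt where "ft s = indicator {..t} s *\<^sub>R f s" and "gt s = indicator {..t} s *\<^sub>R g s" for s
  have i: "integrable (leb T) ft" "integrable (leb T) gt"
    unfolding ft_def gt_def by (intro prim_indicator_integrable f g)+
  have p: "prim T ft s = prim T f s" "prim T gt s = prim T g s" if "s \<le> t" for s
    unfolding prim_def ft_def gt_def using that
    by (auto intro!: Bochner_Integration.integral_cong simp: indicator_def)
  have "(\<integral>s. B (ft s) (prim T gt s) \<partial>leb T) = prim T (\<lambda>s. B (f s) (prim T g s)) t"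
    unfolding prim_def[of T _ t]
    by (rule Bochner_Integration.integral_cong)
      (auto simp: ft_def indicator_def p bounded_bilinear.zero_left[OF B])
  moreover have "(\<integral>s. B (prim T ft s) (gt s) \<partial>leb T) = prim T (\<lambda>s. B (prim T f s) (g s)) t"
    unfolding prim_def[of T _ t]
    by (rule Bochner_Integration.integral_cong)
      (auto simp: gt_def indicator_def p bounded_bilinear.zero_right[OF B])
  moreover have "integral\<^sup>L (leb T) ft = prim T f t"
    "integral\<^sup>L (leb T) gt = prim T g t"
    unfolding prim_def ft_def gt_def by auto
  ultimately show ?thesis using integral_bilinear_prim[OF B i] by simp
qed


section \<open>Test functions\<close>

text \<open>Finite order makes closure under sums, products and affine substitutions provable by
  induction on \<open>k\<close>; smoothness of a test function is the conjunction over all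
  \<open>k\<close>.\<close>

definition smooth_upto :: "nat \<Rightarrow> (real \<Rightarrow> real) \<Rightarrow> bool" where
  "smooth_upto k f \<longleftrightarrow> (\<forall>n<k. \<forall>t. (deriv ^^ n) f differentiable (at t))"

lemma smooth_upto_0 [simp]: "smooth_upto 0 f"
  by (simp add: smooth_upto_def)

lemma smooth_upto_Suc:
  "smooth_upto (Suc k) f \<longleftrightarrow> (\<forall>t. f differentiable (at t)) \<and> smooth_upto k (deriv f)"
proof -
  have "(deriv ^^ Suc n) f = (deriv ^^ n) (deriv f)" for n
    by (simp add: funpow_swap1)
  then show ?thesis
    unfolding smooth_upto_def by (auto simp: less_Suc_eq_0_disj)
qed

lemma smooth_upto_SucD: "smooth_upto (Suc k) f \<Longrightarrow> smooth_upto k f"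
  by (simp add: smooth_upto_def)

lemma test_function_iff:
  "test_function T \<phi> \<longleftrightarrow> (\<forall>k. smooth_upto k \<phi>) \<and>
    (\<exists>a b. 0 < a \<and> b < T \<and> (\<forall>t. t \<notin> {a..b} \<longrightarrow> \<phi> t = 0))"
  unfolding test_function_def smooth_upto_def by auto

lemma deriv_eqI: "(\<And>t. (f has_real_derivative f' t) (at t)) \<Longrightarrow> deriv f = f'"
  by (simp add: fun_eq_iff DERIV_imp_deriv)

lemma smooth_upto_SucI:
  assumes "\<And>t. (f has_real_derivative f' t) (at t)" "smooth_upto k f'"
  shows "smooth_upto (Suc k) f"
  using assms deriv_eqI[OF assms(1)] by (auto simp: smooth_upto_Suc real_differentiable_def)

lemma smooth_upto_has_deriv:
  "smooth_upto (Suc k) f \<Longrightarrow> (f has_real_derivative deriv f t) (at t)"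
  by (simp add: smooth_upto_Suc DERIV_deriv_iff_real_differentiable)

lemma smooth_upto_add:
  "smooth_upto k f \<Longrightarrow> smooth_upto k g \<Longrightarrow> smooth_upto k (\<lambda>t. f t + g t)"
proof (induction k arbitrary: f g)
  case (Suc k)
  show ?case
    by (rule smooth_upto_SucI[where f' = "\<lambda>t. deriv f t + deriv g t"])
      (use Suc in \<open>auto intro!: DERIV_add smooth_upto_has_deriv simp: smooth_upto_Suc\<close>)
qed simp

lemma smooth_upto_mult:
  "smooth_upto k f \<Longrightarrow> smooth_upto k g \<Longrightarrow> smooth_upto k (\<lambda>t. f t * g t)"
proof (induction k arbitrary: f g)
  case (Suc k)
  show ?case
  proof (rule smooth_upto_SucI[where f' = "\<lambda>t. deriv f t * g t + deriv g t * f t"])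
    show "((\<lambda>t. f t * g t) has_real_derivative deriv f t * g t + deriv g t * f t) (at t)" for t
      by (rule DERIV_mult) (use Suc.prems in \<open>auto intro: smooth_upto_has_deriv\<close>)
    show "smooth_upto k (\<lambda>t. deriv f t * g t + deriv g t * f t)"
      using Suc.prems by (intro smooth_upto_add Suc.IH) (auto simp: smooth_upto_Suc intro: smooth_upto_SucD)
  qed
qed simp

lemma smooth_upto_const: "smooth_upto k (\<lambda>t. c)"
proof (induction k arbitrary: c)
  case (Suc k)
  then show ?case by (intro smooth_upto_SucI[where f' = "\<lambda>t. 0"]) auto
qed simp

lemma smooth_upto_affine: "smooth_upto k f \<Longrightarrow> smooth_upto k (\<lambda>t. f (c * t + d))"
proof (induction k arbitrary: f)
  case (Suc k)
  show ?case
  proof (rule smooth_upto_SucI[where f' = "\<lambda>t. deriv f (c * t + d) * c"])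
    show "((\<lambda>t. f (c * t + d)) has_real_derivative deriv f (c * t + d) * c) (at t)" for t
      by (rule DERIV_chain2[OF smooth_upto_has_deriv[OF Suc.prems]]) (auto intro!: derivative_eq_intros)
    show "smooth_upto k (\<lambda>t. deriv f (c * t + d) * c)"
      by (rule smooth_upto_mult[OF Suc.IH smooth_upto_const])
        (use Suc.prems in \<open>simp add: smooth_upto_Suc\<close>)
  qed
qed simp

text \<open>With \<open>y = 1/x\<close> this is \<open>p(y) exp(-y)\<close>. Its derivative has the
  same form with \<open>p\<close> replaced by \<open>y\<^sup>2 (p - p')\<close>, so one derivative
  formula gives smoothness of all orders by induction.\<close>

definition flat :: "real poly \<Rightarrow> real \<Rightarrow> real" where
  "flat p x = (if 0 < x then poly p (inverse x) * exp (- inverse x) else 0)"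

text \<open>The power \<open>k\<close> is generalized because peeling a coefficient off the
  polynomial multiplies the rest by \<open>y\<close>.\<close>

lemma power_poly_exp_tendsto_0: "((\<lambda>y::real. y ^ k * poly p y * exp (- y)) \<longlongrightarrow> 0) at_top"
proof (induction p arbitrary: k)
  case (pCons a p)
  have "((\<lambda>y. a * (y ^ k / exp y) + y ^ Suc k * poly p y * exp (- y)) \<longlongrightarrow> a * 0 + 0) at_top"
    by (rule tendsto_add[OF tendsto_mult[OF tendsto_const tendsto_power_div_exp_0] pCons.IH])
  moreover have "y ^ k * poly (pCons a p) y * exp (- y) =
      a * (y ^ k / exp y) + y ^ Suc k * poly p y * exp (- y)" for y
    by (simp add: exp_minus divide_inverse distrib_left distrib_right mult_ac)
  ultimately show ?case by simp
qed simp

lemma flat_has_deriv: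
  "(flat p has_real_derivative flat (monom 1 2 * (p - pderiv p)) x) (at x)"
proof (cases "x = 0")
  case True
  \<comment> \<open>Since \<open>flat p 0 = 0\<close>, this is the difference quotient at the
    origin. On the right it is \<open>y p(y) exp(-y)\<close> with \<open>y = 1/x\<close> tending to
    infinity; on the left it is zero.\<close>
  have "((\<lambda>x. flat p x / x) \<longlongrightarrow> 0) (at_right 0)"
  proof -
    have "((\<lambda>x. (inverse x) ^ 1 * poly p (inverse x) * exp (- inverse x)) \<longlongrightarrow> 0) (at_right (0::real))"
      by (rule filterlim_compose[OF power_poly_exp_tendsto_0 filterlim_inverse_at_top_right])
    then show ?thesis
      by (rule Lim_transform_eventually)
        (auto simp: eventually_at_right_less flat_def divide_inverse mult_ac
          intro!: eventually_mono[OF eventually_at_right_less[of 0]])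
  qed
  moreover have "((\<lambda>x. flat p x / x) \<longlongrightarrow> 0) (at_left 0)"
    by (rule Lim_transform_eventually[OF tendsto_const])
      (auto intro!: eventually_at_leftI[of "-1"] simp: flat_def)
  ultimately have "((\<lambda>x. flat p x / x) \<longlongrightarrow> 0) (at 0)"
    by (simp add: filterlim_split_at)
  then show ?thesis
    using True by (simp add: has_field_derivative_iff flat_def)
next
  case False
  show ?thesis
  proof (cases "0 < x")
    case True
    have "((\<lambda>x. poly p (inverse x) * exp (- inverse x)) has_real_derivative
        flat (monom 1 2 * (p - pderiv p)) x) (at x)"
      using True
      by (auto intro!: derivative_eq_intros DERIV_chain2[OF poly_DERIV]
          simp: flat_def poly_monom power2_eq_square algebra_simps)
    then show ?thesis
      by (rule has_field_derivative_transform_within_open[of _ _ _ "{0<..}"])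
        (use True in \<open>auto simp: flat_def\<close>)
  next
    case neg: False
    have "((\<lambda>x. 0) has_real_derivative flat (monom 1 2 * (p - pderiv p)) x) (at x)"
      using neg by (simp add: flat_def)
    then show ?thesis
      by (rule has_field_derivative_transform_within_open[of _ _ _ "{..<0}"])
        (use neg \<open>x \<noteq> 0\<close> in \<open>auto simp: flat_def\<close>)
  qed
qed

lemma smooth_upto_flat: "smooth_upto k (flat p)"
proof (induction k arbitrary: p)
  case (Suc k)
  show ?case by (rule smooth_upto_SucI[OF flat_has_deriv Suc.IH])
qed simp

text \<open>For \<open>c > 0\<close> a smooth function, positive exactly on \<open>(a,b)\<close>.
  Large \<open>c\<close> steepens both flanks, so the bumps approach the indicator of the open
  interval; test functions can then stand in for indicators in limits.\<close>

definition bump :: "real \<Rightarrow> real \<Rightarrow> real \<Rightarrow> real \<Rightarrow> real" where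
  "bump a b c t = flat 1 (c * t + (- c * a)) * flat 1 (- c * t + c * b)"

lemma flat_1_nonneg: "0 \<le> flat 1 x" and flat_1_le: "flat 1 x \<le> 1"
  by (auto simp: flat_def)

lemma bump_nonneg: "0 \<le> bump a b c t" and bump_le: "bump a b c t \<le> 1"
  unfolding bump_def by (auto intro!: mult_nonneg_nonneg mult_le_one flat_1_nonneg flat_1_le)

lemma bump_eq:
  assumes "0 < c"
  shows "bump a b c t =
    (if t \<in> {a<..<b} then exp (- inverse (c * (t - a))) * exp (- inverse (c * (b - t))) else 0)"
proof -
  have "0 < c * t + (- c * a) \<longleftrightarrow> a < t" "0 < - c * t + c * b \<longleftrightarrow> t < b"
    using assms by (simp_all add: algebra_simps)
  then show ?thesis by (simp add: bump_def flat_def algebra_simps)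
qed

lemma test_function_bump:
  assumes "0 < a" "b < T" "0 < c"
  shows "test_function T (bump a b c)"
  unfolding test_function_iff
proof
  have "bump a b c t = 0" if "t \<notin> {a..b}" for t
    using that assms by (auto simp: bump_eq)
  then show "\<exists>a' b'. 0 < a' \<and> b' < T \<and> (\<forall>t. t \<notin> {a'..b'} \<longrightarrow> bump a b c t = 0)"
    using assms by blast
  have "smooth_upto k (bump a b c)" for k
    unfolding bump_def
    by (rule smooth_upto_mult[OF smooth_upto_affine[OF smooth_upto_flat]
          smooth_upto_affine[OF smooth_upto_flat]])
  then show "\<forall>k. smooth_upto k (bump a b c)" ..
qed

lemma bump_tendsto: "(\<lambda>n. bump a b (real (Suc n)) t) \<longlonglongrightarrow> indicator {a<..<b} t"
proof (cases "t \<in> {a<..<b}")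
  case True
  have "(\<lambda>n. exp (- (inverse (real (Suc n)) * inverse (t - a))) * exp (- (inverse (real (Suc n)) * inverse (b - t))))
      \<longlonglongrightarrow> exp (- (0 * inverse (t - a))) * exp (- (0 * inverse (b - t)))"
    by (intro tendsto_intros LIMSEQ_inverse_real_of_nat)
  moreover have "bump a b (real (Suc n)) t = exp (- (inverse (real (Suc n)) * inverse (t - a))) *
      exp (- (inverse (real (Suc n)) * inverse (b - t)))" for n
    using True by (subst bump_eq) simp_all
  ultimately show ?thesis using True by simp
next
  case False
  then have "bump a b (real (Suc n)) t = 0" for n by (subst bump_eq) auto
  then show ?thesis using False by simp
qed

lemma test_function_has_deriv:
  assumes "test_function T \<phi>"
  shows "(\<phi> has_real_derivative deriv \<phi> t) (at t)" "continuous_on S \<phi>" "continuous_on S (deriv \<phi>)"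
proof -
  have s: "smooth_upto k \<phi>" for k using assms by (simp add: test_function_iff)
  then show d: "(\<phi> has_real_derivative deriv \<phi> t) (at t)" for t
    by (rule smooth_upto_has_deriv)
  show "continuous_on S \<phi>"
    by (intro continuous_at_imp_continuous_on ballI DERIV_isCont[OF d])
  have "smooth_upto (Suc 0) (deriv \<phi>)"
    using s[of "Suc (Suc 0)"] smooth_upto_Suc by blast
  from smooth_upto_has_deriv[OF this] show "continuous_on S (deriv \<phi>)"
    by (intro continuous_at_imp_continuous_on ballI DERIV_isCont)
qed

lemma test_function_ends:
  assumes "test_function T \<phi>" shows "t \<le> 0 \<Longrightarrow> \<phi> t = 0" "T \<le> t \<Longrightarrow> \<phi> t = 0"
  using assms unfolding test_function_def by force+

lemma test_function_add_scaled:
  assumes "test_function T \<phi>" "test_function T \<psi>"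
  shows "test_function T (\<lambda>t. \<phi> t + c * \<psi> t)"
proof -
  obtain a b a' b' where *: "0 < a" "b < T" "\<And>t. t \<notin> {a..b} \<Longrightarrow> \<phi> t = 0"
    "0 < a'" "b' < T" "\<And>t. t \<notin> {a'..b'} \<Longrightarrow> \<psi> t = 0"
    using assms unfolding test_function_def by metis
  have "smooth_upto k (\<lambda>t. \<phi> t + c * \<psi> t)" for k
    using assms by (intro smooth_upto_add smooth_upto_mult smooth_upto_const) (auto simp: test_function_iff)
  moreover have "\<exists>a b. 0 < a \<and> b < T \<and> (\<forall>t. t \<notin> {a..b} \<longrightarrow> \<phi> t + c * \<psi> t = 0)"
    using * by (intro exI[of _ "min a a'"] exI[of _ "max b b'"]) (auto simp: min_def max_def split: if_splits)
  ultimately show ?thesis by (simp add: test_function_iff)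
qed

section \<open>Test functions as primitives and their antiderivatives\<close>

lemma integrable_continuous_lebesgue_on:
  fixes f :: "real \<Rightarrow> 'b::{banach, second_countable_topology}"
  assumes "continuous_on UNIV f"
  shows "integrable (leb T) f"
proof -
  have "bounded (f ` {0..T})"
    by (intro compact_imp_bounded compact_continuous_image continuous_on_subset[OF assms]) auto
  then obtain K where "\<forall>x\<in>f ` {0..T}. norm x \<le> K"
    unfolding bounded_iff by blast
  then have K: "norm (f t) \<le> K" if "t \<in> {0..T}" for t
    using that by blast
  show ?thesis
  proof (rule finite_measure.integrable_const_bound[OF finite_measure_interval, of f K])
    show "AE t in leb T. norm (f t) \<le> K"
      by (rule AE_lebesgue_onI) (use K in auto)
    show "f \<in> borel_measurable (leb T)"
      by (intro borel_measurable_lebesgue_onI borel_measurable_continuous_onI assms)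
  qed
qed

lemma integral_lebesgue_on_eq_HK:
  fixes f :: "real \<Rightarrow> real"
  assumes "continuous_on UNIV f"
  shows "integral\<^sup>L (leb T) f = integral {0..T} f"
proof -
  have "integral\<^sup>L (leb T) f = integral {0<..<T} f"
    by (rule lebesgue_integral_eq_integral) (auto intro: integrable_continuous_lebesgue_on assms)
  then show ?thesis using integral_open_interval_real[of 0 T f] by simp
qed

text \<open>Passage to the gauge integral, for which the fundamental theorem of calculus is
  stated.\<close>

lemma prim_eq_HK:
  fixes f :: "real \<Rightarrow> real"
  assumes "continuous_on UNIV f" "0 \<le> t" "t \<le> T"
  shows "prim T f t = integral {0..t} f"
proof -
  have "prim T f t = integral\<^sup>L (lebesgue_on {0<..<t}) f"
  proof (cases "t = T")
    case True
    then show ?thesis by (simp add: prim_end)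
  next
    case False
    have "prim T f t = integral\<^sup>L lebesgue (\<lambda>s. indicator {0<..<T} s *\<^sub>R indicator {..t} s *\<^sub>R f s)"
      unfolding prim_def by (subst integral_restrict_space) auto
    also have "\<dots> = integral\<^sup>L lebesgue (\<lambda>s. indicator {0<..<t} s *\<^sub>R f s)"
    proof (rule integral_cong_AE)
      have "AE s in lebesgue. s \<noteq> t"
        by (rule AE_completion) (rule AE_lborel_singleton)
      then show "AE s in lebesgue. indicator {0<..<T} s *\<^sub>R indicator {..t} s *\<^sub>R f s = indicator {0<..<t} s *\<^sub>R f s"
        by eventually_elim (use False assms in \<open>auto simp: indicator_def\<close>)
      have "f \<in> borel_measurable borel" using assms by (simp add: borel_measurable_continuous_onI)
      then have "(\<lambda>s. indicator {0<..<T} s *\<^sub>R indicator {..t} s *\<^sub>R f s) \<in> borel_measurable borel"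
        "(\<lambda>s. indicator {0<..<t} s *\<^sub>R f s) \<in> borel_measurable borel"
        by measurable
      then show "(\<lambda>s. indicator {0<..<T} s *\<^sub>R indicator {..t} s *\<^sub>R f s) \<in> borel_measurable lebesgue"
        "(\<lambda>s. indicator {0<..<t} s *\<^sub>R f s) \<in> borel_measurable lebesgue"
        by (auto intro: measurable_completion)
    qed
    also have "\<dots> = integral\<^sup>L (lebesgue_on {0<..<t}) f"
      by (subst integral_restrict_space) auto
    finally show ?thesis .
  qed
  then show ?thesis by (simp add: integral_lebesgue_on_eq_HK assms)
qed

lemma test_function_eq_prim:
  assumes "test_function T \<phi>"
  shows "t \<in> {0..T} \<Longrightarrow> \<phi> t = prim T (deriv \<phi>) t" and "integral\<^sup>L (leb T) (deriv \<phi>) = 0"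
proof -
  note d = test_function_has_deriv[OF assms]
  have *: "(deriv \<phi> has_integral \<phi> t - \<phi> 0) {0..t}" if "0 \<le> t" for t
    using that d(1)
    by (intro fundamental_theorem_of_calculus)
      (auto simp: has_real_derivative_iff_has_vector_derivative intro: has_vector_derivative_at_within)
  show "\<phi> t = prim T (deriv \<phi>) t" if "t \<in> {0..T}"
    using integral_unique[OF *[of t]] that test_function_ends(1)[OF assms, of 0]
    by (simp add: prim_eq_HK d(3))
  show "integral\<^sup>L (leb T) (deriv \<phi>) = 0"
  proof (cases "0 \<le> T")
    case True
    then show ?thesis using *[OF True] test_function_ends[OF assms]
      by (simp add: integral_lebesgue_on_eq_HK d(3) integral_unique)
  next
    case False
    then show ?thesis by simp
  qed
qed

lemma integral_vanish: "(\<And>x. x \<in> S \<Longrightarrow> f x = 0) \<Longrightarrow> integral S f = (0::real)"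
  by (metis has_integral_is_0 integral_unique)

text \<open>The integral of \<open>\<theta>\<close> from \<open>0\<close> vanishes to the left of
  the support; the zero mean makes it vanish to the right as well, so it has compact
  support.\<close>

lemma test_function_antiderivative:
  assumes \<theta>: "test_function T \<theta>" and T: "0 < T" and 0: "integral {0..T} \<theta> = 0"
  obtains \<psi> where "test_function T \<psi>" "deriv \<psi> = \<theta>"
proof -
  note d = test_function_has_deriv[OF \<theta>]
  obtain a b where ab: "0 < a" "b < T" "\<And>t. t \<notin> {a..b} \<Longrightarrow> \<theta> t = 0"
    using \<theta> unfolding test_function_def by metis
  define \<psi> where "\<psi> t = integral {0..t} \<theta>" for t
  have left: "\<psi> t = 0" if "t < a" for t
    unfolding \<psi>_def by (rule integral_vanish) (use that ab in auto)
  have deriv: "(\<psi> has_real_derivative \<theta> t) (at t)" for t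
  proof (cases "0 < t")
    case True
    have "(\<psi> has_real_derivative \<theta> t) (at t within {0..t + 1})"
      unfolding \<psi>_def using True by (intro integral_has_real_derivative d(2)) auto
    then show ?thesis
      using True at_within_Icc_at[of 0 t "t + 1"] by simp
  next
    case False
    \<comment> \<open>Left of \<open>a\<close> the function \<open>\<psi>\<close> is identically
      zero, also at negative \<open>t\<close>, where the interval of integration is empty.\<close>
    have "((\<lambda>t. 0) has_real_derivative \<theta> t) (at t)" using False ab by simp
    then show ?thesis
      by (rule has_field_derivative_transform_within_open[of _ _ _ "{..<a}"])
        (use False ab left in auto)
  qed
  have right: "\<psi> t = 0" if "b < t" for t
  proof -
    \<comment> \<open>\<open>t\<close> may lie on either side of \<open>T\<close>. Both integrals
      are compared with the one up to \<open>max t T\<close>, since \<open>\<theta>\<close> vanishes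
      beyond \<open>b\<close>.\<close>
    have "integral {0..max t T} \<theta> = \<psi> s" if "s \<in> {t, T}" for s
    proof (cases "0 \<le> s")
      case True
      have "integral {0..s} \<theta> + integral {s..max t T} \<theta> = integral {0..max t T} \<theta>"
        by (rule Henstock_Kurzweil_Integration.integral_combine)
          (use that True in \<open>auto intro!: integrable_continuous_interval d\<close>)
      moreover have "integral {s..max t T} \<theta> = 0"
        by (rule integral_vanish) (use that ab \<open>b < t\<close> in auto)
      ultimately show ?thesis by (simp add: \<psi>_def)
    next
      case False
      then have "s = t" using that T by auto
      have "integral {0..max t T} \<theta> = 0"
        by (rule integral_vanish) (use ab False \<open>s = t\<close> \<open>b < t\<close> in auto)
      then show ?thesis using left[of s] False ab by simp
    qed
    from this[of t] this[of T] show ?thesis using 0 by (simp add: \<psi>_def)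
  qed
  have d\<psi>: "deriv \<psi> = \<theta>" by (rule deriv_eqI) (rule deriv)
  have "smooth_upto k \<psi>" for k
    by (rule smooth_upto_SucD, rule smooth_upto_SucI[OF deriv])
      (use \<theta> in \<open>simp add: test_function_iff\<close>)
  moreover have "\<psi> t = 0" if "t \<notin> {a..b}" for t
    using that left right by (metis atLeastAtMost_iff not_le)
  ultimately have "test_function T \<psi>"
    unfolding test_function_iff using ab(1,2) by blast
  with d\<psi> show ?thesis using that by blast
qed

section \<open>Weak derivatives\<close>

text \<open>Half-lines form an intersection-stable generator of the Borel sets, so by a Dynkin
  argument the integral of \<open>h\<close> vanishes over every Borel set; a Lebesgue set differs
  from a Borel set by a null set.\<close>

lemma integral_atMost_zero_imp_AE_zero:
  fixes h :: "real \<Rightarrow> 'b::{banach, second_countable_topology}"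
  assumes h: "integrable (leb T) h" and p: "\<And>t. prim T h t = 0"
  shows "AE t in leb T. h t = 0"
proof -
  \<comment> \<open>Extension by zero allows the generator to consist of half-lines of the whole
    line instead of subsets of \<open>(0,T)\<close>.\<close>
  define h0 where "h0 t = indicator {0<..<T} t *\<^sub>R h t" for t
  have i: "integrable lebesgue h0"
    using h by (simp add: h0_def[abs_def] integrable_restrict_space)
  have all: "integral\<^sup>L lebesgue h0 = 0"
    using p[of T] h by (simp add: prim_end h0_def[abs_def] integral_restrict_space)
  have B: "set_lebesgue_integral lebesgue A h0 = 0" if "A \<in> sets borel" for A
  proof -
    have "A \<in> sigma_sets UNIV (range (\<lambda>a::real. {..a}))"
      using that by (simp add: borel_eq_atMost)
    then show ?thesis
    proof (rule sigma_sets_induct_disjoint[rotated 2])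
      show "Int_stable (range (\<lambda>a::real. {..a}))" by (auto simp: Int_stable_def)
      show "set_lebesgue_integral lebesgue A h0 = 0" if "A \<in> range (\<lambda>a. {..a})" for A
      proof -
        obtain a where a: "A = {..a}" using \<open>A \<in> _\<close> by auto
        have "prim T h a = set_lebesgue_integral lebesgue A h0"
          unfolding prim_def set_lebesgue_integral_def a h0_def
          by (subst integral_restrict_space) (auto intro!: Bochner_Integration.integral_cong simp: indicator_def)
        then show ?thesis using p by simp
      qed
      show "set_lebesgue_integral lebesgue {} h0 = 0" by (simp add: set_lebesgue_integral_def)
      show "set_lebesgue_integral lebesgue (UNIV - A) h0 = 0"
        if A: "A \<in> sigma_sets UNIV (range (\<lambda>a::real. {..a}))" and 0: "set_lebesgue_integral lebesgue A h0 = 0" for A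
      proof -
        have "A \<in> sets borel" using A by (simp add: borel_eq_atMost)
        then have A': "A \<in> sets lebesgue" "UNIV - A \<in> sets lebesgue" by auto
        have "set_lebesgue_integral lebesgue A h0 + set_lebesgue_integral lebesgue (UNIV - A) h0 =
            integral\<^sup>L lebesgue (\<lambda>x. indicator A x *\<^sub>R h0 x + indicator (UNIV - A) x *\<^sub>R h0 x)"
          unfolding set_lebesgue_integral_def
          by (rule Bochner_Integration.integral_add[symmetric]) (intro integrable_mult_indicator A' i)+
        also have "\<dots> = integral\<^sup>L lebesgue h0"
          by (rule Bochner_Integration.integral_cong) (auto simp: indicator_def)
        finally show ?thesis using 0 all by simp
      qed
      show "set_lebesgue_integral lebesgue (\<Union>n. A n) h0 = 0"
        if "disjoint_family A" and A: "range A \<subseteq> sigma_sets UNIV (range (\<lambda>a::real. {..a}))"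
          and 0: "\<And>n. set_lebesgue_integral lebesgue (A n) h0 = 0" for A :: "nat \<Rightarrow> real set"
      proof -
        have "A n \<in> sets borel" for n using A by (auto simp: borel_eq_atMost)
        then have A': "A n \<in> sets lebesgue" for n by auto
        have "set_lebesgue_integral lebesgue (\<Union>n. A n) h0 = (\<Sum>n. set_lebesgue_integral lebesgue (A n) h0)"
        proof (rule lebesgue_integral_countable_add)
          show "set_integrable lebesgue (\<Union>n. A n) h0"
            unfolding set_integrable_def using A' by (intro integrable_mult_indicator i) auto
        qed (use A' \<open>disjoint_family A\<close> in \<open>auto simp: disjoint_family_on_def\<close>)
        then show ?thesis using 0 by simp
      qed
    qed auto
  qed
  show ?thesis
  proof (rule sigma_finite_measure.density_zero[OF _ h])
    show "sigma_finite_measure (leb T)"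
      by (rule finite_measure.axioms(1)[OF finite_measure_interval])
    fix A :: "real set" assume "A \<in> sets (leb T)"
    then have A: "A \<in> sets lebesgue" by (subst (asm) sets_restrict_space_iff) auto
    define S where "S = main_part lborel A"
    have S: "S \<in> sets borel" using main_part_sets[OF A] by (simp add: S_def)
    have "null_part lborel A \<in> null_sets lebesgue"
    proof -
      obtain N where N: "N \<in> null_sets lborel" "null_part lborel A \<subseteq> N"
        using null_part[OF A] by auto
      then show ?thesis by (meson completion.complete2 null_sets_completion_iff2 null_sets_completionI)
    qed
    then have "AE x in lebesgue. x \<notin> null_part lborel A" by (rule AE_not_in)
    then have ae: "AE x in lebesgue. indicator A x *\<^sub>R h0 x = indicator S x *\<^sub>R h0 x"
      by eventually_elim
        (use main_part_null_part_Un[OF A] in \<open>auto simp: S_def indicator_def\<close>)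
    have "set_lebesgue_integral lebesgue A h0 = set_lebesgue_integral lebesgue S h0"
      unfolding set_lebesgue_integral_def
      by (rule integral_cong_AE[OF _ _ ae])
        (use A S i in \<open>auto intro!: borel_measurable_integrable[OF integrable_mult_indicator]\<close>)
    moreover have "set_lebesgue_integral (leb T) A h = set_lebesgue_integral lebesgue A h0"
      unfolding set_lebesgue_integral_def h0_def
      by (subst integral_restrict_space) (auto intro!: Bochner_Integration.integral_cong simp: mult.commute)
    ultimately show "set_lebesgue_integral (leb T) A h = 0"
      using B[OF S] by simp
  qed
qed

lemma integrable_scaleR_test:
  fixes h :: "real \<Rightarrow> 'b::{banach, second_countable_topology}"
  assumes h: "integrable (leb T) h" and \<phi>: "continuous_on UNIV \<phi>"
  shows "integrable (leb T) (\<lambda>t. \<phi> t *\<^sub>R h t)"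
proof -
  have "bounded (\<phi> ` {0..T})"
    by (intro compact_imp_bounded compact_continuous_image continuous_on_subset[OF \<phi>]) auto
  then obtain K where "\<forall>x\<in>\<phi> ` {0..T}. norm x \<le> K"
    unfolding bounded_iff by blast
  then have K: "\<bar>\<phi> t\<bar> \<le> K" if "t \<in> {0..T}" for t
    using that by (metis image_eqI real_norm_def)
  have i: "integrable (leb T) (\<lambda>t. K * norm (h t))" using h by simp
  have [measurable]: "\<phi> \<in> borel_measurable (leb T)" "h \<in> borel_measurable (leb T)"
    using h by (auto intro!: borel_measurable_lebesgue_onI borel_measurable_continuous_onI \<phi>)
  show ?thesis
  proof (rule Bochner_Integration.integrable_bound[OF i])
    show "(\<lambda>t. \<phi> t *\<^sub>R h t) \<in> borel_measurable (leb T)" by measurable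
    show "AE t in leb T. norm (\<phi> t *\<^sub>R h t) \<le> norm (K * norm (h t))"
    proof (rule AE_lebesgue_onI)
      fix t assume "t \<in> {0<..<T}"
      then have "\<bar>\<phi> t\<bar> \<le> K" using K by simp
      then have "\<bar>\<phi> t\<bar> * norm (h t) \<le> \<bar>K\<bar> * norm (h t)" by (intro mult_right_mono) auto
      then show "norm (\<phi> t *\<^sub>R h t) \<le> norm (K * norm (h t))" by (simp add: abs_mult)
    qed
  qed
qed

text \<open>Bumps converge boundedly to the indicator of \<open>(a,b)\<close>, so \<open>h\<close>
  has integral zero over every such interval. Hence \<open>prim T h\<close> is constant inside, by
  continuity also on the closed interval, and the constant is its value \<open>0\<close> at
  \<open>0\<close>.\<close>

lemma fundamental_lemma:
  fixes h :: "real \<Rightarrow> 'b::{banach, second_countable_topology}"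
  assumes h: "integrable (leb T) h"
    and 0: "\<And>\<phi>. test_function T \<phi> \<Longrightarrow> (\<integral>t. \<phi> t *\<^sub>R h t \<partial>leb T) = 0"
  shows "AE t in leb T. h t = 0"
proof (cases "0 < T")
  case True
  have eq: "prim T h b = prim T h a" if ab: "0 < a" "a < b" "b < T" for a b
  proof -
    have "(\<lambda>n. \<integral>t. bump a b (real (Suc n)) t *\<^sub>R h t \<partial>leb T) \<longlonglongrightarrow>
        (\<integral>t. indicator {a<..<b} t *\<^sub>R h t \<partial>leb T)"
    proof (rule integral_dominated_convergence[where w = "\<lambda>t. norm (h t)"])
      have t: "test_function T (bump a b (real (Suc n)))" for n
        using ab by (intro test_function_bump) auto
      show "(\<lambda>t. bump a b (real (Suc n)) t *\<^sub>R h t) \<in> borel_measurable (leb T)" for n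
        by (rule borel_measurable_integrable[OF integrable_scaleR_test[OF h test_function_has_deriv(2)[OF t]]])
      have [measurable]: "{a<..<b} \<in> sets (leb T)"
        using ab by (subst sets_restrict_space_iff) auto
      show "(\<lambda>t. indicator {a<..<b} t *\<^sub>R h t) \<in> borel_measurable (leb T)"
        using integrable_mult_indicator[OF _ h] by (metis \<open>{a<..<b} \<in> _\<close> borel_measurable_integrable)
      show "AE t in leb T. (\<lambda>n. bump a b (real (Suc n)) t *\<^sub>R h t) \<longlonglongrightarrow> indicator {a<..<b} t *\<^sub>R h t"
        by (intro AE_I2 tendsto_scaleR bump_tendsto tendsto_const)
      show "AE t in leb T. norm (bump a b (real (Suc n)) t *\<^sub>R h t) \<le> norm (h t)" for n
        by (intro AE_I2) (simp add: abs_of_nonneg[OF bump_nonneg] mult_left_le_one_le bump_nonneg bump_le)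
    qed (use h in auto)
    moreover have "(\<integral>t. bump a b (real (Suc n)) t *\<^sub>R h t \<partial>leb T) = 0" for n
      using ab by (intro 0 test_function_bump) auto
    ultimately have z: "(\<integral>t. indicator {a<..<b} t *\<^sub>R h t \<partial>leb T) = 0"
      by (simp add: LIMSEQ_const_iff)
    have "prim T h b - prim T h a = (\<integral>t. indicator {..b} t *\<^sub>R h t - indicator {..a} t *\<^sub>R h t \<partial>leb T)"
      unfolding prim_def by (simp add: prim_indicator_integrable h)
    also have "\<dots> = (\<integral>t. indicator {a<..<b} t *\<^sub>R h t \<partial>leb T)"
    proof (rule integral_cong_AE)
      show "AE t in leb T. indicator {..b} t *\<^sub>R h t - indicator {..a} t *\<^sub>R h t = indicator {a<..<b} t *\<^sub>R h t"
        using AE_lebesgue_on_ne[where T = T and t = b]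
        by eventually_elim (use ab in \<open>auto simp: indicator_def\<close>)
      show "(\<lambda>t. indicator {..b} t *\<^sub>R h t - indicator {..a} t *\<^sub>R h t) \<in> borel_measurable (leb T)"
        by (intro borel_measurable_diff borel_measurable_integrable[OF prim_indicator_integrable] h)
      have "{a<..<b} \<in> sets (leb T)"
        using ab by (subst sets_restrict_space_iff) auto
      then show "(\<lambda>t. indicator {a<..<b} t *\<^sub>R h t) \<in> borel_measurable (leb T)"
        using integrable_mult_indicator[OF _ h] by (metis borel_measurable_integrable)
    qed
    finally show ?thesis using z by simp
  qed
  have c: "prim T h t = prim T h (T / 2)" if "t \<in> {0<..<T}" for t
    using eq[of t "T / 2"] eq[of "T / 2" t] that True by (cases t "T / 2" rule: linorder_cases) auto
  have "prim T h t = prim T h (T / 2)" if "t \<in> {0..T}" for t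
  proof (rule continuous_constant_on_closure[of "{0<..<T}" "prim T h"])
    show "continuous_on (closure {0<..<T}) (prim T h)" by (rule continuous_on_prim[OF h])
    show "t \<in> closure {0<..<T}" using that True by simp
  qed (rule c)
  note const = this
  have "prim T h (T / 2) = 0" using const[of 0] True by (simp add: prim_0)
  then have z: "prim T h t = 0" if "t \<in> {0..T}" for t
    using const[OF that] by simp
  have "prim T h t = 0" for t
  proof -
    consider "t \<le> 0" | "t \<in> {0..T}" | "T \<le> t" by fastforce
    then show ?thesis
    proof cases
      case 3
      then show ?thesis using z[of T] True by (simp add: prim_end)
    qed (auto simp: prim_0 z)
  qed
  then show ?thesis by (rule integral_atMost_zero_imp_AE_zero[OF h])
qed (auto intro: AE_lebesgue_onI)

text \<open>Integration by parts against the derivative of the test function. That derivative has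
  integral zero, which removes both the boundary term and the constant \<open>x\<close>.\<close>

lemma weak_deriv_prim:
  fixes g :: "real \<Rightarrow> 'b::{banach, second_countable_topology}"
  assumes g: "integrable (leb T) g"
  shows "weak_deriv T (\<lambda>t. x + prim T g t) g"
  unfolding weak_deriv_def
proof (intro allI impI)
  fix \<phi> assume \<phi>: "test_function T \<phi>"
  let ?M = "leb T"
  note d = test_function_has_deriv[OF \<phi>]
  note i = integrable_continuous_lebesgue_on[OF d(3), of T]
  have p: "integrable ?M (\<lambda>t. deriv \<phi> t *\<^sub>R prim T g t)"
    by (intro integrable_scaleR_test d integrable_continuous_lebesgue_on continuous_on_prim g)
  have "(\<integral>t. deriv \<phi> t *\<^sub>R x \<partial>?M) = 0"
    using integral_scaleR_left[OF i] test_function_eq_prim(2)[OF \<phi>] by simp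
  moreover have "integrable ?M (\<lambda>t. deriv \<phi> t *\<^sub>R x)" using i by (rule integrable_scaleR_left)
  ultimately have "(\<integral>t. deriv \<phi> t *\<^sub>R (x + prim T g t) \<partial>?M) = (\<integral>t. deriv \<phi> t *\<^sub>R prim T g t \<partial>?M)"
    using p by (simp add: scaleR_add_right)
  moreover have "(\<integral>t. deriv \<phi> t *\<^sub>R prim T g t \<partial>?M) + (\<integral>t. prim T (deriv \<phi>) t *\<^sub>R g t \<partial>?M) = 0"
    using integral_bilinear_prim[OF bounded_bilinear_scaleR i g] test_function_eq_prim(2)[OF \<phi>] by simp
  moreover have "(\<integral>t. prim T (deriv \<phi>) t *\<^sub>R g t \<partial>?M) = (\<integral>t. \<phi> t *\<^sub>R g t \<partial>?M)"
    by (rule Bochner_Integration.integral_cong) (auto simp: test_function_eq_prim(1)[OF \<phi>])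
  ultimately show "(\<integral>t. deriv \<phi> t *\<^sub>R (x + prim T g t) \<partial>?M) = - (\<integral>t. \<phi> t *\<^sub>R g t \<partial>?M)"
    by (simp add: add_eq_0_iff)
qed

text \<open>Only derivatives of test functions, that is, test functions of mean zero, may be
  inserted. Subtracting from \<open>\<phi>\<close> a multiple of a fixed bump \<open>\<beta>\<close>
  of nonzero mean makes it admissible and reduces the claim to the fundamental lemma for
  \<open>h - c\<close>.\<close>

lemma du_Bois_Reymond:
  fixes h :: "real \<Rightarrow> 'b::{banach, second_countable_topology}"
  assumes T: "0 < T" and h: "integrable (leb T) h"
    and 0: "\<And>\<phi>. test_function T \<phi> \<Longrightarrow> (\<integral>t. deriv \<phi> t *\<^sub>R h t \<partial>leb T) = 0"
  shows "\<exists>c. AE t in leb T. h t = c"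
proof -
  let ?M = "leb T"
  define \<beta> where "\<beta> = bump (T / 3) (2 * T / 3) 1"
  have \<beta>: "test_function T \<beta>" unfolding \<beta>_def using T by (intro test_function_bump) auto
  note d\<beta> = test_function_has_deriv[OF \<beta>]
  have ne: "integral {0..T} \<beta> \<noteq> 0"
  proof
    assume "integral {0..T} \<beta> = 0"
    then have "\<beta> (T / 2) = 0"
      using integral_eq_0_iff[OF d\<beta>(2), of 0 T] T by (auto simp: \<beta>_def bump_nonneg)
    then show False using T by (auto simp: \<beta>_def bump_eq)
  qed
  \<comment> \<open>Testing a constant function with \<open>\<beta>\<close> shows that no other
    value is possible: this is the mean of \<open>h\<close> with weight
    \<open>\<beta>\<close>.\<close>
  define c where "c = (1 / integral {0..T} \<beta>) *\<^sub>R (\<integral>t. \<beta> t *\<^sub>R h t \<partial>?M)"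
  have "AE t in ?M. h t - c = 0"
  proof (rule fundamental_lemma)
    show "integrable ?M (\<lambda>t. h t - c)"
      by (intro Bochner_Integration.integrable_diff h finite_measure.integrable_const
          finite_measure_interval)
    fix \<phi> assume \<phi>: "test_function T \<phi>"
    note d\<phi> = test_function_has_deriv[OF \<phi>]
    define k where "k = integral {0..T} \<phi> / integral {0..T} \<beta>"
    have "integral {0..T} (\<lambda>t. \<phi> t + (- k) * \<beta> t) = integral {0..T} \<phi> + (- k) * integral {0..T} \<beta>"
      by (subst Henstock_Kurzweil_Integration.integral_add)
        (auto intro!: integrable_continuous_interval continuous_intros d\<beta> d\<phi>)
    then have "integral {0..T} (\<lambda>t. \<phi> t + (- k) * \<beta> t) = 0" using ne by (simp add: k_def)
    then obtain \<psi> where \<psi>: "test_function T \<psi>" "deriv \<psi> = (\<lambda>t. \<phi> t + (- k) * \<beta> t)"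
      using test_function_antiderivative[OF test_function_add_scaled[OF \<phi> \<beta>] T] by metis
    note i = integrable_scaleR_test[OF h d\<phi>(2)] integrable_scaleR_test[OF h d\<beta>(2)]
    have "0 = (\<integral>t. \<phi> t *\<^sub>R h t - k *\<^sub>R \<beta> t *\<^sub>R h t \<partial>?M)"
      using 0[OF \<psi>(1)] by (simp add: \<psi>(2) algebra_simps)
    also have "\<dots> = (\<integral>t. \<phi> t *\<^sub>R h t \<partial>?M) - k *\<^sub>R (\<integral>t. \<beta> t *\<^sub>R h t \<partial>?M)"
      using i by (simp only: Bochner_Integration.integral_diff integrable_scaleR_right integral_scaleR_right)
    also have "k *\<^sub>R (\<integral>t. \<beta> t *\<^sub>R h t \<partial>?M) = integral {0..T} \<phi> *\<^sub>R c"
      by (simp add: k_def c_def)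
    also have "\<dots> = (\<integral>t. \<phi> t *\<^sub>R c \<partial>?M)"
      using integral_scaleR_left[OF integrable_continuous_lebesgue_on[OF d\<phi>(2), of T], of c]
      by (simp add: integral_lebesgue_on_eq_HK d\<phi>)
    finally show "(\<integral>t. \<phi> t *\<^sub>R (h t - c) \<partial>?M) = 0"
      using i(1) integrable_scaleR_left[OF integrable_continuous_lebesgue_on[OF d\<phi>(2), of T], of c]
      by (simp add: scaleR_diff_right)
  qed
  then show ?thesis by (intro exI[of _ c]) (auto elim: eventually_mono)
qed

text \<open>\<open>u - prim T g\<close> has weak derivative zero, hence is constant. The primitive
  is the absolutely continuous representative on which initial values are read off.\<close>

lemma weak_deriv_imp_prim:
  fixes u g :: "real \<Rightarrow> 'b::{banach, second_countable_topology}"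
  assumes T: "0 < T" and u: "integrable (leb T) u"
    and g: "integrable (leb T) g" and w: "weak_deriv T u g"
  shows "\<exists>x. AE t in leb T. u t = x + prim T g t"
proof -
  let ?M = "leb T"
  have p: "integrable ?M (prim T g)" by (intro integrable_continuous_lebesgue_on continuous_on_prim g)
  have "\<exists>c. AE t in ?M. u t - prim T g t = c"
  proof (rule du_Bois_Reymond[OF T])
    show "integrable ?M (\<lambda>t. u t - prim T g t)" using u p by simp
    fix \<phi> assume \<phi>: "test_function T \<phi>"
    note d = test_function_has_deriv[OF \<phi>]
    have "(\<integral>t. deriv \<phi> t *\<^sub>R (u t - prim T g t) \<partial>?M) =
        (\<integral>t. deriv \<phi> t *\<^sub>R u t \<partial>?M) - (\<integral>t. deriv \<phi> t *\<^sub>R prim T g t \<partial>?M)"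
      using integrable_scaleR_test[OF u d(3)] integrable_scaleR_test[OF p d(3)]
      by (simp add: scaleR_diff_right)
    also have "\<dots> = 0"
      using w weak_deriv_prim[OF g, of 0] \<phi> by (simp add: weak_deriv_def)
    finally show "(\<integral>t. deriv \<phi> t *\<^sub>R (u t - prim T g t) \<partial>?M) = 0" .
  qed
  then obtain c where "AE t in ?M. u t - prim T g t = c" ..
  then have "AE t in ?M. u t = c + prim T g t" by eventually_elim (simp add: algebra_simps)
  then show ?thesis ..
qed

lemma weak_deriv_unique:
  fixes u g1 g2 :: "real \<Rightarrow> 'b::{banach, second_countable_topology}"
  assumes g: "integrable (leb T) g1" "integrable (leb T) g2"
    and w: "weak_deriv T u g1" "weak_deriv T u g2"
  shows "AE t in leb T. g1 t = g2 t"
proof -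
  have "AE t in leb T. g1 t - g2 t = 0"
  proof (rule fundamental_lemma)
    show "integrable (leb T) (\<lambda>t. g1 t - g2 t)" using g by simp
    fix \<phi> assume \<phi>: "test_function T \<phi>"
    note d = test_function_has_deriv(2)[OF \<phi>]
    show "(\<integral>t. \<phi> t *\<^sub>R (g1 t - g2 t) \<partial>leb T) = 0"
      using w \<phi> integrable_scaleR_test[OF g(1) d] integrable_scaleR_test[OF g(2) d]
      by (simp add: weak_deriv_def scaleR_diff_right)
  qed
  then show ?thesis by eventually_elim simp
qed

text \<open>\<open>wderiv\<close> is determined only up to null sets; a second derivative is
  computed by first replacing it by a primitive.\<close>

lemma weak_deriv_cong_AE:
  fixes u u' g :: "real \<Rightarrow> 'b::{banach, second_countable_topology}"
  assumes w: "weak_deriv T u g" and ae: "AE t in leb T. u t = u' t"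
    and m: "u \<in> borel_measurable (leb T)" "u' \<in> borel_measurable (leb T)"
  shows "weak_deriv T u' g"
  unfolding weak_deriv_def
proof (intro allI impI)
  fix \<phi> assume \<phi>: "test_function T \<phi>"
  note [measurable] = m
  have [measurable]: "deriv \<phi> \<in> borel_measurable (leb T)"
    by (intro borel_measurable_lebesgue_onI borel_measurable_continuous_onI
        test_function_has_deriv(3)[OF \<phi>])
  have "(\<integral>t. deriv \<phi> t *\<^sub>R u t \<partial>leb T) = (\<integral>t. deriv \<phi> t *\<^sub>R u' t \<partial>leb T)"
  proof (rule integral_cong_AE)
    show "AE t in leb T. deriv \<phi> t *\<^sub>R u t = deriv \<phi> t *\<^sub>R u' t"
      using ae by eventually_elim simp
  qed measurable
  then show "(\<integral>t. deriv \<phi> t *\<^sub>R u' t \<partial>leb T) = - (\<integral>t. \<phi> t *\<^sub>R g t \<partial>leb T)"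
    using w \<phi> by (simp add: weak_deriv_def)
qed

lemma weak_deriv_bounded_linear:
  fixes u g :: "real \<Rightarrow> 'b::{banach, second_countable_topology}"
    and L :: "'b \<Rightarrow> 'c::{banach, second_countable_topology}"
  assumes L: "bounded_linear L" and w: "weak_deriv T u g"
    and u: "integrable (leb T) u" and g: "integrable (leb T) g"
  shows "weak_deriv T (\<lambda>t. L (u t)) (\<lambda>t. L (g t))"
  unfolding weak_deriv_def
proof (intro allI impI)
  fix \<phi> assume \<phi>: "test_function T \<phi>"
  note d = test_function_has_deriv[OF \<phi>]
  interpret L: bounded_linear L by (rule L)
  have "(\<integral>t. deriv \<phi> t *\<^sub>R L (u t) \<partial>leb T) = L (\<integral>t. deriv \<phi> t *\<^sub>R u t \<partial>leb T)"
    using integral_bounded_linear[OF L integrable_scaleR_test[OF u d(3)]] by (simp add: L.scaleR)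
  also have "\<dots> = L (- (\<integral>t. \<phi> t *\<^sub>R g t \<partial>leb T))"
    using w \<phi> by (simp add: weak_deriv_def)
  also have "\<dots> = - (\<integral>t. \<phi> t *\<^sub>R L (g t) \<partial>leb T)"
    using integral_bounded_linear[OF L integrable_scaleR_test[OF g d(2)]] by (simp add: L.scaleR L.neg)
  finally show "(\<integral>t. deriv \<phi> t *\<^sub>R L (u t) \<partial>leb T) =
      - (\<integral>t. \<phi> t *\<^sub>R L (g t) \<partial>leb T)" .
qed


section \<open>Hilbert space adjoints\<close>

definition riesz_rep :: "('v::{real_inner, banach} \<Rightarrow> real) \<Rightarrow> 'v" where
  "riesz_rep g = (SOME w. \<forall>v. g v = inner w v)"

lemma inner_riesz_rep:
  assumes "bounded_linear g" shows "inner (riesz_rep g) v = g v"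
proof -
  have "\<forall>v. g v = inner (riesz_rep g) v"
    unfolding riesz_rep_def by (rule someI_ex[OF riesz_real[OF assms]])
  then show ?thesis by metis
qed

lemma inner_ext: "(\<And>v. inner x v = inner y v) \<Longrightarrow> x = (y::'a::real_inner)"
  by (metis inner_diff_left inner_eq_zero_iff right_minus_eq)

definition hilbert_adj :: "('v::{real_inner, banach} \<Rightarrow> 'h::real_inner) \<Rightarrow> 'h \<Rightarrow> 'v" where
  "hilbert_adj j h = riesz_rep (\<lambda>v. inner h (j v))"

lemma inner_hilbert_adj:
  "bounded_linear j \<Longrightarrow> inner (hilbert_adj j h) v = inner h (j v)"
  unfolding hilbert_adj_def
  by (intro inner_riesz_rep bounded_linear_inner_right_comp)

lemma bounded_linear_hilbert_adj:
  assumes j: "bounded_linear j" shows "bounded_linear (hilbert_adj j)"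
proof -
  obtain K where K: "\<And>v. norm (j v) \<le> norm v * K" "0 \<le> K"
    using bounded_linear.nonneg_bounded[OF j] by blast
  note i = inner_hilbert_adj[OF j]
  show ?thesis
  proof (rule bounded_linear_intro)
    show "hilbert_adj j (x + y) = hilbert_adj j x + hilbert_adj j y" for x y
      by (rule inner_ext) (simp add: i inner_add_left)
    show "hilbert_adj j (r *\<^sub>R x) = r *\<^sub>R hilbert_adj j x" for r x
      by (rule inner_ext) (simp add: i)
    show "norm (hilbert_adj j h) \<le> norm h * K" for h
    proof (cases "hilbert_adj j h = 0")
      case False
      have "(norm (hilbert_adj j h))\<^sup>2 = inner h (j (hilbert_adj j h))"
        by (simp add: power2_norm_eq_inner i)
      also have "\<dots> \<le> norm h * norm (j (hilbert_adj j h))" by (rule norm_cauchy_schwarz)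
      also have "\<dots> \<le> norm h * (norm (hilbert_adj j h) * K)" by (intro mult_left_mono K) auto
      finally have "norm (hilbert_adj j h) * norm (hilbert_adj j h) \<le> (norm h * K) * norm (hilbert_adj j h)"
        by (simp add: power2_eq_square mult_ac)
      then show ?thesis using False by simp
    qed (use K in auto)
  qed
qed

text \<open>By symmetry the inner product of \<open>x n\<close> and \<open>x m\<close> is the
  squared norm of the power \<open>n + m\<close> applied to \<open>v\<close>, a decreasing and hence
  convergent sequence; this forces \<open>x\<close> to be Cauchy. Even powers are used so that every
  inner product is such a square. The limit is fixed by \<open>S\<close> applied twice, hence
  zero.\<close>

lemma symmetric_contraction_powers_tendsto_0:
  fixes S :: "'v::{real_inner, banach} \<Rightarrow> 'v"
  assumes S: "bounded_linear S" and sym: "\<And>x y. inner (S x) y = inner x (S y)"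
    and contr: "\<And>x. norm (S x) \<le> norm x" and fix0: "\<And>x. S (S x) = x \<Longrightarrow> x = 0"
  shows "(\<lambda>n. (S ^^ (2 * n)) v) \<longlonglongrightarrow> 0"
proof -
  define b where "b k = (norm ((S ^^ k) v))\<^sup>2" for k
  define x where "x n = (S ^^ (2 * n)) v" for n
  have symk: "inner ((S ^^ k) x) y = inner x ((S ^^ k) y)" for k x y
    by (induction k arbitrary: x y) (auto simp: sym funpow_swap1)
  have xx: "inner (x n) (x m) = b (n + m)" for n m
  proof -
    have "inner (x n) (x m) = inner v ((S ^^ (2 * n + 2 * m)) v)"
      by (simp add: x_def symk funpow_add)
    also have "2 * n + 2 * m = (n + m) + (n + m)" by simp
    also have "inner v ((S ^^ (k + k)) v) = b k" for k
      by (simp add: funpow_add b_def power2_norm_eq_inner symk)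
    finally show ?thesis .
  qed
  have "decseq b"
    by (rule decseq_SucI) (simp add: b_def power_mono contr)
  then obtain L where L: "b \<longlonglongrightarrow> L" "\<And>i. L \<le> b i"
    using decseq_convergent[of b 0] by (auto simp: b_def)
  have "Cauchy x"
  proof (rule CauchyI)
    fix e :: real assume e: "0 < e"
    then have "eventually (\<lambda>n. b n < L + e\<^sup>2 / 2) sequentially"
      using L(1) by (intro order_tendstoD) auto
    then obtain N where N: "\<And>n. n \<ge> N \<Longrightarrow> b n < L + e\<^sup>2 / 2"
      by (auto simp: eventually_sequentially)
    show "\<exists>M. \<forall>m\<ge>M. \<forall>n\<ge>M. norm (x m - x n) < e"
    proof (intro exI allI impI)
      fix m n assume mn: "m \<ge> N" "n \<ge> N"
      have "(norm (x m - x n))\<^sup>2 = b (m + m) + b (n + n) - 2 * b (m + n)"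
        by (simp add: power2_norm_eq_inner inner_diff_left inner_diff_right xx add.commute)
      also have "\<dots> < e\<^sup>2"
        using N[of "m + m"] N[of "n + n"] L(2)[of "m + n"] mn by linarith
      finally show "norm (x m - x n) < e" using e by (simp add: power2_less_imp_less)
    qed
  qed
  then obtain y where y: "x \<longlonglongrightarrow> y" by (auto simp: Cauchy_convergent_iff convergent_def)
  have "(\<lambda>n. x (Suc n)) \<longlonglongrightarrow> y" using y by (rule LIMSEQ_Suc)
  moreover have "x (Suc n) = S (S (x n))" for n by (simp add: x_def)
  moreover have "(\<lambda>n. S (S (x n))) \<longlonglongrightarrow> S (S y)"
    by (intro bounded_linear.tendsto[OF S] y)
  ultimately have "S (S y) = y" using LIMSEQ_unique by auto
  then have "y = 0" by (rule fix0)
  with y show ?thesis by (simp add: x_def[abs_def])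
qed


section \<open>Continuity and energy identity\<close>

text \<open>The product rule with both factors equal, where symmetry merges the two terms. The
  integrand is integrable because a primitive is bounded.\<close>

lemma prim_quadratic:
  fixes g :: "real \<Rightarrow> 'b::{banach, second_countable_topology}" and B :: "'b \<Rightarrow> 'b \<Rightarrow> real"
  assumes B: "bounded_bilinear B" and sym: "\<And>a b. B a b = B b a"
    and g: "integrable (leb T) g"
  shows "B (x + prim T g t) (x + prim T g t) = B x x + 2 * prim T (\<lambda>s. B (g s) (x + prim T g s)) t"
proof -
  interpret B: bounded_bilinear B by (rule B)
  interpret finite_measure "leb T" by (rule finite_measure_interval)
  have i1: "integrable (leb T) (\<lambda>s. B (g s) x)"
    by (rule integrable_bounded_linear[OF B.bounded_linear_left g])
  have i2: "integrable (leb T) (\<lambda>s. B (g s) (prim T g s))"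
  proof -
    obtain K where K: "\<And>a b. norm (B a b) \<le> norm a * norm b * K" "0 \<le> K"
      using B.nonneg_bounded by blast
    define N where "N = (\<integral>s. norm (g s) \<partial>leb T)"
    have i: "integrable (leb T) (\<lambda>s. norm (g s) * N * K)" using g by simp
    show ?thesis
    proof (rule Bochner_Integration.integrable_bound[OF i])
      show "(\<lambda>s. B (g s) (prim T g s)) \<in> borel_measurable (leb T)"
        by (intro borel_measurable_bilinear[OF B] borel_measurable_integrable[OF g] borel_measurable_prim g)
      have "norm (B (g s) (prim T g s)) \<le> norm (g s) * N * K" for s
      proof -
        have "norm (g s) * norm (prim T g s) * K \<le> norm (g s) * N * K"
          using norm_prim_le[OF g, of s] K(2) by (intro mult_right_mono mult_left_mono) (auto simp: N_def)
        then show ?thesis using K(1)[of "g s" "prim T g s"] by linarith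
      qed
      from order_trans[OF this abs_ge_self]
      show "AE s in leb T. norm (B (g s) (prim T g s)) \<le> norm (norm (g s) * N * K)"
        unfolding real_norm_def[of "_ * K"] by (intro AE_I2)
    qed
  qed
  have "B (prim T g t) (prim T g t) = 2 * prim T (\<lambda>s. B (g s) (prim T g s)) t"
    unfolding mult_2 using prim_product[OF B g g, of t] unfolding sym[of "prim T g _" "g _"] .
  moreover have "B (prim T g t) x = prim T (\<lambda>s. B (g s) x) t"
    by (rule prim_bounded_linear[OF B.bounded_linear_left g, symmetric])
  moreover have "prim T (\<lambda>s. B (g s) (x + prim T g s)) t = prim T (\<lambda>s. B (g s) x) t + prim T (\<lambda>s. B (g s) (prim T g s)) t"
    using prim_add[OF i1 i2, of t] by (simp add: B.add_right)
  ultimately show ?thesis by (simp add: B.add_left B.add_right sym[of x "prim T g t"])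
qed

lemma prim_dominated_convergence:
  fixes f :: "nat \<Rightarrow> real \<Rightarrow> 'b::{banach, second_countable_topology}"
  assumes w: "integrable (leb T) w"
    and f: "\<And>n. f n \<in> borel_measurable (leb T)"
    and g: "g \<in> borel_measurable (leb T)"
    and le: "\<And>n. AE s in leb T. norm (f n s) \<le> w s"
    and lim: "AE s in leb T. (\<lambda>n. f n s) \<longlonglongrightarrow> g s"
  shows "(\<lambda>n. prim T (f n) t) \<longlonglongrightarrow> prim T g t"
proof -
  note dc = integrable_dominated_convergence[OF g f w lim le]
    integrable_dominated_convergence2[OF g f w lim le]
  show ?thesis
    unfolding prim_def
  proof (rule integral_dominated_convergence[OF _ _ w])
    show "(\<lambda>s. indicator {..t} s *\<^sub>R g s) \<in> borel_measurable (leb T)"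
      by (rule borel_measurable_integrable[OF prim_indicator_integrable[OF dc(1)]])
    show "(\<lambda>s. indicator {..t} s *\<^sub>R f n s) \<in> borel_measurable (leb T)" for n
      by (rule borel_measurable_integrable[OF prim_indicator_integrable[OF dc(2)]])
    show "AE s in leb T. (\<lambda>n. indicator {..t} s *\<^sub>R f n s) \<longlonglongrightarrow> indicator {..t} s *\<^sub>R g s"
      using lim by eventually_elim (intro tendsto_intros)
    show "AE s in leb T. norm (indicator {..t} s *\<^sub>R f n s) \<le> w s" for n
      using le[of n] by eventually_elim (auto simp: indicator_def intro: order_trans[OF norm_ge_zero])
  qed
qed

lemma AE_interval_ex:
  assumes "0 < T" "AE t in lebesgue_on {0<..<T::real}. P t"
  obtains t where "t \<in> {0<..<T}" "P t"
proof -
  have "ae_filter (leb T) \<noteq> bot"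
    using assms(1) by (simp add: ae_filter_eq_bot_iff emeasure_restrict_space)
  moreover have "AE t in leb T. t \<in> {0<..<T} \<and> P t"
    using assms(2) AE_space[of "leb T"] by eventually_elim auto
  ultimately show ?thesis using that eventually_happens' by blast
qed

text \<open>Only the real structure is kept; density of the range of \<open>j\<close> enters as a
  hypothesis where the adjoint must be injective.\<close>

locale real_gelfand =
  fixes j :: "'v::{real_inner, banach, second_countable_topology} \<Rightarrow>
    'h::{real_inner, banach, second_countable_topology}"
  assumes bounded_linear_j: "bounded_linear j" and inj_j: "inj j"
begin

definition J :: "'v \<Rightarrow> 'v" where "J v = hilbert_adj j (j v)"

lemma inner_J: "inner (J x) y = inner (j x) (j y)"
  by (simp add: J_def inner_hilbert_adj bounded_linear_j)

lemma bounded_linear_J: "bounded_linear J"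
  unfolding J_def
  by (rule bounded_linear_compose[OF bounded_linear_hilbert_adj[OF bounded_linear_j] bounded_linear_j])

section \<open>The contraction \<open>I - \<tau> J\<close> and its Neumann series\<close>

definition K where "K = onorm j + 1"

lemma norm_j_le: "norm (j v) \<le> K * norm v" and K_pos: "0 < K"
proof -
  have "norm (j v) \<le> onorm j * norm v" by (rule onorm[OF bounded_linear_j])
  also have "\<dots> \<le> K * norm v" by (rule mult_right_mono) (auto simp: K_def)
  finally show "norm (j v) \<le> K * norm v" .
  show "0 < K" using onorm_pos_le[OF bounded_linear_j] by (simp add: K_def)
qed

text \<open>The norm of \<open>J\<close> is at most \<open>K\<^sup>2\<close>. With this step size
  \<open>\<tau> J\<close> lies between zero and the identity, so that \<open>S\<close> below is a
  symmetric contraction.\<close>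

definition \<tau> where "\<tau> = 1 / K\<^sup>2"

definition S :: "'v \<Rightarrow> 'v" where "S v = v - \<tau> *\<^sub>R J v"

lemma \<tau>_pos: "0 < \<tau>" using K_pos by (simp add: \<tau>_def)

lemma bounded_linear_S: "bounded_linear S"
  unfolding S_def
  by (intro bounded_linear_sub bounded_linear_ident bounded_linear_const_scaleR bounded_linear_J)

text \<open>Expanding the square gives a negative cross term, and the quadratic term returns at most
  half of it, because \<open>J\<close> is \<open>j\<close> followed by an adjoint of norm at most
  \<open>K\<close>. The remaining loss is what rules out fixed points.\<close>

lemma norm_S_sq: "(norm (S v))\<^sup>2 \<le> (norm v)\<^sup>2 - \<tau> * (norm (j v))\<^sup>2"
proof -
  have "norm (J v) \<le> K * norm (j v)"
  proof (cases "J v = 0")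
    case False
    have "(norm (J v))\<^sup>2 = inner (j v) (j (J v))"
      by (simp add: power2_norm_eq_inner inner_J)
    also have "\<dots> \<le> norm (j v) * norm (j (J v))" by (rule norm_cauchy_schwarz)
    also have "\<dots> \<le> norm (j v) * (K * norm (J v))" by (intro mult_left_mono norm_j_le) auto
    finally have "norm (J v) * norm (J v) \<le> (K * norm (j v)) * norm (J v)"
      by (simp add: power2_eq_square mult_ac)
    then show ?thesis using False by simp
  qed (use K_pos in auto)
  then have "(norm (J v))\<^sup>2 \<le> (K * norm (j v))\<^sup>2" by (intro power_mono) auto
  then have "\<tau>\<^sup>2 * (norm (J v))\<^sup>2 \<le> \<tau>\<^sup>2 * (K * norm (j v))\<^sup>2" by (rule mult_left_mono) auto
  also have "\<tau>\<^sup>2 * (K * norm (j v))\<^sup>2 = \<tau> * (norm (j v))\<^sup>2"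
    using K_pos by (simp add: \<tau>_def field_simps power2_eq_square)
  finally have "\<tau>\<^sup>2 * (norm (J v))\<^sup>2 \<le> \<tau> * (norm (j v))\<^sup>2" .
  moreover have "(norm (S v))\<^sup>2 = (norm v)\<^sup>2 - 2 * \<tau> * (norm (j v))\<^sup>2 + \<tau>\<^sup>2 * (norm (J v))\<^sup>2"
    unfolding S_def power2_norm_eq_inner
    by (simp add: inner_diff_left inner_diff_right inner_J inner_commute[of v "J v"] power2_eq_square algebra_simps)
  ultimately show ?thesis by linarith
qed

lemma norm_S: "norm (S v) \<le> norm v"
proof (rule power2_le_imp_le)
  have "0 \<le> \<tau> * (norm (j v))\<^sup>2" using \<tau>_pos by simp
  then show "(norm (S v))\<^sup>2 \<le> (norm v)\<^sup>2" using norm_S_sq[of v] by linarith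
qed simp

lemma norm_S_pow: "norm ((S ^^ k) v) \<le> norm v"
  by (induction k) (auto intro: order_trans[OF norm_S])

lemma norm_S_pow_mono: "m \<le> n \<Longrightarrow> norm ((S ^^ n) v) \<le> norm ((S ^^ m) v)"
  by (induction n rule: dec_induct) (auto intro: order_trans[OF norm_S])

lemma S_pow_tendsto_0: "(\<lambda>n. (S ^^ (2 * n)) v) \<longlonglongrightarrow> 0"
proof (rule symmetric_contraction_powers_tendsto_0[OF bounded_linear_S _ norm_S])
  show "inner (S x) y = inner x (S y)" for x y
    by (simp add: S_def inner_diff_left inner_diff_right inner_J inner_commute[of x "J y"] inner_commute[of "j y"])
  show "x = 0" if "S (S x) = x" for x
  proof -
    \<comment> \<open>A vector fixed by two applications of \<open>S\<close> loses no norm in the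
      first, so the loss term vanishes; injectivity of \<open>j\<close> then gives
      \<open>x = 0\<close>.\<close>
    have "norm x \<le> norm (S x)" using norm_S[of "S x"] that by simp
    then have "(norm x)\<^sup>2 \<le> (norm (S x))\<^sup>2" by (rule power_mono) simp
    then have "\<tau> * (norm (j x))\<^sup>2 \<le> 0" using norm_S_sq[of x] by linarith
    then have "j x = 0" using \<tau>_pos by (simp add: mult_le_0_iff)
    then show ?thesis
      using inj_j by (metis injD linear_0 bounded_linear.linear[OF bounded_linear_j])
  qed
qed

lemma bounded_linear_S_pow: "bounded_linear (S ^^ k)"
  by (induction k)
    (auto simp: id_def bounded_linear_ident o_def intro: bounded_linear_compose[OF bounded_linear_S])

lemma J_S_pow: "J ((S ^^ k) v) = (S ^^ k) (J v)"
proof (induction k)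
  case (Suc k)
  have "J (S x) = S (J x)" for x
    by (simp add: S_def linear_diff[OF bounded_linear.linear[OF bounded_linear_J]]
        linear_scale[OF bounded_linear.linear[OF bounded_linear_J]])
  with Suc show ?case by simp
qed simp

text \<open>A Neumann series: \<open>P n\<close> is an approximate inverse of \<open>J\<close>, uniformly bounded after composition with \<open>J\<close>.\<close>

definition P :: "nat \<Rightarrow> 'v \<Rightarrow> 'v" where "P n v = \<tau> *\<^sub>R (\<Sum>k<2 * n. (S ^^ k) v)"

lemma bounded_linear_P: "bounded_linear (P n)"
  unfolding P_def by (intro bounded_linear_const_scaleR bounded_linear_sum bounded_linear_S_pow)

text \<open>A telescoping sum, because \<open>\<tau> J\<close> is the identity minus
  \<open>S\<close>. The number of terms in \<open>P\<close> is even so that the remainder is an even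
  power of \<open>S\<close>, which tends strongly to zero.\<close>

lemma P_J: "P n (J v) = v - (S ^^ (2 * n)) v"
proof -
  have "\<tau> *\<^sub>R (\<Sum>k<m. (S ^^ k) (J v)) = v - (S ^^ m) v" for m
  proof (induction m)
    case (Suc m)
    have "\<tau> *\<^sub>R (S ^^ m) (J v) = (S ^^ m) v - (S ^^ Suc m) v"
      by (simp add: S_def J_S_pow[symmetric])
    with Suc show ?case by (simp add: scaleR_add_right)
  qed simp
  then show ?thesis by (simp add: P_def)
qed

lemma J_P: "J (P n v) = P n (J v)"
  by (simp add: P_def linear_scale[OF bounded_linear.linear[OF bounded_linear_J]]
      linear_sum[OF bounded_linear.linear[OF bounded_linear_J]] J_S_pow)

lemma bounded_bilinear_j:
  assumes "bounded_linear Q"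
  shows "bounded_bilinear (\<lambda>a b. inner (j (Q a)) (j (Q b)))"
  using bounded_bilinear.comp[OF bounded_bilinear_inner
      bounded_linear_compose[OF bounded_linear_j assms] bounded_linear_compose[OF bounded_linear_j assms]] .

text \<open>\<open>W = x + prim T g\<close> equals \<open>J v\<close> almost everywhere, so
  \<open>P n (W t)\<close> is a \<open>V\<close>-valued primitive with derivative
  \<open>P n (g t)\<close>, and almost everywhere it is \<open>v t\<close> minus a power of
  \<open>S\<close> applied to \<open>v t\<close>. The chain rule for the differences
  \<open>P n - P m\<close> shows that \<open>j (P n (W t))\<close> is Cauchy uniformly in
  \<open>t\<close>; its limit \<open>z\<close> is the continuous representative. The same rule for a
  single \<open>P n\<close> becomes the energy identity in the limit.\<close>

theorem Lions_continuity:
  assumes T: "0 < T" and v: "sq_integrable (leb T) v"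
    and g: "sq_integrable (leb T) g"
    and w: "AE t in leb T. J (v t) = x + prim T g t"
  obtains z where "continuous_on UNIV z" "AE t in leb T. j (v t) = z t"
    "\<And>t. hilbert_adj j (z t) = x + prim T g t"
    "\<And>t. (norm (z t))\<^sup>2 = (norm (z 0))\<^sup>2 + 2 * prim T (\<lambda>s. inner (g s) (v s)) t"
proof -
  let ?M = "leb T"
  interpret finite_measure ?M by (rule finite_measure_interval)
  define W where "W t = x + prim T g t" for t
  have gi: "integrable ?M g" using g by (rule sq_integrable_imp_integrable)
  have [measurable]: "v \<in> borel_measurable ?M" "g \<in> borel_measurable ?M"
    using v g by (auto simp: sq_integrable_def)
  have Smeas [measurable]: "(S ^^ k) \<in> borel_measurable borel" for k
    by (intro borel_measurable_continuous_onI linear_continuous_on bounded_linear_S_pow)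
  have quad: "(norm (j (Q (W t))))\<^sup>2 = (norm (j (Q x)))\<^sup>2 + 2 * prim T (\<lambda>s. inner (j (Q (g s))) (j (Q (W s)))) t"
    if "bounded_linear Q" for Q t
    using prim_quadratic[OF bounded_bilinear_j[OF that] inner_commute gi, of x t]
    by (simp add: W_def power2_norm_eq_inner)
  have ig: "integrable ?M (\<lambda>s. norm (g s) * norm (v s))" using g v by (rule sq_integrable_mult)
  define e where "e N = (\<integral>s. norm (g s) * norm ((S ^^ (2 * N)) (v s)) \<partial>?M)" for N
  have "(\<lambda>N. \<integral>s. norm (g s) * norm ((S ^^ (2 * N)) (v s)) \<partial>?M) \<longlonglongrightarrow> (\<integral>s. norm (g s) * 0 \<partial>?M)"
  proof (rule integral_dominated_convergence[OF _ _ ig])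
    show "(\<lambda>s. norm (g s) * norm ((S ^^ (2 * N)) (v s))) \<in> borel_measurable ?M" for N by measurable
    show "AE s in ?M. (\<lambda>N. norm (g s) * norm ((S ^^ (2 * N)) (v s))) \<longlonglongrightarrow> norm (g s) * 0"
      by (intro AE_I2 tendsto_mult tendsto_const tendsto_norm_zero S_pow_tendsto_0)
  qed (auto intro!: AE_I2 mult_left_mono norm_S_pow)
  then have e0: "e \<longlonglongrightarrow> 0" by (simp add: e_def[abs_def])
  obtain s0 where s0: "J (v s0) = W s0"
    using AE_interval_ex[OF T w] by (metis W_def)
  \<comment> \<open>The energies at \<open>t\<close> and \<open>s0\<close> differ by two primitives
    of \<open>h\<close>, each at most \<open>4 * e N\<close> and each counted twice, whence
    \<open>16\<close>; the square is the contribution of \<open>s0\<close> itself.\<close>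
  define d where "d N = 16 * e N + (2 * K * norm ((S ^^ (2 * N)) (v s0)))\<^sup>2" for N
  have d0: "d \<longlonglongrightarrow> 0"
  proof -
    have "d \<longlonglongrightarrow> 16 * 0 + (2 * K * norm (0::'v))\<^sup>2"
      unfolding d_def by (intro tendsto_intros e0 S_pow_tendsto_0)
    then show ?thesis by simp
  qed
  have bound: "(norm (j (P n (W t)) - j (P m (W t))))\<^sup>2 \<le> d N" if mn: "N \<le> m" "N \<le> n" for N m n t
  proof -
    define Q where "Q y = P n y - P m y" for y
    define D where "D y = (S ^^ (2 * m)) y - (S ^^ (2 * n)) y" for y
    have Q: "bounded_linear Q" unfolding Q_def by (intro bounded_linear_sub bounded_linear_P)
    have QJ: "Q (J y) = D y" for y by (simp add: Q_def D_def P_J)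
    have JQ: "J (Q y) = D y" for y
      by (simp add: Q_def D_def linear_diff[OF bounded_linear.linear[OF bounded_linear_J]] J_P P_J)
    have D: "norm (D y) \<le> 2 * norm ((S ^^ (2 * N)) y)" for y
      using norm_triangle_ineq4[of "(S ^^ (2 * m)) y" "(S ^^ (2 * n)) y"]
        norm_S_pow_mono[of "2 * N" "2 * m" y] norm_S_pow_mono[of "2 * N" "2 * n" y] mn
      unfolding D_def by linarith
    have D2: "norm (D y) \<le> 2 * norm y" for y
      using D[of y] norm_S_pow[of "2 * N" y] by linarith
    define h where "h s = inner (j (Q (g s))) (j (Q (W s)))" for s
    have h: "norm (h s) \<le> 4 * (norm (g s) * norm ((S ^^ (2 * N)) (v s)))" if "J (v s) = W s" for s
    proof -
      \<comment> \<open>\<open>Q\<close> is not bounded uniformly in \<open>m\<close> and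
        \<open>n\<close>, but \<open>J Q\<close> is. The inner product in \<open>H\<close> supplies
        the factor \<open>J\<close> on the side of \<open>g\<close>, and
        \<open>W s = J (v s)\<close> supplies it on the side of \<open>v\<close>.\<close>
      have "h s = inner (D (g s)) (D (v s))"
        by (simp add: h_def inner_J[symmetric] JQ that[symmetric] QJ)
      then have "norm (h s) \<le> norm (D (g s)) * norm (D (v s))"
        by (simp add: Cauchy_Schwarz_ineq2)
      also have "\<dots> \<le> (2 * norm (g s)) * (2 * norm ((S ^^ (2 * N)) (v s)))"
        by (intro mult_mono D D2) auto
      finally show ?thesis by simp
    qed
    have iN: "integrable ?M (\<lambda>s. norm (g s) * norm ((S ^^ (2 * N)) (v s)))"
      by (intro sq_integrable_mult g sq_integrable_bounded_linear[OF bounded_linear_S_pow] v)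
    have hm: "h \<in> borel_measurable ?M"
    proof -
      have "W \<in> borel_measurable ?M" unfolding W_def using borel_measurable_prim[OF gi] by measurable
      then show ?thesis unfolding h_def
        by (intro borel_measurable_bilinear[OF bounded_bilinear_j[OF Q]]) auto
    qed
    have hAE: "AE s in ?M. norm (h s) \<le> 4 * (norm (g s) * norm ((S ^^ (2 * N)) (v s)))"
      using w by eventually_elim (rule h, simp add: W_def)
    have hi: "integrable ?M h"
      by (rule Bochner_Integration.integrable_bound[OF integrable_mult_right[OF iN, of 4] hm])
        (use hAE in eventually_elim, auto)
    have ph: "norm (prim T h s) \<le> 4 * e N" for s
    proof -
      have "norm (prim T h s) \<le> (\<integral>s. norm (h s) \<partial>?M)" by (rule norm_prim_le[OF hi])
      also have "\<dots> \<le> (\<integral>s. 4 * (norm (g s) * norm ((S ^^ (2 * N)) (v s))) \<partial>?M)"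
        by (intro integral_mono_AE integrable_norm hi integrable_mult_right iN hAE)
      also have "\<dots> = 4 * e N" by (simp add: e_def)
      finally show ?thesis .
    qed
    have "(norm (j (Q (W t))))\<^sup>2 = (norm (j (Q (W s0))))\<^sup>2 + 2 * prim T h t - 2 * prim T h s0"
      using quad[OF Q, of t] quad[OF Q, of s0] by (simp add: h_def[abs_def])
    also have "\<dots> \<le> (norm (j (Q (W s0))))\<^sup>2 + 16 * e N"
      using ph[of t] ph[of s0] by simp
    also have "norm (j (Q (W s0))) \<le> 2 * K * norm ((S ^^ (2 * N)) (v s0))"
    proof -
      have "norm (j (D (v s0))) \<le> K * (2 * norm ((S ^^ (2 * N)) (v s0)))"
        using norm_j_le[of "D (v s0)"] mult_left_mono[OF D[of "v s0"], of K] K_pos by linarith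
      then show ?thesis by (simp add: s0[symmetric] QJ)
    qed
    then have "(norm (j (Q (W s0))))\<^sup>2 \<le> (2 * K * norm ((S ^^ (2 * N)) (v s0)))\<^sup>2"
      by (intro power_mono) auto
    finally show ?thesis
      by (simp add: Q_def d_def linear_diff[OF bounded_linear.linear[OF bounded_linear_j]])
  qed
  have "uniformly_Cauchy_on UNIV (\<lambda>n t. j (P n (W t)))"
  proof (rule uniformly_Cauchy_onI)
    fix r :: real assume r: "0 < r"
    then obtain N where N: "d N < r\<^sup>2"
      using order_tendstoD(2)[OF d0, of "r\<^sup>2"] by (auto simp: eventually_sequentially)
    show "\<exists>M. \<forall>t\<in>UNIV. \<forall>m\<ge>M. \<forall>n\<ge>M. dist (j (P m (W t))) (j (P n (W t))) < r"
    proof (intro exI ballI allI impI)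
      fix t m n assume "N \<le> m" "N \<le> n"
      then have "(dist (j (P m (W t))) (j (P n (W t))))\<^sup>2 < r\<^sup>2"
        using bound[of N n m t] N by (simp add: dist_norm)
      then show "dist (j (P m (W t))) (j (P n (W t))) < r"
        using r by (simp add: power2_less_imp_less)
    qed
  qed
  then obtain z where z: "uniform_limit UNIV (\<lambda>n t. j (P n (W t))) z sequentially"
    using Cauchy_uniformly_convergent uniformly_convergent_on_def by blast
  have zt: "(\<lambda>n. j (P n (W t))) \<longlonglongrightarrow> z t" for t
    using tendsto_uniform_limitI[OF z] by simp
  have Wc: "continuous_on UNIV W"
    unfolding W_def by (intro continuous_intros continuous_on_prim gi)
  have "continuous_on UNIV z"
  proof (rule uniform_limit_theorem[OF _ z])
    have "continuous_on UNIV (\<lambda>t. j (P n (W t)))" for n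
      by (rule bounded_linear.continuous_on[OF bounded_linear_j bounded_linear.continuous_on[OF bounded_linear_P Wc]])
    then show "\<forall>\<^sub>F n in sequentially. continuous_on UNIV (\<lambda>t. j (P n (W t)))" by simp
  qed simp
  moreover have "AE t in ?M. j (v t) = z t"
    using w
  proof eventually_elim
    case (elim t)
    have "(\<lambda>n. j (v t - (S ^^ (2 * n)) (v t))) \<longlonglongrightarrow> j (v t - 0)"
      by (intro bounded_linear.tendsto[OF bounded_linear_j] tendsto_intros S_pow_tendsto_0)
    then show ?case
      using LIMSEQ_unique zt[of t] by (simp add: W_def elim[symmetric] P_J)
  qed
  \<comment> \<open>Valid at every \<open>t\<close>, since \<open>J P n\<close> is the identity
    minus a power of \<open>S\<close> and converges on \<open>W t\<close> whether or not
    \<open>W t\<close> is \<open>J (v t)\<close>. At \<open>t = 0\<close> this identifies the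
    initial value of \<open>z\<close>.\<close>
  moreover have "hilbert_adj j (z t) = x + prim T g t" for t
  proof -
    have "(\<lambda>n. hilbert_adj j (j (P n (W t)))) \<longlonglongrightarrow> hilbert_adj j (z t)"
      by (intro bounded_linear.tendsto[OF bounded_linear_hilbert_adj[OF bounded_linear_j]] zt)
    moreover have "hilbert_adj j (j (P n (W t))) = W t - (S ^^ (2 * n)) (W t)" for n
      using J_P[of n "W t"] P_J[of n "W t"] by (simp add: J_def)
    moreover have "(\<lambda>n. W t - (S ^^ (2 * n)) (W t)) \<longlonglongrightarrow> W t - 0"
      by (intro tendsto_intros S_pow_tendsto_0)
    ultimately show ?thesis using LIMSEQ_unique by (fastforce simp: W_def)
  qed
  moreover have "(norm (z t))\<^sup>2 = (norm (z 0))\<^sup>2 + 2 * prim T (\<lambda>s. inner (g s) (v s)) t" for t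
  proof -
    define h where "h n s = inner (g s - (S ^^ (2 * n)) (g s)) (v s - (S ^^ (2 * n)) (v s))" for n s
    have hm: "h n \<in> borel_measurable ?M" for n unfolding h_def by measurable
    have "(\<lambda>n. prim T (h n) t) \<longlonglongrightarrow> prim T (\<lambda>s. inner (g s) (v s)) t"
    proof (rule prim_dominated_convergence[where w = "\<lambda>s. 4 * (norm (g s) * norm (v s))"])
      show "AE s in ?M. (\<lambda>n. h n s) \<longlonglongrightarrow> inner (g s) (v s)"
      proof (intro AE_I2)
        fix s
        have "(\<lambda>n. h n s) \<longlonglongrightarrow> inner (g s - 0) (v s - 0)"
          unfolding h_def by (intro tendsto_intros S_pow_tendsto_0)
        then show "(\<lambda>n. h n s) \<longlonglongrightarrow> inner (g s) (v s)" by simp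
      qed
      show "AE s in ?M. norm (h n s) \<le> 4 * (norm (g s) * norm (v s))" for n
      proof (intro AE_I2)
        fix s
        have *: "norm (y - (S ^^ (2 * n)) y) \<le> 2 * norm y" for y
          using norm_triangle_ineq4[of y "(S ^^ (2 * n)) y"] norm_S_pow[of "2 * n" y] by linarith
        have "norm (h n s) \<le> norm (g s - (S ^^ (2 * n)) (g s)) * norm (v s - (S ^^ (2 * n)) (v s))"
          unfolding h_def by (simp add: Cauchy_Schwarz_ineq2)
        also have "\<dots> \<le> (2 * norm (g s)) * (2 * norm (v s))" by (intro mult_mono *) auto
        finally show "norm (h n s) \<le> 4 * (norm (g s) * norm (v s))" by simp
      qed
    qed (use ig hm in auto)
    moreover have "(norm (j (P n (W t))))\<^sup>2 = (norm (j (P n (W 0))))\<^sup>2 + 2 * prim T (h n) t" for n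
    proof -
      have eq: "AE s in ?M. inner (j (P n (g s))) (j (P n (W s))) = h n s"
        using w
      proof eventually_elim
        case (elim s)
        have "inner (j (P n (g s))) (j (P n (W s))) = inner (J (P n (g s))) (P n (J (v s)))"
          by (simp add: inner_J W_def elim)
        then show ?case by (simp add: J_P P_J h_def)
      qed
      have m: "(\<lambda>s. inner (j (P n (g s))) (j (P n (W s)))) \<in> borel_measurable ?M"
        by (intro borel_measurable_bilinear[OF bounded_bilinear_j[OF bounded_linear_P]]
            borel_measurable_lebesgue_onI[OF borel_measurable_continuous_onI[OF Wc]]) measurable
      have hi: "integrable ?M (h n)"
        unfolding h_def
        by (intro sq_integrable_inner sq_integrable_diff g v sq_integrable_bounded_linear[OF bounded_linear_S_pow])
      have "integrable ?M (\<lambda>s. inner (j (P n (g s))) (j (P n (W s))))"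
        using integrable_cong_AE[OF m borel_measurable_integrable[OF hi] eq] hi by simp
      from prim_cong_AE[OF eq this hi]
      have "prim T (\<lambda>s. inner (j (P n (g s))) (j (P n (W s)))) t = prim T (h n) t" .
      with quad[OF bounded_linear_P, of n t] show ?thesis by (simp add: W_def prim_0)
    qed
    moreover have "(\<lambda>n. (norm (j (P n (W t))))\<^sup>2) \<longlonglongrightarrow> (norm (z t))\<^sup>2" for t
      by (intro tendsto_intros zt)
    ultimately have "(\<lambda>n. (norm (j (P n (W t))))\<^sup>2) \<longlonglongrightarrow> (norm (z 0))\<^sup>2 + 2 * prim T (\<lambda>s. inner (g s) (v s)) t"
      by (simp only:) (intro tendsto_add tendsto_mult tendsto_const)
    moreover have "(\<lambda>n. (norm (j (P n (W t))))\<^sup>2) \<longlonglongrightarrow> (norm (z t))\<^sup>2"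
      by (intro tendsto_intros zt)
    ultimately show ?thesis
      using LIMSEQ_unique by blast
  qed
  ultimately show ?thesis by (rule that)
qed

end


section \<open>The Hilbert space of square integrable functions on the line\<close>

text \<open>A rapidly Cauchy subsequence converges almost everywhere; Fatou's lemma along it turns
  the Cauchy condition into norm convergence of the whole sequence to the pointwise limit.\<close>

lemma Riesz_Fischer:
  fixes f :: "nat \<Rightarrow> 'a \<Rightarrow> 'b::{banach, second_countable_topology}"
  assumes f: "\<And>n. sq_integrable M (f n)"
    and Cauchy: "\<And>e. 0 < e \<Longrightarrow> \<exists>N. \<forall>m\<ge>N. \<forall>n\<ge>N. norm_L2 M (\<lambda>x. f m x - f n x) < e"
  obtains g where "sq_integrable M g" "(\<lambda>n. norm_L2 M (\<lambda>x. f n x - g x)) \<longlonglongrightarrow> 0"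
proof -
  have [measurable]: "f n \<in> borel_measurable M" for n using f by (auto simp: sq_integrable_def)
  have nn: "(\<integral>\<^sup>+x. ennreal ((norm (f m x - f n x))\<^sup>2) \<partial>M) = ennreal ((norm_L2 M (\<lambda>x. f m x - f n x))\<^sup>2)" for m n
    unfolding norm_L2_sq
    by (rule nn_integral_eq_integral) (auto intro!: sq_integrable_norm_sq sq_integrable_diff f)
  obtain N where N: "\<And>k m n. m \<ge> N k \<Longrightarrow> n \<ge> N k \<Longrightarrow> norm_L2 M (\<lambda>x. f m x - f n x) < (1/4) ^ k"
  proof -
    have "\<exists>N. \<forall>m\<ge>N. \<forall>n\<ge>N. norm_L2 M (\<lambda>x. f m x - f n x) < (1/4) ^ k" for k :: nat
      by (rule Cauchy) simp
    then show ?thesis using that by metis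
  qed
  \<comment> \<open>The sum makes both \<open>r k\<close> and \<open>r (Suc k)\<close> at least
    \<open>N k\<close>, so consecutive terms are closer than \<open>(1/4) ^ k\<close>; the summand
    \<open>k\<close> makes the indices unbounded.\<close>
  define r where "r k = (\<Sum>i\<le>k. N i) + k" for k
  have rN: "N k \<le> r k" "N k \<le> r (Suc k)" and rk: "k \<le> r k" for k
  proof -
    have "N k \<le> (\<Sum>i\<le>k. N i)" by (rule member_le_sum) auto
    then show "N k \<le> r k" "N k \<le> r (Suc k)" "k \<le> r k" by (auto simp: r_def)
  qed
  \<comment> \<open>Weighted by \<open>4 ^ k\<close>, the integrals of these squares are at most
    \<open>(1/4) ^ k\<close>, still summable. Conversely, boundedness of the weighted squares at a
    point bounds the increments by a multiple of \<open>(1/2) ^ k\<close>.\<close>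
  define d where "d k x = (norm (f (r (Suc k)) x - f (r k) x))\<^sup>2" for k x
  have "(\<integral>\<^sup>+x. (\<Sum>k. ennreal (4 ^ k * d k x)) \<partial>M) = (\<Sum>k. \<integral>\<^sup>+x. ennreal (4 ^ k * d k x) \<partial>M)"
    unfolding d_def by (rule nn_integral_suminf) measurable
  also have "\<dots> \<le> (\<Sum>k. ennreal ((1/4) ^ k))"
  proof (rule suminf_le)
    fix k
    have "(\<integral>\<^sup>+x. ennreal (4 ^ k * d k x) \<partial>M) = ennreal (4 ^ k) * (\<integral>\<^sup>+x. ennreal (d k x) \<partial>M)"
      unfolding d_def by (subst nn_integral_cmult[symmetric]) (auto simp: ennreal_mult)
    also have "\<dots> = ennreal (4 ^ k * (norm_L2 M (\<lambda>x. f (r (Suc k)) x - f (r k) x))\<^sup>2)"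
      by (simp add: d_def nn ennreal_mult)
    also have "\<dots> \<le> ennreal (4 ^ k * ((1/4) ^ k)\<^sup>2)"
      using N[OF rN(2) rN(1), of k] by (intro ennreal_leI mult_left_mono power_mono) auto
    also have "4 ^ k * ((1/4) ^ k)\<^sup>2 = (1/4::real) ^ k"
      by (simp add: power2_eq_square power_divide)
    finally show "(\<integral>\<^sup>+x. ennreal (4 ^ k * d k x) \<partial>M) \<le> ennreal ((1/4) ^ k)" .
  qed auto
  also have "\<dots> = ennreal (\<Sum>k. (1/4) ^ k)" by (rule suminf_ennreal_eq) (auto intro: summable_sums)
  finally have "(\<integral>\<^sup>+x. (\<Sum>k. ennreal (4 ^ k * d k x)) \<partial>M) \<noteq> \<infinity>"
    by (auto simp: top_unique)
  moreover have "(\<lambda>x. \<Sum>k. ennreal (4 ^ k * d k x)) \<in> borel_measurable M"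
    unfolding d_def by measurable
  ultimately have "AE x in M. (\<Sum>k. ennreal (4 ^ k * d k x)) \<noteq> \<infinity>"
    by (intro nn_integral_PInf_AE)
  then have conv: "AE x in M. convergent (\<lambda>k. f (r k) x)"
  proof eventually_elim
    case (elim x)
    then have "summable (\<lambda>k. 4 ^ k * d k x)"
      by (intro summable_suminf_not_top) (auto simp: d_def)
    then have "Bseq (\<lambda>k. 4 ^ k * d k x)"
      using summable_LIMSEQ_zero convergentI convergent_imp_Bseq by blast
    then obtain C where C: "0 < C" "\<And>k. norm (4 ^ k * d k x) \<le> C" by (auto simp: Bseq_def)
    have le: "norm (f (r (Suc k)) x - f (r k) x) \<le> sqrt C * (1/2) ^ k" for k
    proof -
      have "(2 ^ k * norm (f (r (Suc k)) x - f (r k) x))\<^sup>2 \<le> C"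
        using C(2)[of k] by (simp add: d_def power_mult_distrib power_mult[symmetric] mult.commute[of k 2])
          (simp add: power_mult)
      then have "2 ^ k * norm (f (r (Suc k)) x - f (r k) x) \<le> sqrt C"
        by (rule real_le_rsqrt)
      then show ?thesis by (simp add: field_simps power_divide)
    qed
    have "summable (\<lambda>k. f (r (Suc k)) x - f (r k) x)"
      by (rule summable_comparison_test[where g = "\<lambda>k. sqrt C * (1/2) ^ k"])
        (use le in \<open>auto intro!: summable_mult\<close>)
    then have "(\<lambda>n. \<Sum>k<n. f (r (Suc k)) x - f (r k) x) \<longlonglongrightarrow> (\<Sum>k. f (r (Suc k)) x - f (r k) x)"
      by (rule summable_LIMSEQ)
    then have "(\<lambda>n. f (r n) x - f (r 0) x) \<longlonglongrightarrow> (\<Sum>k. f (r (Suc k)) x - f (r k) x)"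
      by (simp add: sum_lessThan_telescope[of "\<lambda>k. f (r k) x"])
    then have "(\<lambda>n. f (r n) x - f (r 0) x + f (r 0) x) \<longlonglongrightarrow> (\<Sum>k. f (r (Suc k)) x - f (r k) x) + f (r 0) x"
      by (intro tendsto_add tendsto_const)
    then show ?case by (auto simp: convergent_def)
  qed
  define g where "g x = lim (\<lambda>k. f (r k) x)" for x
  have [measurable]: "g \<in> borel_measurable M"
    unfolding g_def by (rule borel_measurable_lim_metric) measurable
  have lim: "AE x in M. (\<lambda>k. f (r k) x) \<longlonglongrightarrow> g x"
    using conv by eventually_elim (simp add: g_def convergent_LIMSEQ_iff)
  have bound: "(\<integral>\<^sup>+x. ennreal ((norm (f n x - g x))\<^sup>2) \<partial>M) \<le> ennreal (e\<^sup>2)"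
    if e: "0 < e" and n: "\<And>m. m \<ge> N0 \<Longrightarrow> norm_L2 M (\<lambda>x. f n x - f m x) < e" for n N0 e
  proof -
    have "(\<integral>\<^sup>+x. ennreal ((norm (f n x - g x))\<^sup>2) \<partial>M) =
        (\<integral>\<^sup>+x. liminf (\<lambda>k. ennreal ((norm (f n x - f (r k) x))\<^sup>2)) \<partial>M)"
    proof (rule nn_integral_cong_AE)
      show "AE x in M. ennreal ((norm (f n x - g x))\<^sup>2) = liminf (\<lambda>k. ennreal ((norm (f n x - f (r k) x))\<^sup>2))"
        using lim
      proof eventually_elim
        case (elim x)
        have "(\<lambda>k. ennreal ((norm (f n x - f (r k) x))\<^sup>2)) \<longlonglongrightarrow> ennreal ((norm (f n x - g x))\<^sup>2)"
          by (intro tendsto_intros tendsto_ennrealI elim)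
        then show ?case by (rule lim_imp_Liminf[OF sequentially_bot, symmetric])
      qed
    qed
    also have "\<dots> \<le> liminf (\<lambda>k. \<integral>\<^sup>+x. ennreal ((norm (f n x - f (r k) x))\<^sup>2) \<partial>M)"
      by (rule nn_integral_liminf) measurable
    also have "\<dots> \<le> ennreal (e\<^sup>2)"
    proof (rule Liminf_le[OF sequentially_bot])
      have "\<forall>\<^sub>F k in sequentially. N0 \<le> r k"
        using rk by (intro eventually_sequentiallyI[of N0]) (metis order_trans)
      then show "\<forall>\<^sub>F k in sequentially. (\<integral>\<^sup>+x. ennreal ((norm (f n x - f (r k) x))\<^sup>2) \<partial>M) \<le> ennreal (e\<^sup>2)"
      proof eventually_elim
        case (elim k)
        then show ?case
          unfolding nn using n[OF elim] by (intro ennreal_leI power_mono) auto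
      qed
    qed
    finally show ?thesis .
  qed
  have sq: "sq_integrable M (\<lambda>x. f n x - g x) \<and> norm_L2 M (\<lambda>x. f n x - g x) \<le> e"
    if e: "0 < e" and n: "\<And>m. m \<ge> N0 \<Longrightarrow> norm_L2 M (\<lambda>x. f n x - f m x) < e" for n N0 e
  proof -
    note b = bound[OF e n]
    have i: "integrable M (\<lambda>x. (norm (f n x - g x))\<^sup>2)"
      by (rule integrableI_bounded) (use b in \<open>auto simp: less_top[symmetric] top_unique\<close>)
    have "ennreal (\<integral>x. (norm (f n x - g x))\<^sup>2 \<partial>M) \<le> ennreal (e\<^sup>2)"
      using b nn_integral_eq_integral[OF i] by simp
    then have "(\<integral>x. (norm (f n x - g x))\<^sup>2 \<partial>M) \<le> e\<^sup>2"
      by (simp add: ennreal_le_iff)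
    then have "norm_L2 M (\<lambda>x. f n x - g x) \<le> e"
      using e unfolding norm_L2_def by (simp add: real_le_lsqrt)
    then show ?thesis using i by (simp add: sq_integrable_def)
  qed
  show ?thesis
  proof
    obtain N0 where "\<forall>m\<ge>N0. \<forall>n\<ge>N0. norm_L2 M (\<lambda>x. f m x - f n x) < 1" using Cauchy[of 1] by auto
    then have "sq_integrable M (\<lambda>x. f N0 x - g x)" using sq[of 1 N0 N0] by auto
    from sq_integrable_diff[OF f[of N0] this] show "sq_integrable M g" by simp
    show "(\<lambda>n. norm_L2 M (\<lambda>x. f n x - g x)) \<longlonglongrightarrow> 0"
    proof (rule LIMSEQ_I)
      fix e :: real assume e: "0 < e"
      then obtain N0 where "\<forall>m\<ge>N0. \<forall>n\<ge>N0. norm_L2 M (\<lambda>x. f m x - f n x) < e / 2"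
        using Cauchy[of "e / 2"] by auto
      then have "norm_L2 M (\<lambda>x. f n x - g x) \<le> e / 2" if "n \<ge> N0" for n
        using sq[of "e / 2" N0 n] e that by auto
      then show "\<exists>no. \<forall>n\<ge>no. norm (norm_L2 M (\<lambda>x. f n x - g x) - 0) < e"
        using e by (intro exI[of _ N0]) fastforce
    qed
  qed
qed

definition eq_L2 :: "(real \<Rightarrow> 'a::{banach, second_countable_topology}) \<Rightarrow> (real \<Rightarrow> 'a) \<Rightarrow> bool" where
  "eq_L2 f g \<longleftrightarrow> sq_integrable lebesgue f \<and> sq_integrable lebesgue g \<and> (AE t in lebesgue. f t = g t)"

lemma eq_L2_refl: "sq_integrable lebesgue f \<Longrightarrow> eq_L2 f f"
  by (simp add: eq_L2_def)

lemma part_equivp_eq_L2: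
  "part_equivp (eq_L2 :: (real \<Rightarrow> 'a::{banach, second_countable_topology}) \<Rightarrow> _)" (is "part_equivp ?R")
proof (rule part_equivpI)
  show "\<exists>x. ?R x x" by (intro exI[of _ "\<lambda>_. 0"] eq_L2_refl sq_integrable_zero)
  show "symp ?R" by (rule sympI) (auto simp: eq_L2_def elim: eventually_mono)
  show "transp ?R"
  proof (rule transpI)
    fix f g h :: "real \<Rightarrow> 'a" assume "eq_L2 f g" "eq_L2 g h"
    then show "eq_L2 f h"
      unfolding eq_L2_def by (auto elim: eventually_elim2)
  qed
qed

\<comment> \<open>A type cannot depend on \<open>T\<close>, so the space lives on the whole line,
  and functions on \<open>(0,T)\<close> are extended by zero through \<open>to_ltwo\<close>. The
  relation is reflexive only on square integrable functions, hence partial.\<close>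
quotient_type (overloaded) 'a ltwo = "real \<Rightarrow> 'a::{banach, second_countable_topology}" / partial: eq_L2
  by (rule part_equivp_eq_L2)

instantiation ltwo :: ("{real_inner, banach, second_countable_topology}") real_inner
begin

lift_definition zero_ltwo :: "'a ltwo" is "\<lambda>_. 0"
  by (simp add: eq_L2_def)

lift_definition plus_ltwo :: "'a ltwo \<Rightarrow> 'a ltwo \<Rightarrow> 'a ltwo" is "\<lambda>f g t. f t + g t"
  unfolding eq_L2_def by (auto intro: sq_integrable_add elim: eventually_elim2)

lift_definition minus_ltwo :: "'a ltwo \<Rightarrow> 'a ltwo \<Rightarrow> 'a ltwo" is "\<lambda>f g t. f t - g t"
  unfolding eq_L2_def by (auto intro: sq_integrable_diff elim: eventually_elim2)

lift_definition uminus_ltwo :: "'a ltwo \<Rightarrow> 'a ltwo" is "\<lambda>f t. - f t"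
  unfolding eq_L2_def by (auto intro: sq_integrable_minus elim: eventually_mono)

lift_definition scaleR_ltwo :: "real \<Rightarrow> 'a ltwo \<Rightarrow> 'a ltwo" is "\<lambda>r f t. r *\<^sub>R f t"
  unfolding eq_L2_def by (auto intro: sq_integrable_scaleR elim: eventually_mono)

lift_definition inner_ltwo :: "'a ltwo \<Rightarrow> 'a ltwo \<Rightarrow> real" is "\<lambda>f g. \<integral>t. inner (f t) (g t) \<partial>lebesgue"
proof -
  fix f f' g g' :: "real \<Rightarrow> 'a"
  assume *: "eq_L2 f f'" "eq_L2 g g'"
  show "(\<integral>t. inner (f t) (g t) \<partial>lebesgue) = (\<integral>t. inner (f' t) (g' t) \<partial>lebesgue)"
  proof (rule integral_cong_AE)
    show "AE t in lebesgue. inner (f t) (g t) = inner (f' t) (g' t)"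
      using * unfolding eq_L2_def by (auto elim: eventually_elim2)
  qed (use * in \<open>auto simp: eq_L2_def intro!: borel_measurable_integrable[OF sq_integrable_inner]\<close>)
qed

lift_definition norm_ltwo :: "'a ltwo \<Rightarrow> real" is "norm_L2 lebesgue"
  unfolding eq_L2_def by (auto intro: norm_L2_cong_AE)

definition dist_ltwo :: "'a ltwo \<Rightarrow> 'a ltwo \<Rightarrow> real" where
  "dist_ltwo f g = norm (f - g)"

definition uniformity_ltwo :: "('a ltwo \<times> 'a ltwo) filter" where
  "uniformity_ltwo = (INF e\<in>{0 <..}. principal {(x, y). dist x y < e})"

definition open_ltwo :: "'a ltwo set \<Rightarrow> bool" where
  "open_ltwo S = (\<forall>x\<in>S. \<forall>\<^sub>F (x', y) in uniformity. x' = x \<longrightarrow> y \<in> S)"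

definition sgn_ltwo :: "'a ltwo \<Rightarrow> 'a ltwo" where
  "sgn_ltwo x = inverse (norm x) *\<^sub>R x"

instance
proof
  fix x y z :: "'a ltwo" and r s :: real and U :: "'a ltwo set"
  show "dist x y = norm (x - y)" by (simp add: dist_ltwo_def)
  show "sgn x = inverse (norm x) *\<^sub>R x" by (simp add: sgn_ltwo_def)
  show "uniformity = (INF e\<in>{0 <..}. principal {(x, y :: 'a ltwo). dist x y < e})"
    by (simp add: uniformity_ltwo_def)
  show "open U = (\<forall>x\<in>U. \<forall>\<^sub>F (x', y) in uniformity. x' = x \<longrightarrow> y \<in> U)"
    by (simp add: open_ltwo_def)
  show "x + y + z = x + (y + z)"
    by transfer (auto simp: eq_L2_def add.assoc intro: sq_integrable_add)
  show "x + y = y + x"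
    by transfer (auto simp: eq_L2_def add.commute intro: sq_integrable_add)
  show "0 + x = x" by transfer (auto simp: eq_L2_def)
  show "- x + x = 0" by transfer (auto simp: eq_L2_def)
  show "x - y = x + - y" by transfer (auto simp: eq_L2_def intro: sq_integrable_diff)
  show "r *\<^sub>R (x + y) = r *\<^sub>R x + r *\<^sub>R y"
    by transfer (auto simp: eq_L2_def scaleR_add_right intro!: sq_integrable_add sq_integrable_scaleR)
  show "(r + s) *\<^sub>R x = r *\<^sub>R x + s *\<^sub>R x"
    by transfer (auto simp: eq_L2_def scaleR_add_left intro!: sq_integrable_add sq_integrable_scaleR)
  show "r *\<^sub>R s *\<^sub>R x = (r * s) *\<^sub>R x"
    by transfer (auto simp: eq_L2_def intro!: sq_integrable_scaleR)
  show "1 *\<^sub>R x = x" by transfer (auto simp: eq_L2_def)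
  show "inner x y = inner y x" by transfer (simp add: inner_commute)
  show "inner (x + y) z = inner x z + inner y z"
    by transfer (simp add: eq_L2_def inner_add_left sq_integrable_inner)
  show "inner (r *\<^sub>R x) y = r * inner x y"
    by transfer simp
  show "0 \<le> inner x x" by transfer (auto intro: integral_nonneg_AE)
  show "norm x = sqrt (inner x x)"
    by transfer (simp add: norm_L2_def power2_norm_eq_inner)
  show "inner x x = 0 \<longleftrightarrow> x = 0"
  proof transfer
    fix f :: "real \<Rightarrow> 'a" assume "eq_L2 f f"
    then have f: "sq_integrable lebesgue f" by (simp add: eq_L2_def)
    show "(\<integral>t. inner (f t) (f t) \<partial>lebesgue) = 0 \<longleftrightarrow> eq_L2 f (\<lambda>_. 0)"
      using integral_nonneg_eq_0_iff_AE[OF sq_integrable_norm_sq[OF f]] f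
      by (simp add: power2_norm_eq_inner[symmetric] eq_L2_def)
  qed
qed

end

instance ltwo :: ("{real_inner, banach, second_countable_topology}") banach
proof
  fix X :: "nat \<Rightarrow> 'a ltwo" assume X: "Cauchy X"
  have "\<exists>f. sq_integrable lebesgue f \<and> x = abs_ltwo f" for x :: "'a ltwo"
    using Quotient3_abs_rep[OF Quotient3_ltwo, of x] Quotient3_rep_reflp[OF Quotient3_ltwo, of x]
    by (metis eq_L2_def)
  then have "\<forall>n. \<exists>f. sq_integrable lebesgue f \<and> X n = abs_ltwo f" by blast
  then obtain f where f: "\<And>n. sq_integrable lebesgue (f n)" "\<And>n. X n = abs_ltwo (f n)"
    by (metis choice)
  have diff: "norm (abs_ltwo g - abs_ltwo h) = norm_L2 lebesgue (\<lambda>t. g t - h t)"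
    if "sq_integrable lebesgue g" "sq_integrable lebesgue h" for g h :: "real \<Rightarrow> 'a"
    using that by (simp add: minus_ltwo.abs_eq norm_ltwo.abs_eq eq_L2_refl sq_integrable_diff)
  have "\<exists>N. \<forall>m\<ge>N. \<forall>n\<ge>N. norm_L2 lebesgue (\<lambda>x. f m x - f n x) < e" if "0 < e" for e
    using CauchyD[OF X that] by (simp add: f diff)
  from Riesz_Fischer[OF f(1) this]
  obtain g where g: "sq_integrable lebesgue g" "(\<lambda>n. norm_L2 lebesgue (\<lambda>x. f n x - g x)) \<longlonglongrightarrow> 0"
    by auto
  have "(\<lambda>n. norm (X n - abs_ltwo g)) \<longlonglongrightarrow> 0"
    using g(2) by (simp add: f diff g(1))
  then have "X \<longlonglongrightarrow> abs_ltwo g"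
    by (simp add: tendsto_norm_zero_iff LIM_zero_iff)
  then show "convergent X" by (auto simp: convergent_def)
qed


section \<open>Lions' representation lemma\<close>

text \<open>The coercivity is required only for some \<open>\<phi>\<close> associated with the test element \<open>\<psi>\<close>,
  and in the norm \<open>n\<close>, which may be stronger than the norm of the space.\<close>

lemma Lions_representation:
  fixes \<Lambda> :: "'x::{real_inner, banach} \<Rightarrow> 'x"
  assumes \<Lambda>: "bounded_linear \<Lambda>" and c: "0 < c"
    and coercive: "\<And>\<psi>. \<exists>\<phi> n. norm \<phi> \<le> n \<and> c * n\<^sup>2 \<le> inner (\<Lambda> \<phi>) \<psi> \<and> \<bar>inner h \<psi>\<bar> \<le> C * n"
  shows "\<exists>v. \<Lambda> v = h"
proof -
  \<comment> \<open>\<open>\<Lambda> w = h\<close> means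
    \<open>inner w (K \<psi>) = inner h \<psi>\<close> for all \<open>\<psi>\<close>: a functional
    on the range of the adjoint, which need not be closed, has to be represented.\<close>
  define K where "K = hilbert_adj \<Lambda>"
  have K: "inner (K \<psi>) \<phi> = inner \<psi> (\<Lambda> \<phi>)" for \<psi> \<phi>
    unfolding K_def by (rule inner_hilbert_adj[OF \<Lambda>])
  have Klin: "bounded_linear K" unfolding K_def by (rule bounded_linear_hilbert_adj[OF \<Lambda>])
  interpret K: bounded_linear K by (rule Klin)
  define D where "D = \<bar>C\<bar> / c"
  \<comment> \<open>Coercivity gives \<open>c n\<^sup>2 \<le> norm (K \<psi>) n\<close>, hence
    \<open>n \<le> norm (K \<psi>) / c\<close>; so the functional given by \<open>h\<close> is
    controlled by \<open>K \<psi>\<close> alone.\<close>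
  have hle: "inner h \<psi> \<le> D * norm (K \<psi>)" for \<psi>
  proof -
    obtain \<phi> n where n: "norm \<phi> \<le> n" "c * n\<^sup>2 \<le> inner (\<Lambda> \<phi>) \<psi>" "\<bar>inner h \<psi>\<bar> \<le> C * n"
      using coercive by blast
    have n0: "0 \<le> n" using n(1) norm_ge_zero order_trans by blast
    have "c * n * n \<le> inner (K \<psi>) \<phi>"
      using n(2) K[of \<psi> \<phi>] by (simp add: inner_commute[of \<psi>] power2_eq_square mult.assoc)
    also have "\<dots> \<le> norm (K \<psi>) * n"
      using norm_cauchy_schwarz[of "K \<psi>" \<phi>] mult_left_mono[OF n(1) norm_ge_zero[of "K \<psi>"]] by linarith
    finally have "c * n \<le> norm (K \<psi>)"
      using n0 by (cases "n = 0") auto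
    then have "n \<le> norm (K \<psi>) / c" using c by (simp add: field_simps)
    then have "\<bar>C\<bar> * n \<le> \<bar>C\<bar> * (norm (K \<psi>) / c)" by (intro mult_left_mono) auto
    moreover have "C * n \<le> \<bar>C\<bar> * n" using n0 by (intro mult_right_mono) auto
    ultimately show ?thesis using n(3) by (simp add: D_def)
  qed
  \<comment> \<open>The functional whose Euler equation is the weak form. A minimizing sequence
    \<open>x n\<close> may fail to converge, but by the parallelogram identity
    \<open>K (x n)\<close> does converge, and only its limit \<open>w\<close> is used.\<close>
  define F where "F \<psi> = (norm (K \<psi>))\<^sup>2 - 2 * inner h \<psi>" for \<psi>
  have F_ge: "F \<psi> \<ge> - D\<^sup>2" for \<psi>
    using hle[of \<psi>] zero_le_power2[of "norm (K \<psi>) - D"]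
    unfolding F_def power2_diff by (simp add: mult_ac)
  define m where "m = (INF \<psi>. F \<psi>)"
  have bdd: "bdd_below (range F)" using F_ge by (auto intro!: bdd_belowI)
  have m_le: "m \<le> F \<psi>" for \<psi> unfolding m_def by (rule cINF_lower[OF bdd]) simp
  have "\<exists>\<psi>. F \<psi> < m + 1 / real (Suc n)" for n
  proof -
    have "(INF \<psi>. F \<psi>) < m + 1 / real (Suc n)" by (simp add: m_def)
    then show ?thesis using cINF_less_iff[OF _ bdd] by auto
  qed
  then obtain x where x: "\<And>n. F (x n) < m + 1 / real (Suc n)" by metis
  have lim1: "(\<lambda>n. m + 1 / real (Suc n)) \<longlonglongrightarrow> m"
    using tendsto_add[OF tendsto_const[of m] LIMSEQ_inverse_real_of_nat]
    by (simp add: inverse_eq_divide)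
  have Fx: "(\<lambda>n. F (x n)) \<longlonglongrightarrow> m"
    by (rule tendsto_sandwich[OF _ _ tendsto_const lim1])
      (intro always_eventually allI m_le less_imp_le[OF x])+
  have par: "(norm (K a - K b))\<^sup>2 \<le> 2 * (F a - m) + 2 * (F b - m)" for a b
  proof -
    have "(norm (K a - K b))\<^sup>2 = 2 * F a + 2 * F b - 4 * F ((1/2) *\<^sub>R (a + b))"
      by (simp add: F_def K.add K.scaleR power2_norm_eq_inner inner_simps inner_commute algebra_simps)
    then show ?thesis using m_le[of "(1/2) *\<^sub>R (a + b)"] by simp
  qed
  have "Cauchy (\<lambda>n. K (x n))"
  proof (rule CauchyI)
    fix e :: real assume e: "0 < e"
    then obtain N where N: "\<And>n. n \<ge> N \<Longrightarrow> F (x n) < m + e\<^sup>2 / 4"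
      using order_tendstoD(2)[OF Fx, of "m + e\<^sup>2 / 4"] by (auto simp: eventually_sequentially)
    show "\<exists>M. \<forall>k\<ge>M. \<forall>n\<ge>M. norm (K (x k) - K (x n)) < e"
    proof (intro exI allI impI)
      fix k n assume "k \<ge> N" "n \<ge> N"
      then have "(norm (K (x k) - K (x n)))\<^sup>2 < e\<^sup>2"
        using par[of "x k" "x n"] N[of k] N[of n] by auto
      then show "norm (K (x k) - K (x n)) < e" using e by (simp add: power2_less_imp_less)
    qed
  qed
  then obtain w where w: "(\<lambda>n. K (x n)) \<longlonglongrightarrow> w" by (auto simp: Cauchy_convergent_iff convergent_def)
  have "inner w (K \<psi>) = inner h \<psi>" for \<psi>
  proof (rule ccontr)
    assume ne: "inner w (K \<psi>) \<noteq> inner h \<psi>"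
    define q where "q = inner w (K \<psi>) - inner h \<psi>"
    \<comment> \<open>The summand \<open>1\<close> avoids division by zero when
      \<open>K \<psi> = 0\<close>; the step \<open>- q / B\<close> makes the quadratic negative
      unless \<open>q = 0\<close>.\<close>
    define B where "B = (norm (K \<psi>))\<^sup>2 + 1"
    have B: "0 < B" by (simp add: B_def add_nonneg_pos)
    have pos: "0 \<le> 2 * s * q + s\<^sup>2 * (norm (K \<psi>))\<^sup>2" for s
    proof -
      have "F (x n + s *\<^sub>R \<psi>) = F (x n) + 2 * s * (inner (K (x n)) (K \<psi>) - inner h \<psi>) + s\<^sup>2 * (norm (K \<psi>))\<^sup>2" for n
        unfolding F_def power2_norm_eq_inner
        by (simp add: K.add K.scaleR inner_simps inner_commute algebra_simps power2_eq_square)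
      then have "m \<le> F (x n) + 2 * s * (inner (K (x n)) (K \<psi>) - inner h \<psi>) + s\<^sup>2 * (norm (K \<psi>))\<^sup>2" for n
        using m_le[of "x n + s *\<^sub>R \<psi>"] by simp
      moreover have "(\<lambda>n. F (x n) + 2 * s * (inner (K (x n)) (K \<psi>) - inner h \<psi>) + s\<^sup>2 * (norm (K \<psi>))\<^sup>2)
          \<longlonglongrightarrow> m + 2 * s * (inner w (K \<psi>) - inner h \<psi>) + s\<^sup>2 * (norm (K \<psi>))\<^sup>2"
        by (intro tendsto_intros Fx w)
      ultimately have "m \<le> m + 2 * s * (inner w (K \<psi>) - inner h \<psi>) + s\<^sup>2 * (norm (K \<psi>))\<^sup>2"
        using LIMSEQ_le_const by blast
      then show ?thesis by (simp add: q_def)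
    qed
    have "0 \<le> 2 * (- q / B) * q + (- q / B)\<^sup>2 * (norm (K \<psi>))\<^sup>2" by (rule pos)
    also have "\<dots> \<le> 2 * (- q / B) * q + (- q / B)\<^sup>2 * B"
      by (intro add_left_mono mult_left_mono) (auto simp: B_def)
    also have "\<dots> = - (q\<^sup>2 / B)" using B by (simp add: field_simps power2_eq_square)
    also have "\<dots> < 0" using ne B by (simp add: q_def)
    finally show False by simp
  qed
  note weak = this
  have "\<Lambda> w = h"
  proof (rule inner_ext)
    fix \<psi>
    have "inner (\<Lambda> w) \<psi> = inner \<psi> (\<Lambda> w)" by (rule inner_commute)
    also have "\<dots> = inner (K \<psi>) w" by (rule K[symmetric])
    also have "\<dots> = inner w (K \<psi>)" by (rule inner_commute)
    also have "\<dots> = inner h \<psi>" by (rule weak)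
    finally show "inner (\<Lambda> w) \<psi> = inner h \<psi>" .
  qed
  then show ?thesis ..
qed


section \<open>Existence for an abstract coercive operator\<close>

definition to_ltwo :: "real \<Rightarrow> (real \<Rightarrow> 'a::{banach, second_countable_topology}) \<Rightarrow> 'a ltwo" where
  "to_ltwo T f = abs_ltwo (\<lambda>t. indicator {0<..<T} t *\<^sub>R f t)"

lemma measurable_ident_lebesgue [measurable]: "(\<lambda>x::real. x) \<in> borel_measurable lebesgue"
  by (rule measurable_completion) simp

lemma norm_L2_restrict:
  fixes f :: "real \<Rightarrow> 'a::{banach, second_countable_topology}"
  shows "norm_L2 lebesgue (\<lambda>t. indicator {0<..<T} t *\<^sub>R f t) = norm_L2 (leb T) f"
proof -
  have *: "(\<lambda>t. (norm (indicator {0<..<T} t *\<^sub>R f t))\<^sup>2) = (\<lambda>t. indicator {0<..<T} t *\<^sub>R (norm (f t))\<^sup>2)"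
    by (auto simp: fun_eq_iff indicator_def)
  show ?thesis unfolding norm_L2_def * by (subst integral_restrict_space) simp_all
qed

lemma sq_integrable_restrict:
  fixes f :: "real \<Rightarrow> 'a::{banach, second_countable_topology}"
  shows "sq_integrable (leb T) f \<longleftrightarrow> sq_integrable lebesgue (\<lambda>t. indicator {0<..<T} t *\<^sub>R f t)"
proof -
  have *: "(\<lambda>t. (norm (indicator {0<..<T} t *\<^sub>R f t))\<^sup>2) = (\<lambda>t. indicator {0<..<T} t *\<^sub>R (norm (f t))\<^sup>2)"
    by (auto simp: fun_eq_iff indicator_def)
  have "f \<in> borel_measurable (leb T) \<longleftrightarrow>
      (\<lambda>t. indicator {0<..<T} t *\<^sub>R f t) \<in> borel_measurable lebesgue"
    by (rule borel_measurable_restrict_space_iff) simp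
  then show ?thesis
    unfolding sq_integrable_def * by (simp add: integrable_restrict_space)
qed

lemma sq_integrable_rep_ltwo: "sq_integrable lebesgue (rep_ltwo x)"
  using Quotient3_rep_reflp[OF Quotient3_ltwo, of x] by (simp add: eq_L2_def)

lemma sq_integrable_lebesgue_on:
  fixes f :: "real \<Rightarrow> 'a::{banach, second_countable_topology}"
  assumes "sq_integrable lebesgue f" shows "sq_integrable (leb T) f"
proof -
  have [measurable]: "f \<in> borel_measurable lebesgue" using assms by (simp add: sq_integrable_def)
  have "sq_integrable lebesgue (\<lambda>t. indicator {0<..<T} t *\<^sub>R f t)"
    by (rule sq_integrable_dominated(1)[OF assms, where K = 1]) (measurable, auto simp: indicator_def)
  then show ?thesis by (simp add: sq_integrable_restrict)
qed

lemma AE_lebesgue_on_of_lebesgue: "AE t in lebesgue. P t \<Longrightarrow> AE t in lebesgue_on {0<..<T::real}. P t"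
  by (subst AE_restrict_space_iff) (auto elim: eventually_mono)

lemma sq_integrable_rep_ltwo_on: "sq_integrable (leb T) (rep_ltwo x)"
  by (rule sq_integrable_lebesgue_on[OF sq_integrable_rep_ltwo])

lemma abs_rep_ltwo: "abs_ltwo (rep_ltwo x) = x"
  by (rule Quotient3_abs_rep[OF Quotient3_ltwo])

lemma eq_L2_rep_abs: "sq_integrable lebesgue f \<Longrightarrow> eq_L2 (rep_ltwo (abs_ltwo f)) f"
  by (rule Quotient3_rep_abs[OF Quotient3_ltwo]) (rule eq_L2_refl)

lemma rep_to_ltwo:
  assumes "sq_integrable (leb T) f"
  shows "AE t in leb T. rep_ltwo (to_ltwo T f) t = f t"
proof -
  have "AE t in lebesgue. rep_ltwo (to_ltwo T f) t = indicator {0<..<T} t *\<^sub>R f t"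
    using eq_L2_rep_abs[of "\<lambda>t. indicator {0<..<T} t *\<^sub>R f t"] assms
    by (simp add: sq_integrable_restrict to_ltwo_def eq_L2_def)
  then have "AE t in lebesgue. t \<in> {0<..<T} \<longrightarrow> rep_ltwo (to_ltwo T f) t = f t"
    by eventually_elim auto
  then show ?thesis by (subst AE_restrict_space_iff) auto
qed

lemma rep_ltwo_add:
  fixes x y :: "'a::{real_inner, banach, second_countable_topology} ltwo"
  shows "AE t in leb T. rep_ltwo (x + y) t = rep_ltwo x t + rep_ltwo y t"
proof (rule AE_lebesgue_on_of_lebesgue)
  have "x + y = abs_ltwo (\<lambda>t. rep_ltwo x t + rep_ltwo y t)"
    by (metis abs_rep_ltwo eq_L2_refl plus_ltwo.abs_eq sq_integrable_rep_ltwo)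
  then show "AE t in lebesgue. rep_ltwo (x + y) t = rep_ltwo x t + rep_ltwo y t"
    using eq_L2_rep_abs[OF sq_integrable_add[OF sq_integrable_rep_ltwo sq_integrable_rep_ltwo], of x y]
    by (simp add: eq_L2_def)
qed

lemma rep_ltwo_scaleR:
  fixes x :: "'a::{real_inner, banach, second_countable_topology} ltwo"
  shows "AE t in leb T. rep_ltwo (r *\<^sub>R x) t = r *\<^sub>R rep_ltwo x t"
proof (rule AE_lebesgue_on_of_lebesgue)
  have "r *\<^sub>R x = abs_ltwo (\<lambda>t. r *\<^sub>R rep_ltwo x t)"
    by (metis abs_rep_ltwo eq_L2_refl scaleR_ltwo.abs_eq sq_integrable_rep_ltwo)
  then show "AE t in lebesgue. rep_ltwo (r *\<^sub>R x) t = r *\<^sub>R rep_ltwo x t"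
    using eq_L2_rep_abs[OF sq_integrable_scaleR[OF sq_integrable_rep_ltwo], of r x]
    by (simp add: eq_L2_def)
qed

lemma to_ltwo_cong:
  assumes "sq_integrable (leb T) f" "sq_integrable (leb T) g"
    and "AE t in leb T. f t = g t"
  shows "to_ltwo T f = to_ltwo T g"
proof -
  have "AE t in lebesgue. t \<in> {0<..<T} \<longrightarrow> f t = g t"
    using assms(3) by (subst (asm) AE_restrict_space_iff) auto
  then have "AE t in lebesgue. indicator {0<..<T} t *\<^sub>R f t = indicator {0<..<T} t *\<^sub>R g t"
    by eventually_elim (auto simp: indicator_def)
  then show ?thesis
    using assms(1,2) unfolding to_ltwo_def
    by (intro Quotient3_rel_abs[OF Quotient3_ltwo]) (auto simp: eq_L2_def sq_integrable_restrict)
qed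

lemma to_ltwo_eqD:
  assumes "sq_integrable (leb T) f" "sq_integrable (leb T) g"
    and "to_ltwo T f = to_ltwo T g"
  shows "AE t in leb T. f t = g t"
  using rep_to_ltwo[OF assms(1)] rep_to_ltwo[OF assms(2)] by eventually_elim (simp add: assms(3))

lemma to_ltwo_add:
  fixes f g :: "real \<Rightarrow> 'a::{real_inner, banach, second_countable_topology}"
  assumes "sq_integrable (leb T) f" "sq_integrable (leb T) g"
  shows "to_ltwo T (\<lambda>t. f t + g t) = to_ltwo T f + to_ltwo T g"
  using assms
  by (simp add: to_ltwo_def plus_ltwo.abs_eq eq_L2_refl sq_integrable_restrict scaleR_add_right)

lemma to_ltwo_scaleR:
  fixes f :: "real \<Rightarrow> 'a::{real_inner, banach, second_countable_topology}"
  assumes "sq_integrable (leb T) f"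
  shows "to_ltwo T (\<lambda>t. r *\<^sub>R f t) = r *\<^sub>R to_ltwo T f"
  using assms
  by (simp add: to_ltwo_def scaleR_ltwo.abs_eq eq_L2_refl sq_integrable_restrict mult.commute)

lemma norm_to_ltwo:
  fixes f :: "real \<Rightarrow> 'a::{real_inner, banach, second_countable_topology}"
  assumes "sq_integrable (leb T) f"
  shows "norm (to_ltwo T f) = norm_L2 (leb T) f"
  using assms
  by (simp add: to_ltwo_def norm_ltwo.abs_eq eq_L2_refl sq_integrable_restrict norm_L2_restrict)

lemma norm_rep_ltwo_le:
  fixes x :: "'a::{real_inner, banach, second_countable_topology} ltwo"
  shows "norm_L2 (leb T) (rep_ltwo x) \<le> norm x"
proof -
  have [measurable]: "rep_ltwo x \<in> borel_measurable lebesgue"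
    using sq_integrable_rep_ltwo[of x] by (simp add: sq_integrable_def)
  have "norm_L2 lebesgue (\<lambda>t. indicator {0<..<T} t *\<^sub>R rep_ltwo x t) \<le> \<bar>1\<bar> * norm_L2 lebesgue (rep_ltwo x)"
    by (rule sq_integrable_dominated(2)[OF sq_integrable_rep_ltwo]) (measurable, auto simp: indicator_def)
  also have "norm_L2 lebesgue (rep_ltwo x) = norm x"
    by (metis abs_rep_ltwo eq_L2_refl norm_ltwo.abs_eq sq_integrable_rep_ltwo)
  finally show ?thesis by (simp add: norm_L2_restrict)
qed

lemma inner_to_ltwo:
  fixes f :: "real \<Rightarrow> 'a::{real_inner, banach, second_countable_topology}"
  assumes "sq_integrable (leb T) f"
  shows "inner (to_ltwo T f) x = (\<integral>t. inner (f t) (rep_ltwo x t) \<partial>leb T)"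
proof -
  have "inner (to_ltwo T f) x = inner (to_ltwo T f) (abs_ltwo (rep_ltwo x))" by (simp add: abs_rep_ltwo)
  also have "\<dots> = (\<integral>t. inner (indicator {0<..<T} t *\<^sub>R f t) (rep_ltwo x t) \<partial>lebesgue)"
    using assms unfolding to_ltwo_def
    by (intro inner_ltwo.abs_eq eq_L2_refl sq_integrable_rep_ltwo) (simp add: sq_integrable_restrict)
  also have "\<dots> = (\<integral>t. inner (f t) (rep_ltwo x t) \<partial>leb T)"
    by (subst integral_restrict_space) auto
  finally show ?thesis .
qed

text \<open>The transpose of integration from \<open>0\<close> is integration up to
  \<open>T\<close>: the difference of primitives on the right is the integral of \<open>p\<close>
  over \<open>(t,T)\<close>. This is the origin of the test function in the existence proof.\<close>

lemma integral_inner_prim: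
  fixes g p :: "real \<Rightarrow> 'a::{real_inner, banach, second_countable_topology}"
  assumes "integrable (leb T) g" "integrable (leb T) p"
  shows "(\<integral>t. inner (prim T g t) (p t) \<partial>leb T) =
    (\<integral>t. inner (g t) (prim T p T - prim T p t) \<partial>leb T)"
proof -
  let ?M = "leb T"
  obtain B where B: "\<And>t. norm (prim T p t) \<le> B" using norm_prim_le[OF assms(2)] by blast
  have i1: "integrable ?M (\<lambda>t. inner (g t) (prim T p T))"
    by (rule integrable_bounded_linear[OF bounded_linear_inner_left assms(1)])
  have ib: "integrable ?M (\<lambda>t. norm (g t) * \<bar>B\<bar>)" using assms(1) by simp
  have i2: "integrable ?M (\<lambda>t. inner (g t) (prim T p t))"
  proof (rule Bochner_Integration.integrable_bound[OF ib])
    show "(\<lambda>t. inner (g t) (prim T p t)) \<in> borel_measurable ?M"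
      by (intro borel_measurable_bilinear[OF bounded_bilinear_inner] borel_measurable_integrable
          borel_measurable_prim assms)
    have "norm (inner (g t) (prim T p t)) \<le> norm (norm (g t) * \<bar>B\<bar>)" for t
    proof -
      have "norm (inner (g t) (prim T p t)) \<le> norm (g t) * norm (prim T p t)"
        by (simp add: Cauchy_Schwarz_ineq2)
      also have "\<dots> \<le> norm (g t) * \<bar>B\<bar>" using B[of t] by (intro mult_left_mono) auto
      finally show ?thesis by simp
    qed
    then show "AE t in ?M. norm (inner (g t) (prim T p t)) \<le> norm (norm (g t) * \<bar>B\<bar>)" by simp
  qed
  have "inner (\<integral>t. g t \<partial>?M) (\<integral>t. p t \<partial>?M) = (\<integral>t. inner (g t) (\<integral>t. p t \<partial>?M) \<partial>?M)"
    by (rule integral_bounded_linear[OF bounded_linear_inner_left assms(1), symmetric])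
  then show ?thesis
    using integral_bilinear_prim[OF bounded_bilinear_inner assms] i1 i2
    by (simp add: inner_diff_right prim_end)
qed

context real_gelfand
begin

text \<open>The curve inside \<open>J\<close> has derivative \<open>- p\<close> and final value
  \<open>0\<close>, so the integrand is minus half the derivative of its squared
  \<open>H\<close>-norm and only the value at time \<open>0\<close> remains.\<close>

lemma integral_J_primitive:
  assumes "integrable (leb T) p"
  shows "(\<integral>t. inner (J (prim T p T - prim T p t)) (p t) \<partial>leb T) = (norm (j (prim T p T)))\<^sup>2 / 2"
proof -
  let ?M = "leb T"
  note jl = bounded_linear.linear[OF bounded_linear_j]
  have jp: "integrable ?M (\<lambda>t. j (p t))"
    by (rule integrable_bounded_linear[OF bounded_linear_j assms])
  have pj: "prim T (\<lambda>t. j (p t)) t = j (prim T p t)" for t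
    by (rule prim_bounded_linear[OF bounded_linear_j assms])
  have "(\<integral>t. inner (J (prim T p T - prim T p t)) (p t) \<partial>?M) =
      (\<integral>t. inner (j (p t)) (prim T (\<lambda>t. j (p t)) T - prim T (\<lambda>t. j (p t)) t) \<partial>?M)"
    by (rule Bochner_Integration.integral_cong)
      (simp_all add: inner_J pj linear_diff[OF jl] inner_commute[of "j (p _)"])
  also have "\<dots> = (\<integral>t. inner (prim T (\<lambda>t. j (p t)) t) (j (p t)) \<partial>?M)"
    by (rule integral_inner_prim[OF jp jp, symmetric])
  finally have eq: "(\<integral>t. inner (J (prim T p T - prim T p t)) (p t) \<partial>?M) =
      (\<integral>t. inner (j (p t)) (prim T (\<lambda>t. j (p t)) t) \<partial>?M)"
    by (simp add: inner_commute)
  have "(norm (j (prim T p T)))\<^sup>2 = 2 * (\<integral>t. inner (j (p t)) (prim T (\<lambda>t. j (p t)) t) \<partial>?M)"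
    using prim_quadratic[OF bounded_bilinear_inner inner_commute jp, of 0 T]
    by (simp add: pj power2_norm_eq_inner flip: prim_end[OF order_refl])
  then show ?thesis using eq by simp
qed

text \<open>\<open>BB\<close> acts on functions rather than pointwise, since it may contain memory.
  For a test element with representative \<open>p\<close>, coercivity comes from
  \<open>\<phi>\<close>, the integral of \<open>p\<close> over \<open>(t,T)\<close>: the
  \<open>J\<close>-term gives half of the squared norm of \<open>j (\<phi> 0)\<close>, and
  transposition turns the other term into the quadratic form of \<open>BB\<close> at
  \<open>\<phi>\<close>.\<close>

theorem coercive_existence:
  fixes BB :: "(real \<Rightarrow> 'v) \<Rightarrow> real \<Rightarrow> 'v"
  defines "M T \<equiv> lebesgue_on {0<..<T::real}"
  assumes T: "0 < T"
    and BB: "\<And>v. sq_integrable (M T) v \<Longrightarrow> sq_integrable (M T) (BB v)"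
    and add: "\<And>v w. sq_integrable (M T) v \<Longrightarrow> sq_integrable (M T) w \<Longrightarrow>
      AE t in M T. BB (\<lambda>t. v t + w t) t = BB v t + BB w t"
    and scale: "\<And>r v. sq_integrable (M T) v \<Longrightarrow> AE t in M T. BB (\<lambda>t. r *\<^sub>R v t) t = r *\<^sub>R BB v t"
    and bound: "\<And>v. sq_integrable (M T) v \<Longrightarrow> norm_L2 (M T) (BB v) \<le> C * norm_L2 (M T) v"
    and \<alpha>: "0 < \<alpha>"
    and coercive: "\<And>v. sq_integrable (M T) v \<Longrightarrow>
      \<alpha> * (norm_L2 (M T) v)\<^sup>2 \<le> (\<integral>t. inner (BB v t) (v t) \<partial>M T)"
    and F: "sq_integrable (M T) F"
  shows "\<exists>v. sq_integrable (M T) v \<and>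
    (AE t in M T. J (v t) = hilbert_adj j u1 + prim T (\<lambda>s. F s - BB v s) t)"
proof -
  let ?M = "M T"
  interpret finite_measure ?M unfolding M_def by (rule finite_measure_interval)
  note sqi = sq_integrable_imp_integrable
  have sq_prim: "sq_integrable ?M (prim T g)" if "sq_integrable ?M g" for g :: "real \<Rightarrow> 'v"
    using sq_integrable_prim[OF sqi[OF that, unfolded M_def]] by (simp add: M_def)
  have sq_J: "sq_integrable ?M (\<lambda>t. J (v t))" if "sq_integrable ?M v" for v
    by (rule sq_integrable_bounded_linear[OF bounded_linear_J that])
  \<comment> \<open>That \<open>BB\<close> respects null sets is not assumed; it follows from
    linearity and the bound, since the difference has norm zero. The passage to equivalence classes
    rests on it.\<close>
  have cong: "AE t in ?M. BB v t = BB w t"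
    if v: "sq_integrable ?M v" and w: "sq_integrable ?M w" and vw: "AE t in ?M. v t = w t" for v w
  proof -
    define d where "d t = v t + (- 1) *\<^sub>R w t" for t
    have d: "sq_integrable ?M d" unfolding d_def by (intro sq_integrable_add sq_integrable_scaleR v w)
    have "norm_L2 ?M d = norm_L2 ?M (\<lambda>t. 0 :: 'v)"
    proof (rule norm_L2_cong_AE)
      show "AE t in ?M. d t = 0" using vw by eventually_elim (simp add: d_def)
    qed (use d in \<open>auto simp: sq_integrable_def\<close>)
    then have "norm_L2 ?M (BB d) \<le> 0" using bound[OF d] by (simp add: norm_L2_def)
    then have "AE t in ?M. BB d t = 0"
      using norm_L2_eq_0[OF BB[OF d]] by (simp add: order_antisym)
    moreover have "AE t in ?M. BB d t = BB v t + BB (\<lambda>t. (- 1) *\<^sub>R w t) t"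
      unfolding d_def by (intro add v sq_integrable_scaleR w)
    moreover have "AE t in ?M. BB (\<lambda>t. (- 1) *\<^sub>R w t) t = (- 1) *\<^sub>R BB w t"
      by (rule scale[OF w])
    ultimately show ?thesis by eventually_elim simp
  qed
  define L where "L v t = J (v t) + prim T (BB v) t" for v t
  have sqL: "sq_integrable ?M (L v)" if "sq_integrable ?M v" for v
    unfolding L_def by (intro sq_integrable_add sq_J sq_prim BB that)
  have Lcong: "AE t in ?M. L v t = L w t"
    if v: "sq_integrable ?M v" and w: "sq_integrable ?M w" and vw: "AE t in ?M. v t = w t" for v w
  proof -
    have "prim T (BB v) t = prim T (BB w) t" for t
      using cong[OF that] sqi[OF BB[OF v]] sqi[OF BB[OF w]] unfolding M_def by (rule prim_cong_AE)
    note * = this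
    show ?thesis using vw by eventually_elim (simp add: L_def *)
  qed
  define \<Lambda> where "\<Lambda> x = to_ltwo T (L (rep_ltwo x))" for x
  note sqr = sq_integrable_rep_ltwo_on[of T, folded M_def]
  note sqLr = sqL[OF sqr]
  obtain KJ where KJ: "\<And>v. norm (J v) \<le> norm v * KJ" "0 \<le> KJ"
    using bounded_linear.nonneg_bounded[OF bounded_linear_J] by blast
  have \<Lambda>: "bounded_linear \<Lambda>"
  proof (rule bounded_linear_intro)
    fix x y :: "'v ltwo" and r :: real
    show "\<Lambda> (x + y) = \<Lambda> x + \<Lambda> y"
    proof -
      have "AE t in ?M. L (\<lambda>t. rep_ltwo x t + rep_ltwo y t) t = L (rep_ltwo x) t + L (rep_ltwo y) t"
      proof -
        have "prim T (BB (\<lambda>t. rep_ltwo x t + rep_ltwo y t)) t = prim T (BB (rep_ltwo x)) t + prim T (BB (rep_ltwo y)) t" for t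
        proof -
          have "prim T (BB (\<lambda>t. rep_ltwo x t + rep_ltwo y t)) t = prim T (\<lambda>t. BB (rep_ltwo x) t + BB (rep_ltwo y) t) t"
            using add[OF sqr sqr, of x y]
              sqi[OF BB[OF sq_integrable_add[OF sqr sqr]], of x y]
              sqi[OF sq_integrable_add[OF BB[OF sqr] BB[OF sqr]], of x y]
            unfolding M_def by (rule prim_cong_AE)
          also have "\<dots> = prim T (BB (rep_ltwo x)) t + prim T (BB (rep_ltwo y)) t"
            using sqi[OF BB[OF sqr], of x] sqi[OF BB[OF sqr], of y] unfolding M_def by (rule prim_add)
          finally show ?thesis .
        qed
        then show ?thesis
          by (simp add: L_def linear_add[OF bounded_linear.linear[OF bounded_linear_J]] add_ac)
      qed
      with Lcong[OF sqr sq_integrable_add[OF sqr sqr] rep_ltwo_add[where T = T and x = x and y = y, folded M_def]]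
      have "AE t in ?M. L (rep_ltwo (x + y)) t = L (rep_ltwo x) t + L (rep_ltwo y) t"
        by eventually_elim simp
      then have "\<Lambda> (x + y) = to_ltwo T (\<lambda>t. L (rep_ltwo x) t + L (rep_ltwo y) t)"
        using sqLr[of "x + y"] sq_integrable_add[OF sqLr[of x] sqLr[of y]]
        unfolding \<Lambda>_def M_def by (intro to_ltwo_cong)
      also have "\<dots> = \<Lambda> x + \<Lambda> y"
        unfolding \<Lambda>_def using sqLr by (intro to_ltwo_add) (auto simp: M_def)
      finally show ?thesis .
    qed
    show "\<Lambda> (r *\<^sub>R x) = r *\<^sub>R \<Lambda> x"
    proof -
      have "AE t in ?M. L (\<lambda>t. r *\<^sub>R rep_ltwo x t) t = r *\<^sub>R L (rep_ltwo x) t"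
      proof -
        have "prim T (BB (\<lambda>t. r *\<^sub>R rep_ltwo x t)) t = prim T (\<lambda>t. r *\<^sub>R BB (rep_ltwo x) t) t" for t
          using scale[OF sqr, of r x]
            sqi[OF BB[OF sq_integrable_scaleR[OF sqr]], of r x]
            sqi[OF sq_integrable_scaleR[OF BB[OF sqr]], of r x]
          unfolding M_def by (rule prim_cong_AE)
        then show ?thesis
          by (simp add: L_def prim_scaleR scaleR_add_right linear_scale[OF bounded_linear.linear[OF bounded_linear_J]])
      qed
      with Lcong[OF sqr sq_integrable_scaleR[OF sqr] rep_ltwo_scaleR[where T = T and r = r and x = x, folded M_def]]
      have "AE t in ?M. L (rep_ltwo (r *\<^sub>R x)) t = r *\<^sub>R L (rep_ltwo x) t"
        by eventually_elim simp
      then have "\<Lambda> (r *\<^sub>R x) = to_ltwo T (\<lambda>t. r *\<^sub>R L (rep_ltwo x) t)"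
        using sqLr[of "r *\<^sub>R x"] sq_integrable_scaleR[OF sqLr[of x]]
        unfolding \<Lambda>_def M_def by (intro to_ltwo_cong)
      also have "\<dots> = r *\<^sub>R \<Lambda> x"
        unfolding \<Lambda>_def using sqLr by (intro to_ltwo_scaleR) (auto simp: M_def)
      finally show ?thesis .
    qed
    show "norm (\<Lambda> x) \<le> norm x * (KJ + T * \<bar>C\<bar>)"
    proof -
      have "norm (\<Lambda> x) = norm_L2 ?M (L (rep_ltwo x))"
        unfolding \<Lambda>_def M_def by (rule norm_to_ltwo[OF sqLr[unfolded M_def]])
      also have "\<dots> \<le> norm_L2 ?M (\<lambda>t. J (rep_ltwo x t)) + norm_L2 ?M (prim T (BB (rep_ltwo x)))"
        unfolding L_def by (intro norm_L2_triangle sq_J sq_prim BB sqr)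
      also have "norm_L2 ?M (\<lambda>t. J (rep_ltwo x t)) \<le> \<bar>KJ\<bar> * norm_L2 ?M (rep_ltwo x)"
        using KJ by (intro sq_integrable_dominated(2)[OF sqr])
          (auto simp: mult.commute intro: sq_integrable_measurable[OF sq_J[OF sqr]])
      also have "norm_L2 ?M (prim T (BB (rep_ltwo x))) \<le>
          \<bar>sqrt T * norm_L2 ?M (BB (rep_ltwo x))\<bar> * norm_L2 ?M (\<lambda>_. 1::real)"
      proof (rule sq_integrable_dominated(2)[OF sq_integrable_const])
        show "prim T (BB (rep_ltwo x)) \<in> borel_measurable ?M"
          by (rule sq_integrable_measurable[OF sq_prim[OF BB[OF sqr]]])
        show "AE t in ?M. norm (prim T (BB (rep_ltwo x)) t) \<le> sqrt T * norm_L2 ?M (BB (rep_ltwo x)) * norm (1::real)"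
          using norm_prim_le_L2[OF less_imp_le[OF T] BB[OF sqr, unfolded M_def]] by (simp add: M_def)
      qed
      also have "norm_L2 ?M (\<lambda>_. 1::real) = sqrt T"
        using T by (simp add: M_def norm_L2_def measure_restrict_space)
      also have "\<bar>sqrt T * norm_L2 ?M (BB (rep_ltwo x))\<bar> * sqrt T = T * norm_L2 ?M (BB (rep_ltwo x))"
        using T by (simp add: abs_mult)
      also have "norm_L2 ?M (BB (rep_ltwo x)) \<le> \<bar>C\<bar> * norm_L2 ?M (rep_ltwo x)"
        using bound[OF sqr, of x] mult_right_mono[OF abs_ge_self[of C] norm_L2_nonneg[of ?M "rep_ltwo x"]] by linarith
      also have "\<bar>KJ\<bar> * norm_L2 ?M (rep_ltwo x) + T * (\<bar>C\<bar> * norm_L2 ?M (rep_ltwo x)) =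
          norm_L2 ?M (rep_ltwo x) * (KJ + T * \<bar>C\<bar>)"
        using KJ(2) by (simp add: algebra_simps)
      also have "\<dots> \<le> norm x * (KJ + T * \<bar>C\<bar>)"
        using KJ(2) T norm_rep_ltwo_le[where T = T and x = x] by (intro mult_right_mono) (auto simp: M_def)
      finally show ?thesis using T by simp
    qed
  qed
  define hf where "hf t = hilbert_adj j u1 + prim T F t" for t
  have sqhf: "sq_integrable ?M hf"
    unfolding hf_def by (intro sq_integrable_add sq_integrable_const sq_prim F)
  define c where "c = min \<alpha> (1/2)"
  have "\<exists>v. \<Lambda> v = to_ltwo T hf"
  proof (rule Lions_representation[OF \<Lambda>, of c _ "norm u1 + norm_L2 ?M F"])
    show "0 < c" using \<alpha> by (simp add: c_def)
    fix \<psi> :: "'v ltwo"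
    define p where "p = rep_ltwo \<psi>"
    have p: "sq_integrable ?M p" unfolding p_def by (rule sqr)
    have pi: "integrable (leb T) p" using sqi[OF p] by (simp add: M_def)
    define e where "e = prim T p T"
    define \<phi> where "\<phi> t = e - prim T p t" for t
    have \<phi>: "sq_integrable ?M \<phi>" unfolding \<phi>_def by (intro sq_integrable_diff sq_integrable_const sq_prim p)
    \<comment> \<open>The value \<open>e\<close> of \<open>\<phi>\<close> at \<open>0\<close> is
      paired with \<open>u1\<close>, and the L2 norm of \<open>\<phi>\<close> does not control it;
      it is therefore made part of the stronger norm. The factor \<open>1/2\<close> of its square
      explains the second entry of \<open>c\<close>.\<close>
    define n where "n = sqrt ((norm_L2 ?M \<phi>)\<^sup>2 + (norm (j e))\<^sup>2)"
    have n: "norm_L2 ?M \<phi> \<le> n" "norm (j e) \<le> n" unfolding n_def by (auto intro: real_le_rsqrt)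
    have prim_\<phi>: "(\<integral>t. inner (prim T g t) (p t) \<partial>?M) = (\<integral>t. inner (g t) (\<phi> t) \<partial>?M)"
      if "sq_integrable ?M g" for g
      using integral_inner_prim[OF sqi[OF that, unfolded M_def] pi] by (simp add: M_def \<phi>_def e_def)
    have "inner (\<Lambda> (to_ltwo T \<phi>)) \<psi> = (\<integral>t. inner (L (rep_ltwo (to_ltwo T \<phi>)) t) (p t) \<partial>?M)"
      unfolding \<Lambda>_def p_def M_def by (rule inner_to_ltwo[OF sqLr[unfolded M_def]])
    also have "\<dots> = (\<integral>t. inner (L \<phi> t) (p t) \<partial>?M)"
    proof (rule integral_cong_AE)
      show "AE t in ?M. inner (L (rep_ltwo (to_ltwo T \<phi>)) t) (p t) = inner (L \<phi> t) (p t)"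
        using Lcong[OF sqr \<phi> rep_to_ltwo[OF \<phi>[unfolded M_def], folded M_def]] by eventually_elim simp
    qed (auto intro!: borel_measurable_integrable sq_integrable_inner sqL \<phi> sqr p)
    also have "\<dots> = (\<integral>t. inner (J (\<phi> t)) (p t) + inner (prim T (BB \<phi>) t) (p t) \<partial>?M)"
      by (simp add: L_def inner_add_left)
    also have "\<dots> = (\<integral>t. inner (J (\<phi> t)) (p t) \<partial>?M) + (\<integral>t. inner (prim T (BB \<phi>) t) (p t) \<partial>?M)"
      by (intro Bochner_Integration.integral_add sq_integrable_inner sq_J sq_prim BB \<phi> p)
    also have "(\<integral>t. inner (J (\<phi> t)) (p t) \<partial>?M) = (norm (j e))\<^sup>2 / 2"
      using integral_J_primitive[OF pi] by (simp add: M_def \<phi>_def e_def)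
    also have "(\<integral>t. inner (prim T (BB \<phi>) t) (p t) \<partial>?M) = (\<integral>t. inner (BB \<phi> t) (\<phi> t) \<partial>?M)"
      by (rule prim_\<phi>[OF BB[OF \<phi>]])
    finally have "(norm (j e))\<^sup>2 / 2 + \<alpha> * (norm_L2 ?M \<phi>)\<^sup>2 \<le> inner (\<Lambda> (to_ltwo T \<phi>)) \<psi>"
      using coercive[OF \<phi>] by simp
    moreover have "c * n\<^sup>2 \<le> (norm (j e))\<^sup>2 / 2 + \<alpha> * (norm_L2 ?M \<phi>)\<^sup>2"
    proof -
      have "c * (norm_L2 ?M \<phi>)\<^sup>2 \<le> \<alpha> * (norm_L2 ?M \<phi>)\<^sup>2" "c * (norm (j e))\<^sup>2 \<le> 1/2 * (norm (j e))\<^sup>2"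
        by (intro mult_right_mono; simp add: c_def)+
      then show ?thesis by (simp add: n_def distrib_left)
    qed
    ultimately have 1: "c * n\<^sup>2 \<le> inner (\<Lambda> (to_ltwo T \<phi>)) \<psi>" by simp
    have ip: "integrable ?M (\<lambda>t. inner (hilbert_adj j u1) (p t))"
      by (intro sq_integrable_inner sq_integrable_const p)
    have "inner (to_ltwo T hf) \<psi> = (\<integral>t. inner (hf t) (p t) \<partial>?M)"
      unfolding p_def M_def by (rule inner_to_ltwo[OF sqhf[unfolded M_def]])
    also have "\<dots> = (\<integral>t. inner (hilbert_adj j u1) (p t) + inner (prim T F t) (p t) \<partial>?M)"
      by (simp add: hf_def inner_add_left)
    also have "\<dots> = (\<integral>t. inner (hilbert_adj j u1) (p t) \<partial>?M) + (\<integral>t. inner (prim T F t) (p t) \<partial>?M)"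
      by (intro Bochner_Integration.integral_add ip sq_integrable_inner sq_prim F p)
    also have "(\<integral>t. inner (hilbert_adj j u1) (p t) \<partial>?M) = inner u1 (j e)"
      using integral_bounded_linear[OF bounded_linear_inner_right sqi[OF p], of "hilbert_adj j u1"]
      by (simp add: e_def prim_end M_def inner_hilbert_adj[OF bounded_linear_j])
    also have "(\<integral>t. inner (prim T F t) (p t) \<partial>?M) = (\<integral>t. inner (F t) (\<phi> t) \<partial>?M)"
      by (rule prim_\<phi>[OF F])
    finally have "\<bar>inner (to_ltwo T hf) \<psi>\<bar> \<le> \<bar>inner u1 (j e)\<bar> + \<bar>\<integral>t. inner (F t) (\<phi> t) \<partial>?M\<bar>"
      by simp
    also have "\<dots> \<le> norm u1 * norm (j e) + norm_L2 ?M F * norm_L2 ?M \<phi>"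
      by (intro add_mono Cauchy_Schwarz_ineq2 integral_inner_le F \<phi>)
    also have "\<dots> \<le> norm u1 * n + norm_L2 ?M F * n"
      by (intro add_mono mult_left_mono n) auto
    finally have 2: "\<bar>inner (to_ltwo T hf) \<psi>\<bar> \<le> (norm u1 + norm_L2 ?M F) * n"
      by (simp add: distrib_right)
    have 0: "norm (to_ltwo T \<phi>) \<le> n"
      using norm_to_ltwo[OF \<phi>[unfolded M_def]] n(1) by (simp add: M_def)
    show "\<exists>\<phi> n. norm \<phi> \<le> n \<and> c * n\<^sup>2 \<le> inner (\<Lambda> \<phi>) \<psi> \<and> \<bar>inner (to_ltwo T hf) \<psi>\<bar> \<le> (norm u1 + norm_L2 ?M F) * n"
      using 0 1 2 by blast
  qed
  then obtain x where x: "\<Lambda> x = to_ltwo T hf" ..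
  define v where "v = rep_ltwo x"
  have v: "sq_integrable ?M v" unfolding v_def by (rule sqr)
  have Lv: "AE t in ?M. L v t = hf t"
    using to_ltwo_eqD[OF sqLr[unfolded M_def] sqhf[unfolded M_def] x[unfolded \<Lambda>_def]]
    unfolding M_def v_def .
  have pd: "prim T (\<lambda>s. F s - BB v s) t = prim T F t - prim T (BB v) t" for t
    using sqi[OF F] sqi[OF BB[OF v]] unfolding M_def by (rule prim_diff)
  have "AE t in ?M. J (v t) = hilbert_adj j u1 + prim T (\<lambda>s. F s - BB v s) t"
    using Lv by eventually_elim (simp add: L_def hf_def pd algebra_simps)
  with v show ?thesis by blast
qed

text \<open>The kernel of the adjoint is the orthogonal complement of the range of \<open>j\<close>,
  trivial by density.\<close>

lemma hilbert_adj_inj: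
  assumes "closure (range j) = UNIV" "hilbert_adj j x = hilbert_adj j y"
  shows "x = y"
proof -
  have "inner (x - y) h = 0" for h
  proof -
    have "h \<in> closure (range j)" using assms(1) by simp
    then obtain s where s: "\<And>n. s n \<in> range j" "s \<longlonglongrightarrow> h" by (auto simp: closure_sequential)
    have "inner (x - y) (s n) = 0" for n
    proof -
      obtain v where "s n = j v" using s(1) by blast
      then show ?thesis
        using arg_cong[OF assms(2), of "\<lambda>u. inner u v"]
        by (simp add: inner_hilbert_adj[OF bounded_linear_j] inner_diff_left)
    qed
    moreover have "(\<lambda>n. inner (x - y) (s n)) \<longlonglongrightarrow> inner (x - y) h" by (intro tendsto_intros s)
    ultimately show ?thesis by (simp add: LIMSEQ_const_iff)
  qed
  from this[of "x - y"] show ?thesis by simp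
qed

text \<open>The energy identity at \<open>T\<close>, with the nonnegative energy at \<open>T\<close>
  dropped, gives a quadratic inequality for the L2 norm of \<open>v\<close>. Bounding its solution
  by a sum of two terms keeps the estimate linear in the data.\<close>

theorem energy_estimate:
  assumes T: "0 < T" and dense: "closure (range j) = UNIV"
    and v: "sq_integrable (leb T) v" and F: "sq_integrable (leb T) F"
    and G: "sq_integrable (leb T) G" and \<alpha>: "0 < \<alpha>"
    and eq: "AE t in leb T. J (v t) = hilbert_adj j u1 + prim T (\<lambda>s. F s - G s) t"
    and coercive: "\<alpha> * (norm_L2 (leb T) v)\<^sup>2 \<le> (\<integral>t. inner (G t) (v t) \<partial>leb T)"
  shows "norm_L2 (leb T) v \<le> norm_L2 (leb T) F / \<alpha> + norm u1 / sqrt (2 * \<alpha>)"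
proof -
  let ?M = "leb T"
  obtain z where "continuous_on UNIV z" "AE t in ?M. j (v t) = z t"
    and z: "\<And>t. hilbert_adj j (z t) = hilbert_adj j u1 + prim T (\<lambda>s. F s - G s) t"
    "\<And>t. (norm (z t))\<^sup>2 = (norm (z 0))\<^sup>2 + 2 * prim T (\<lambda>s. inner (F s - G s) (v s)) t"
    by (rule Lions_continuity[OF T v sq_integrable_diff[OF F G] eq]) (rule that)
  have z0: "z 0 = u1" using z(1)[of 0] by (intro hilbert_adj_inj[OF dense]) (simp add: prim_0)
  have "prim T (\<lambda>s. inner (F s - G s) (v s)) T = (\<integral>t. inner (F t) (v t) \<partial>?M) - (\<integral>t. inner (G t) (v t) \<partial>?M)"
    by (simp add: prim_end inner_diff_left sq_integrable_inner F G v)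
  then have "2 * (\<integral>t. inner (G t) (v t) \<partial>?M) \<le> (norm u1)\<^sup>2 + 2 * (\<integral>t. inner (F t) (v t) \<partial>?M)"
    using z(2)[of T] zero_le_power2[of "norm (z T)"] unfolding z0 by linarith
  moreover have "(\<integral>t. inner (F t) (v t) \<partial>?M) \<le> norm_L2 ?M F * norm_L2 ?M v"
    using integral_inner_le[OF F v] by linarith
  ultimately have main: "\<alpha> * (norm_L2 ?M v)\<^sup>2 \<le> (norm u1)\<^sup>2 / 2 + norm_L2 ?M F * norm_L2 ?M v"
    using coercive by linarith
  \<comment> \<open>\<open>e\<close> is the solution for \<open>F = 0\<close>, where
    \<open>\<alpha> e\<^sup>2 = (norm u1)\<^sup>2 / 2\<close>; similarly \<open>b / \<alpha>\<close>
    is the one for \<open>u1 = 0\<close>.\<close>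
  define a b e where "a = norm_L2 ?M v" and "b = norm_L2 ?M F" and "e = norm u1 / sqrt (2 * \<alpha>)"
  have e2: "\<alpha> * e * e = (norm u1)\<^sup>2 / 2"
    using \<alpha> by (simp add: e_def power2_eq_square)
  have nn: "0 \<le> e" "0 \<le> b" using \<alpha> by (auto simp: e_def b_def)
  have "a \<le> b / \<alpha> + e"
  proof (rule ccontr)
    assume "\<not> a \<le> b / \<alpha> + e"
    then have gt: "b / \<alpha> + e < a" by simp
    then have 1: "\<alpha> * e < \<alpha> * a - b" using \<alpha> by (simp add: field_simps)
    have "0 \<le> b / \<alpha>" using nn \<alpha> by simp
    then have 2: "e \<le> a" "0 < a" using gt nn by linarith+
    have "\<alpha> * e * e \<le> \<alpha> * e * a" using 2 nn \<alpha> by (intro mult_left_mono) auto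
    also have "\<dots> < (\<alpha> * a - b) * a" using 1 2(2) by (rule mult_strict_right_mono)
    finally show False using main e2 by (simp add: a_def[symmetric] b_def[symmetric] power2_eq_square algebra_simps)
  qed
  then show ?thesis by (simp add: a_def b_def e_def)
qed

end


section \<open>Operators given by measurable families of forms\<close>

text \<open>Pettis' theorem for separable Hilbert spaces: closed balls are countable intersections of
  half-spaces.\<close>

lemma borel_measurable_weakly:
  fixes f :: "'a \<Rightarrow> 'v::{real_inner, second_countable_topology}"
  assumes weak: "\<And>w. (\<lambda>t. inner (f t) w) \<in> borel_measurable M"
  shows "f \<in> borel_measurable M"
proof -
  obtain D :: "'v set" where D: "countable D" "\<And>X. open X \<Longrightarrow> X \<noteq> {} \<Longrightarrow> \<exists>d\<in>D. d \<in> X"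
    using countable_dense_exists by metis
  have ball: "y \<in> cball x r \<longleftrightarrow> (\<forall>d\<in>D. inner (y - x) d \<le> r * norm d)" if "0 \<le> r" for x y :: 'v and r
  proof
    assume "y \<in> cball x r"
    then have le: "norm (y - x) \<le> r" by (simp add: dist_norm norm_minus_commute)
    show "\<forall>d\<in>D. inner (y - x) d \<le> r * norm d"
    proof
      fix d
      have "inner (y - x) d \<le> norm (y - x) * norm d" by (rule norm_cauchy_schwarz)
      also have "\<dots> \<le> r * norm d" using le by (intro mult_right_mono) auto
      finally show "inner (y - x) d \<le> r * norm d" .
    qed
  next
    assume *: "\<forall>d\<in>D. inner (y - x) d \<le> r * norm d"
    \<comment> \<open>The vectors violating the inequality form an open set, which by density would
      meet \<open>D\<close>. Choosing \<open>d = y - x\<close> afterwards recovers the norm.\<close>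
    have "inner (y - x) d \<le> r * norm d" for d
    proof (rule ccontr)
      assume "\<not> inner (y - x) d \<le> r * norm d"
      then have "d \<in> {d. r * norm d < inner (y - x) d}" by simp
      then have "{d. r * norm d < inner (y - x) d} \<noteq> {}" by blast
      moreover have "open {d. r * norm d < inner (y - x) d}"
        by (intro open_Collect_less continuous_intros)
      ultimately show False using D(2)[of "{d. r * norm d < inner (y - x) d}"] * by fastforce
    qed
    from this[of "y - x"] have "norm (y - x) * norm (y - x) \<le> r * norm (y - x)"
      by (simp add: power2_norm_eq_inner[symmetric] power2_eq_square)
    then have "norm (y - x) \<le> r" using that by (cases "y = x") auto
    then show "y \<in> cball x r" by (simp add: dist_norm norm_minus_commute)
  qed
  have cball: "f -` cball x r \<inter> space M \<in> sets M" if "0 \<le> r" for x r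
  proof -
    have "f -` cball x r \<inter> space M = {t \<in> space M. \<forall>d\<in>D. inner (f t) d - inner x d \<le> r * norm d}"
      using ball[OF that] by (auto simp: inner_diff_left)
    also have "\<dots> \<in> sets M"
      using D(1) weak by measurable
    finally show ?thesis .
  qed
  show ?thesis
  proof (rule borel_measurableI)
    fix U :: "'v set" assume U: "open U"
    \<comment> \<open>Balls with centres in \<open>D\<close> and rational radii exhaust an open set.
      For a centre within \<open>e / 4\<close> of \<open>x\<close>, a radius between
      \<open>e / 4\<close> and \<open>e / 2\<close> reaches \<open>x\<close> and stays inside
      \<open>ball x e\<close>.\<close>
    define I where "I = {(d, q). d \<in> D \<and> 0 \<le> real_of_rat q \<and> cball d (real_of_rat q) \<subseteq> U}"
    have "countable I"
      by (rule countable_subset[of _ "D \<times> UNIV"]) (use D(1) in \<open>auto simp: I_def\<close>)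
    have "U = (\<Union>(d, q)\<in>I. cball d (real_of_rat q))"
    proof
      show "U \<subseteq> (\<Union>(d, q)\<in>I. cball d (real_of_rat q))"
      proof
        fix x assume "x \<in> U"
        then obtain e where e: "0 < e" "ball x e \<subseteq> U" using U by (auto simp: open_contains_ball)
        obtain q where q: "e / 4 < real_of_rat q" "real_of_rat q < e / 2"
          using of_rat_dense[of "e / 4" "e / 2"] e by auto
        obtain d where d: "d \<in> D" "d \<in> ball x (e / 4)"
          using D(2)[of "ball x (e / 4)"] e by auto
        have "cball d (real_of_rat q) \<subseteq> ball x e"
        proof
          fix y assume "y \<in> cball d (real_of_rat q)"
          then show "y \<in> ball x e"
            using dist_triangle[of x y d] d(2) q e(1) by simp
        qed
        moreover have "0 \<le> real_of_rat q" using q e by linarith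
        ultimately have "(d, q) \<in> I" using d(1) e by (auto simp: I_def)
        moreover have "x \<in> cball d (real_of_rat q)" using d(2) q by (simp add: dist_commute)
        ultimately show "x \<in> (\<Union>(d, q)\<in>I. cball d (real_of_rat q))" by blast
      qed
    qed (auto simp: I_def)
    then have "f -` U \<inter> space M = (\<Union>i\<in>I. f -` cball (fst i) (real_of_rat (snd i)) \<inter> space M)"
      by (auto simp: split_beta)
    also have "\<dots> \<in> sets M"
      by (rule sets.countable_UN'[OF \<open>countable I\<close>]) (auto simp: I_def intro!: cball)
    finally show "f -` U \<inter> space M \<in> sets M" .
  qed
qed

text \<open>The operator of the form followed by the Riesz isomorphism, hence with values in the
  space itself.\<close>

definition form_op :: "(real \<Rightarrow> 'v::{real_inner, banach} \<Rightarrow> 'v \<Rightarrow> real) \<Rightarrow> real \<Rightarrow> 'v \<Rightarrow> 'v" where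
  "form_op c t u = riesz_rep (c t u)"

locale real_form =
  fixes T :: real and c :: "real \<Rightarrow> 'v::{real_inner, banach, second_countable_topology} \<Rightarrow> 'v \<Rightarrow> real"
    and K :: real
  assumes bilinear: "t \<in> {0<..<T} \<Longrightarrow> bounded_bilinear (c t)"
    and bound: "t \<in> {0<..<T} \<Longrightarrow> \<bar>c t u w\<bar> \<le> K * norm u * norm w"
    and K_nonneg: "0 \<le> K"
    and measurable_form: "(\<lambda>t. c t u w) \<in> borel_measurable (leb T)"
begin

lemma inner_form_op: "t \<in> {0<..<T} \<Longrightarrow> inner (form_op c t u) w = c t u w"
  unfolding form_op_def
  by (intro inner_riesz_rep bounded_bilinear.bounded_linear_right bilinear)

lemma form_op_add: "t \<in> {0<..<T} \<Longrightarrow> form_op c t (u + u') = form_op c t u + form_op c t u'"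
  by (rule inner_ext)
    (simp add: inner_form_op inner_add_left bounded_bilinear.add_left[OF bilinear])

lemma form_op_scaleR: "t \<in> {0<..<T} \<Longrightarrow> form_op c t (r *\<^sub>R u) = r *\<^sub>R form_op c t u"
  by (rule inner_ext)
    (simp add: inner_form_op bounded_bilinear.scaleR_left[OF bilinear])

lemma form_op_diff: "t \<in> {0<..<T} \<Longrightarrow> form_op c t (u - u') = form_op c t u - form_op c t u'"
  using form_op_add[of t u "(- 1) *\<^sub>R u'"] form_op_scaleR[of t "- 1" u'] by simp

lemma norm_form_op: "t \<in> {0<..<T} \<Longrightarrow> norm (form_op c t u) \<le> K * norm u"
proof (cases "form_op c t u = 0")
  case False
  assume t: "t \<in> {0<..<T}"
  have "norm (form_op c t u) * norm (form_op c t u) = c t u (form_op c t u)"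
    using inner_form_op[OF t, of u "form_op c t u"]
    by (simp add: power2_norm_eq_inner[symmetric] flip: power2_eq_square)
  also have "\<dots> \<le> K * norm u * norm (form_op c t u)" using bound[OF t] abs_le_D1 by blast
  finally show ?thesis using False by simp
qed (use K_nonneg in simp)

text \<open>The argument \<open>v t\<close> varies with \<open>t\<close>, so two rounds of weak
  measurability are made. The transposed form at fixed \<open>w\<close> is represented by a weakly
  measurable, hence measurable, vector; its inner product with \<open>v t\<close> is
  \<open>c t (v t) w\<close>.\<close>

lemma measurable_form_op:
  assumes v: "v \<in> borel_measurable (leb T)"
  shows "(\<lambda>t. form_op c t (v t)) \<in> borel_measurable (leb T)"
proof (rule borel_measurable_weakly)
  fix w
  define c' where "c' t w u = c t u w" for t u w
  have c': "inner (form_op c' t w) u = c t u w" if "t \<in> {0<..<T}" for t u w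
    using bounded_bilinear.bounded_linear_left[OF bilinear[OF that], of w]
    unfolding form_op_def c'_def by (rule inner_riesz_rep)
  have "(\<lambda>t. form_op c' t w) \<in> borel_measurable (leb T)"
  proof (rule borel_measurable_weakly)
    fix u
    show "(\<lambda>t. inner (form_op c' t w) u) \<in> borel_measurable (leb T)"
      using measurable_form[of u w] by (subst measurable_lebesgue_cong[OF c']) auto
  qed
  from borel_measurable_bilinear[OF bounded_bilinear_inner this v]
  show "(\<lambda>t. inner (form_op c t (v t)) w) \<in> borel_measurable (leb T)"
    by (subst measurable_lebesgue_cong[of _ _ "\<lambda>t. inner (form_op c' t w) (v t)"])
      (simp_all add: inner_form_op c')
qed

lemma sq_integrable_form_op:
  assumes "sq_integrable (leb T) v"
  shows "sq_integrable (leb T) (\<lambda>t. form_op c t (v t))"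
    and "norm_L2 (leb T) (\<lambda>t. form_op c t (v t)) \<le> K * norm_L2 (leb T) v"
proof -
  have m: "(\<lambda>t. form_op c t (v t)) \<in> borel_measurable (leb T)"
    by (rule measurable_form_op[OF sq_integrable_measurable[OF assms]])
  have "AE t in leb T. norm (form_op c t (v t)) \<le> K * norm (v t)"
    by (rule AE_lebesgue_onI[OF norm_form_op])
  from sq_integrable_dominated[OF assms m this]
  show "sq_integrable (leb T) (\<lambda>t. form_op c t (v t))"
    and "norm_L2 (leb T) (\<lambda>t. form_op c t (v t)) \<le> K * norm_L2 (leb T) v"
    using K_nonneg by simp_all
qed

end


section \<open>Exponential weights\<close>

definition weight :: "real \<Rightarrow> (real \<Rightarrow> 'a::real_vector) \<Rightarrow> real \<Rightarrow> 'a" where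
  "weight \<mu> v t = exp (\<mu> * t) *\<^sub>R v t"

lemma weight_weight: "weight \<mu> (weight (- \<mu>) v) = v" "weight (- \<mu>) (weight \<mu> v) = v"
  by (auto simp: weight_def fun_eq_iff exp_add[symmetric])

lemma sq_integrable_weight:
  fixes v :: "real \<Rightarrow> 'b::{banach, second_countable_topology}"
  assumes v: "sq_integrable (leb T) v"
  shows "sq_integrable (leb T) (weight \<mu> v)"
    and "norm_L2 (leb T) (weight \<mu> v) \<le> exp (\<bar>\<mu>\<bar> * T) * norm_L2 (leb T) v"
proof -
  have [measurable]: "v \<in> borel_measurable (leb T)"
    using v by (simp add: sq_integrable_def)
  have [measurable]: "(\<lambda>t. exp (\<mu> * t)) \<in> borel_measurable (leb T)"
    by (rule borel_measurable_lebesgue_onI) measurable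
  have m: "weight \<mu> v \<in> borel_measurable (leb T)"
    unfolding weight_def by measurable
  have "AE t in leb T. norm (weight \<mu> v t) \<le> exp (\<bar>\<mu>\<bar> * T) * norm (v t)"
  proof (rule AE_lebesgue_onI)
    fix t assume t: "t \<in> {0<..<T}"
    have "\<mu> * t \<le> \<bar>\<mu>\<bar> * T" using t by (intro mult_mono) auto
    then show "norm (weight \<mu> v t) \<le> exp (\<bar>\<mu>\<bar> * T) * norm (v t)"
      by (simp add: weight_def mult_right_mono)
  qed
  from sq_integrable_dominated[OF v m this]
  show "sq_integrable (leb T) (weight \<mu> v)"
    and "norm_L2 (leb T) (weight \<mu> v) \<le> exp (\<bar>\<mu>\<bar> * T) * norm_L2 (leb T) v"
    by simp_all
qed

lemma prim_cong:
  fixes f g :: "real \<Rightarrow> 'b::{banach, second_countable_topology}"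
  assumes "\<And>s. s \<in> {0<..<T} \<Longrightarrow> f s = g s"
  shows "prim T f t = prim T g t"
  unfolding prim_def by (rule Bochner_Integration.integral_cong) (use assms in auto)

text \<open>The product rule for an exponential times an absolutely continuous curve, in integrated
  form. It is confined to \<open>[0,T]\<close> because primitives are frozen outside while the
  exponential is not.\<close>

lemma weight_prim:
  fixes g :: "real \<Rightarrow> 'b::{banach, second_countable_topology}"
  assumes g: "integrable (leb T) g" and t: "t \<in> {0..T}"
  shows "weight \<mu> (\<lambda>t. x + prim T g t) t =
    x + prim T (\<lambda>s. weight \<mu> g s + \<mu> *\<^sub>R weight \<mu> (\<lambda>t. x + prim T g t) s) t"
proof -
  let ?M = "leb T"
  \<comment> \<open>The exponential is \<open>1\<close> plus a primitive of \<open>f\<close>;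
    splitting off the \<open>1\<close> leaves a product of two primitives.\<close>
  define f where "f s = \<mu> * exp (\<mu> * s)" for s
  have fc: "continuous_on UNIV f" unfolding f_def by (intro continuous_intros)
  have fi: "integrable ?M f" by (rule integrable_continuous_lebesgue_on[OF fc])
  have pf: "prim T f s = exp (\<mu> * s) - 1" if "s \<in> {0..T}" for s
  proof -
    have "(f has_integral exp (\<mu> * s) - exp (\<mu> * 0)) {0..s}"
      using that unfolding f_def
      by (intro fundamental_theorem_of_calculus)
        (auto intro!: derivative_eq_intros simp: has_real_derivative_iff_has_vector_derivative[symmetric])
    then show ?thesis using that by (simp add: prim_eq_HK[OF fc] integral_unique)
  qed
  have ec: "continuous_on UNIV (\<lambda>s. exp (\<mu> * s) - 1)" "continuous_on UNIV (\<lambda>s. exp (\<mu> * s))"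
    by (intro continuous_intros)+
  have i0: "integrable ?M (\<lambda>s. (exp (\<mu> * s) - 1) *\<^sub>R g s)"
    by (rule integrable_scaleR_test[OF g ec(1)])
  have i1: "integrable ?M (\<lambda>s. f s *\<^sub>R prim T g s)"
    by (intro integrable_scaleR_test fc integrable_continuous_lebesgue_on continuous_on_prim g)
  have i2: "integrable ?M (\<lambda>s. f s *\<^sub>R x)" using fi by (rule integrable_scaleR_left)
  have e: "exp (\<mu> * t) *\<^sub>R y = y + prim T f t *\<^sub>R y" for y :: 'b
    using pf[OF t] by (simp add: scaleR_diff_left)
  have "prim T f t *\<^sub>R prim T g t = prim T (\<lambda>s. f s *\<^sub>R prim T g s) t + prim T (\<lambda>s. prim T f s *\<^sub>R g s) t"
    by (rule prim_product[OF bounded_bilinear_scaleR fi g])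
  also have "prim T (\<lambda>s. prim T f s *\<^sub>R g s) t = prim T (\<lambda>s. (exp (\<mu> * s) - 1) *\<^sub>R g s) t"
    by (rule prim_cong) (simp add: pf)
  finally have 1: "prim T f t *\<^sub>R prim T g t =
      prim T (\<lambda>s. f s *\<^sub>R prim T g s) t + prim T (\<lambda>s. (exp (\<mu> * s) - 1) *\<^sub>R g s) t" .
  have 2: "prim T f t *\<^sub>R x = prim T (\<lambda>s. f s *\<^sub>R x) t"
    by (rule prim_bounded_linear[OF bounded_linear_scaleR_left fi, symmetric])
  have "weight \<mu> (\<lambda>t. x + prim T g t) t = x + (prim T (\<lambda>s. f s *\<^sub>R x) t + prim T g t +
      (prim T (\<lambda>s. f s *\<^sub>R prim T g s) t + prim T (\<lambda>s. (exp (\<mu> * s) - 1) *\<^sub>R g s) t))"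
    by (simp only: weight_def e scaleR_add_right 1 2 add_ac)
  also have "prim T (\<lambda>s. f s *\<^sub>R x) t + prim T g t +
      (prim T (\<lambda>s. f s *\<^sub>R prim T g s) t + prim T (\<lambda>s. (exp (\<mu> * s) - 1) *\<^sub>R g s) t) =
      prim T (\<lambda>s. f s *\<^sub>R x + g s + (f s *\<^sub>R prim T g s + (exp (\<mu> * s) - 1) *\<^sub>R g s)) t"
    using i0 i1 i2 g by (simp add: prim_add)
  also have "\<dots> = prim T (\<lambda>s. weight \<mu> g s + \<mu> *\<^sub>R weight \<mu> (\<lambda>t. x + prim T g t) s) t"
    by (rule prim_cong) (simp add: weight_def f_def algebra_simps)
  finally show ?thesis .
qed

text \<open>The solution of \<open>Y' + \<gamma> Y = v\<close> with \<open>Y(0) = 0\<close>: what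
  integration of the velocity becomes under the exponential weight.\<close>

definition damped_prim :: "real \<Rightarrow> real \<Rightarrow> (real \<Rightarrow> 'b::{banach, second_countable_topology}) \<Rightarrow> real \<Rightarrow> 'b" where
  "damped_prim T \<gamma> v = weight (- \<gamma>) (prim T (weight \<gamma> v))"

lemma sq_integrable_damped_prim:
  fixes v :: "real \<Rightarrow> 'b::{banach, second_countable_topology}"
  assumes "sq_integrable (leb T) v"
  shows "sq_integrable (leb T) (damped_prim T \<gamma> v)"
  unfolding damped_prim_def
  by (intro sq_integrable_weight sq_integrable_prim assms
      finite_measure.sq_integrable_imp_integrable[OF finite_measure_interval])

text \<open>Testing \<open>Y' + \<gamma> Y = v\<close> with \<open>Y\<close>: the term with
  \<open>Y'\<close> integrates to half of the squared norm of \<open>Y\<close> at \<open>T\<close>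
  and may be dropped by its sign.\<close>

lemma norm_damped_prim:
  fixes v :: "real \<Rightarrow> 'b::{real_inner, banach, second_countable_topology}"
  assumes T: "0 < T" and \<gamma>: "0 < \<gamma>" and v: "sq_integrable (leb T) v"
  shows "\<gamma> * norm_L2 (leb T) (damped_prim T \<gamma> v) \<le> norm_L2 (leb T) v"
proof -
  let ?M = "leb T"
  interpret finite_measure ?M by (rule finite_measure_interval)
  define Y where "Y = damped_prim T \<gamma> v"
  have Y: "sq_integrable ?M Y" unfolding Y_def by (rule sq_integrable_damped_prim[OF v])
  \<comment> \<open>This is the derivative of \<open>Y\<close>; on \<open>[0,T]\<close> the curve
    \<open>Y\<close> is its primitive.\<close>
  define g where "g s = v s - \<gamma> *\<^sub>R Y s" for s
  have g: "sq_integrable ?M g" unfolding g_def by (intro sq_integrable_diff sq_integrable_scaleR v Y)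
  have gi: "integrable ?M g" by (rule sq_integrable_imp_integrable[OF g])
  have Yg: "Y t = prim T g t" if "t \<in> {0..T}" for t
    using weight_prim[OF sq_integrable_imp_integrable[OF sq_integrable_weight(1)[OF v]] that, of "- \<gamma>" 0 \<gamma>]
    by (simp add: Y_def damped_prim_def g_def[abs_def] weight_weight)
  have "(norm (prim T g T))\<^sup>2 = 2 * prim T (\<lambda>s. inner (g s) (prim T g s)) T"
    using prim_quadratic[OF bounded_bilinear_inner inner_commute gi, of 0 T]
    by (simp add: power2_norm_eq_inner)
  also have "prim T (\<lambda>s. inner (g s) (prim T g s)) T = prim T (\<lambda>s. inner (g s) (Y s)) T"
    by (rule prim_cong) (simp add: Yg)
  also have "\<dots> = (\<integral>s. inner (v s) (Y s) \<partial>?M) - \<gamma> * (norm_L2 ?M Y)\<^sup>2"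
    by (simp add: prim_end g_def inner_diff_left sq_integrable_inner v Y norm_L2_sq power2_norm_eq_inner)
  finally have eq: "(norm (prim T g T))\<^sup>2 = 2 * ((\<integral>s. inner (v s) (Y s) \<partial>?M) - \<gamma> * (norm_L2 ?M Y)\<^sup>2)" .
  have "0 \<le> (\<integral>s. inner (v s) (Y s) \<partial>?M) - \<gamma> * (norm_L2 ?M Y)\<^sup>2"
    using zero_le_power2[of "norm (prim T g T)"] unfolding eq by simp
  then have "\<gamma> * (norm_L2 ?M Y)\<^sup>2 \<le> (\<integral>s. inner (v s) (Y s) \<partial>?M)" by simp
  also have "\<dots> \<le> norm_L2 ?M v * norm_L2 ?M Y" using integral_inner_le[OF v Y] by linarith
  finally have "\<gamma> * norm_L2 ?M Y * norm_L2 ?M Y \<le> norm_L2 ?M v * norm_L2 ?M Y"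
    by (simp add: power2_eq_square)
  then have "\<gamma> * norm_L2 ?M Y \<le> norm_L2 ?M v \<or> norm_L2 ?M Y = 0"
    by (metis mult_right_le_imp_le norm_L2_nonneg order_le_less)
  then show ?thesis by (auto simp: Y_def)
qed


section \<open>The second order problem as a first order problem for the velocity\<close>

locale second_order = real_gelfand j + a: real_form T a Ka + b: real_form T b Kb
  for j :: "'v::{real_inner, banach, second_countable_topology} \<Rightarrow>
      'h::{real_inner, banach, second_countable_topology}"
    and T :: real and a b :: "real \<Rightarrow> 'v \<Rightarrow> 'v \<Rightarrow> real" and Ka Kb :: real +
  fixes \<alpha> \<omega> :: real
  assumes T: "0 < T" and dense: "closure (range j) = UNIV" and \<alpha>: "0 < \<alpha>"
    and coercive: "t \<in> {0<..<T} \<Longrightarrow> \<alpha> * (norm u)\<^sup>2 \<le> b t u u + \<omega> * (norm (j u))\<^sup>2"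
begin

abbreviation "M \<equiv> leb T"

sublocale M: finite_measure M by (rule finite_measure_interval)

text \<open>The first summand lets \<open>\<gamma> J\<close> absorb the term with
  \<open>\<omega>\<close> in the coercivity of \<open>b\<close>, the second keeps the memory term
  below half of the coercivity constant, and the third makes \<open>\<gamma>\<close>
  positive.\<close>

definition \<gamma> :: real where "\<gamma> = \<bar>\<omega>\<bar> + 2 * Ka / \<alpha> + 1"

lemma \<gamma>: "0 < \<gamma>" "\<omega> \<le> \<gamma>" "Ka / \<gamma> \<le> \<alpha> / 2"
proof -
  have nn: "0 \<le> 2 * Ka / \<alpha>" using a.K_nonneg \<alpha> by simp
  then show "0 < \<gamma>" "\<omega> \<le> \<gamma>" by (auto simp: \<gamma>_def)
  have "2 * Ka / \<alpha> \<le> \<gamma>" by (simp add: \<gamma>_def)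
  then show "Ka / \<gamma> \<le> \<alpha> / 2" using \<alpha> \<open>0 < \<gamma>\<close> by (simp add: field_simps)
qed

text \<open>The weight \<open>exp (- \<gamma> t)\<close> on the velocity turns the memory term into a small perturbation.\<close>

definition BB :: "(real \<Rightarrow> 'v) \<Rightarrow> real \<Rightarrow> 'v" where
  "BB v t = form_op b t (v t) + \<gamma> *\<^sub>R J (v t) + form_op a t (damped_prim T \<gamma> v t)"

lemma sq_integrable_J: "sq_integrable M v \<Longrightarrow> sq_integrable M (\<lambda>t. J (v t))"
  by (rule sq_integrable_bounded_linear[OF bounded_linear_J])

lemma sq_integrable_BB: "sq_integrable M v \<Longrightarrow> sq_integrable M (BB v)"
  unfolding BB_def
  by (intro sq_integrable_add sq_integrable_scaleR a.sq_integrable_form_op b.sq_integrable_form_op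
      sq_integrable_damped_prim sq_integrable_J)

lemma sq_integrable_prim_sq:
  fixes v :: "real \<Rightarrow> 'b::{banach, second_countable_topology}"
  shows "sq_integrable M v \<Longrightarrow> sq_integrable M (prim T v)"
  by (intro sq_integrable_prim M.sq_integrable_imp_integrable)

lemma BB_add:
  assumes v: "sq_integrable M v" and w: "sq_integrable M w"
  shows "AE t in M. BB (\<lambda>t. v t + w t) t = BB v t + BB w t"
proof (rule AE_lebesgue_onI)
  fix t assume t: "t \<in> {0<..<T}"
  have "weight \<gamma> (\<lambda>t. v t + w t) = (\<lambda>t. weight \<gamma> v t + weight \<gamma> w t)"
    by (simp add: weight_def scaleR_add_right fun_eq_iff)
  then have "damped_prim T \<gamma> (\<lambda>t. v t + w t) t = damped_prim T \<gamma> v t + damped_prim T \<gamma> w t"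
    using prim_add[OF M.sq_integrable_imp_integrable M.sq_integrable_imp_integrable,
        OF sq_integrable_weight(1)[OF v] sq_integrable_weight(1)[OF w], of \<gamma> \<gamma> t]
    by (simp add: damped_prim_def weight_def[of "- \<gamma>"] scaleR_add_right)
  then show "BB (\<lambda>t. v t + w t) t = BB v t + BB w t"
    using t by (simp add: BB_def a.form_op_add b.form_op_add scaleR_add_right
        linear_add[OF bounded_linear.linear[OF bounded_linear_J]])
qed

lemma BB_scaleR: "AE t in M. BB (\<lambda>t. r *\<^sub>R v t) t = r *\<^sub>R BB v t"
proof (rule AE_lebesgue_onI)
  fix t assume t: "t \<in> {0<..<T}"
  have "weight \<gamma> (\<lambda>t. r *\<^sub>R v t) = (\<lambda>t. r *\<^sub>R weight \<gamma> v t)"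
    by (simp add: weight_def fun_eq_iff mult.commute)
  then have "damped_prim T \<gamma> (\<lambda>t. r *\<^sub>R v t) t = r *\<^sub>R damped_prim T \<gamma> v t"
    by (simp add: damped_prim_def weight_def[of "- \<gamma>"] prim_scaleR mult.commute)
  then show "BB (\<lambda>t. r *\<^sub>R v t) t = r *\<^sub>R BB v t"
    using t by (simp add: BB_def a.form_op_scaleR b.form_op_scaleR scaleR_add_right mult.commute
        linear_scale[OF bounded_linear.linear[OF bounded_linear_J]])
qed

lemma norm_BB:
  obtains C where "\<And>v. sq_integrable M v \<Longrightarrow> norm_L2 M (BB v) \<le> C * norm_L2 M v"
proof -
  obtain KJ where KJ: "\<And>v. norm (J v) \<le> norm v * KJ" "0 \<le> KJ"
    using bounded_linear.nonneg_bounded[OF bounded_linear_J] by blast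
  have "norm_L2 M (BB v) \<le> (Kb + \<gamma> * KJ + Ka / \<gamma>) * norm_L2 M v" if v: "sq_integrable M v" for v
  proof -
    note sq = b.sq_integrable_form_op[OF v] sq_integrable_J[OF v] sq_integrable_damped_prim[OF v, of \<gamma>]
      a.sq_integrable_form_op[OF sq_integrable_damped_prim[OF v, of \<gamma>]]
    have "norm_L2 M (BB v) \<le> norm_L2 M (\<lambda>t. form_op b t (v t) + \<gamma> *\<^sub>R J (v t)) +
        norm_L2 M (\<lambda>t. form_op a t (damped_prim T \<gamma> v t))"
      unfolding BB_def by (intro norm_L2_triangle sq_integrable_add sq_integrable_scaleR sq)
    also have "norm_L2 M (\<lambda>t. form_op b t (v t) + \<gamma> *\<^sub>R J (v t)) \<le>
        norm_L2 M (\<lambda>t. form_op b t (v t)) + norm_L2 M (\<lambda>t. \<gamma> *\<^sub>R J (v t))"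
      by (intro norm_L2_triangle sq_integrable_scaleR sq)
    finally have 1: "norm_L2 M (BB v) \<le> norm_L2 M (\<lambda>t. form_op b t (v t)) +
        \<gamma> * norm_L2 M (\<lambda>t. J (v t)) + norm_L2 M (\<lambda>t. form_op a t (damped_prim T \<gamma> v t))"
      using \<gamma>(1) by (simp add: norm_L2_scaleR)
    have "norm_L2 M (\<lambda>t. J (v t)) \<le> \<bar>KJ\<bar> * norm_L2 M v"
      using KJ by (intro sq_integrable_dominated(2)[OF v])
        (auto simp: mult.commute intro: sq_integrable_measurable[OF sq(3)])
    then have 2: "\<gamma> * norm_L2 M (\<lambda>t. J (v t)) \<le> \<gamma> * (KJ * norm_L2 M v)"
      using KJ(2) \<gamma>(1) by (intro mult_left_mono) auto
    have "norm_L2 M (damped_prim T \<gamma> v) \<le> norm_L2 M v / \<gamma>"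
      using norm_damped_prim[OF T \<gamma>(1) v] \<gamma>(1) by (simp add: field_simps)
    then have "Ka * norm_L2 M (damped_prim T \<gamma> v) \<le> Ka * (norm_L2 M v / \<gamma>)"
      by (rule mult_left_mono) (rule a.K_nonneg)
    with 1 2 sq(2,6) show ?thesis by (simp add: distrib_right mult.assoc)
  qed
  then show ?thesis using that by blast
qed

text \<open>The form \<open>b\<close> together with \<open>\<gamma> J\<close> contributes
  \<open>\<alpha>\<close>. The damped primitive has at most \<open>1 / \<gamma>\<close> times the
  norm of \<open>v\<close>, so the memory term costs at most
  \<open>Ka / \<gamma> \<le> \<alpha> / 2\<close>.\<close>

lemma BB_coercive:
  assumes v: "sq_integrable M v"
  shows "\<alpha> / 2 * (norm_L2 M v)\<^sup>2 \<le> (\<integral>t. inner (BB v t) (v t) \<partial>M)"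
proof -
  define Y where "Y = damped_prim T \<gamma> v"
  have Y: "sq_integrable M Y" unfolding Y_def by (rule sq_integrable_damped_prim[OF v])
  have aY: "sq_integrable M (\<lambda>t. form_op a t (Y t))" by (rule a.sq_integrable_form_op[OF Y])
  have i: "integrable M (\<lambda>t. \<alpha> * (norm (v t))\<^sup>2)" "integrable M (\<lambda>t. inner (form_op a t (Y t)) (v t))"
    using sq_integrable_norm_sq[OF v] sq_integrable_inner[OF aY v] by simp_all
  have "\<bar>\<integral>t. inner (form_op a t (Y t)) (v t) \<partial>M\<bar> \<le> norm_L2 M (\<lambda>t. form_op a t (Y t)) * norm_L2 M v"
    by (rule integral_inner_le[OF aY v])
  also have "\<dots> \<le> (Ka * norm_L2 M Y) * norm_L2 M v"
    by (intro mult_right_mono a.sq_integrable_form_op Y norm_L2_nonneg)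
  also have "\<dots> \<le> (Ka * (norm_L2 M v / \<gamma>)) * norm_L2 M v"
    using norm_damped_prim[OF T \<gamma>(1) v] \<gamma>(1) a.K_nonneg
    by (intro mult_right_mono mult_left_mono norm_L2_nonneg) (simp_all add: field_simps Y_def)
  also have "\<dots> = Ka / \<gamma> * (norm_L2 M v)\<^sup>2" by (simp add: power2_eq_square)
  also have "\<dots> \<le> \<alpha> / 2 * (norm_L2 M v)\<^sup>2" by (intro mult_right_mono \<gamma>) simp
  finally have small: "- (\<integral>t. inner (form_op a t (Y t)) (v t) \<partial>M) \<le> \<alpha> / 2 * (norm_L2 M v)\<^sup>2"
    by linarith
  have "\<alpha> * (norm_L2 M v)\<^sup>2 + (\<integral>t. inner (form_op a t (Y t)) (v t) \<partial>M) =
      (\<integral>t. \<alpha> * (norm (v t))\<^sup>2 + inner (form_op a t (Y t)) (v t) \<partial>M)"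
    using i by (simp add: norm_L2_sq)
  also have "\<dots> \<le> (\<integral>t. inner (BB v t) (v t) \<partial>M)"
  proof (rule integral_mono_AE)
    show "integrable M (\<lambda>t. \<alpha> * (norm (v t))\<^sup>2 + inner (form_op a t (Y t)) (v t))" using i by simp
    show "integrable M (\<lambda>t. inner (BB v t) (v t))" by (intro sq_integrable_inner sq_integrable_BB v)
    show "AE t in M. \<alpha> * (norm (v t))\<^sup>2 + inner (form_op a t (Y t)) (v t) \<le> inner (BB v t) (v t)"
    proof (rule AE_lebesgue_onI)
      fix t assume t: "t \<in> {0<..<T}"
      have "\<omega> * (norm (j (v t)))\<^sup>2 \<le> \<gamma> * (norm (j (v t)))\<^sup>2" by (intro mult_right_mono \<gamma>) simp
      then show "\<alpha> * (norm (v t))\<^sup>2 + inner (form_op a t (Y t)) (v t) \<le> inner (BB v t) (v t)"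
        using coercive[OF t, of "v t"]
        by (simp add: BB_def inner_add_left b.inner_form_op[OF t] inner_J Y_def power2_norm_eq_inner)
    qed
  qed
  finally show ?thesis using small by linarith
qed

text \<open>\<open>velocity_eq u0 x F v\<close> is the equation for \<open>v = u'\<close>, integrated once in time; the dual of \<open>V\<close>
  is identified with \<open>V\<close> by the Riesz isomorphism, and \<open>x\<close> is the representative of \<open>u'(0)\<close>.\<close>

definition residual :: "'v \<Rightarrow> (real \<Rightarrow> 'v) \<Rightarrow> (real \<Rightarrow> 'v) \<Rightarrow> real \<Rightarrow> 'v" where
  "residual u0 F v s = F s - form_op b s (v s) - form_op a s (u0 + prim T v s)"

definition velocity_eq :: "'v \<Rightarrow> 'v \<Rightarrow> (real \<Rightarrow> 'v) \<Rightarrow> (real \<Rightarrow> 'v) \<Rightarrow> bool" where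
  "velocity_eq u0 x F v \<longleftrightarrow> (AE t in M. J (v t) = x + prim T (residual u0 F v) t)"

lemma sq_integrable_residual:
  assumes "sq_integrable M F" "sq_integrable M v"
  shows "sq_integrable M (residual u0 F v)"
  unfolding residual_def
  by (intro sq_integrable_diff a.sq_integrable_form_op b.sq_integrable_form_op sq_integrable_add
      M.sq_integrable_const sq_integrable_prim_sq assms)

text \<open>The product rule produces the curve \<open>x + prim T G\<close> under the integral,
  where it may be replaced by \<open>J v\<close>, equal to it almost everywhere. Both signs of
  \<open>\<mu>\<close> occur below, one for weighting and one for undoing it.\<close>

lemma weight_eq:
  assumes v: "sq_integrable M v" and G: "sq_integrable M G"
    and eq: "AE t in M. J (v t) = x + prim T G t"
  shows "AE t in M. J (weight \<mu> v t) = x + prim T (\<lambda>s. weight \<mu> G s + \<mu> *\<^sub>R J (weight \<mu> v s)) t"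
proof -
  note lin = bounded_linear.linear[OF bounded_linear_J]
  note Gi = M.sq_integrable_imp_integrable[OF G]
  have W: "sq_integrable M (\<lambda>t. x + prim T G t)"
    by (intro sq_integrable_add M.sq_integrable_const sq_integrable_prim_sq G)
  have ae: "AE s in M. weight \<mu> G s + \<mu> *\<^sub>R weight \<mu> (\<lambda>t. x + prim T G t) s = weight \<mu> G s + \<mu> *\<^sub>R J (weight \<mu> v s)"
    using eq by eventually_elim (simp add: weight_def linear_scale[OF lin])
  have p: "prim T (\<lambda>s. weight \<mu> G s + \<mu> *\<^sub>R weight \<mu> (\<lambda>t. x + prim T G t) s) t =
      prim T (\<lambda>s. weight \<mu> G s + \<mu> *\<^sub>R J (weight \<mu> v s)) t" for t
    by (intro prim_cong_AE[OF ae] M.sq_integrable_imp_integrable sq_integrable_add sq_integrable_scaleR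
        sq_integrable_weight sq_integrable_J W G v)
  have "AE t in M. t \<in> {0..T}" by (rule AE_lebesgue_onI) auto
  with eq show ?thesis
  proof eventually_elim
    case (elim t)
    have "J (weight \<mu> v t) = weight \<mu> (\<lambda>t. x + prim T G t) t"
      using elim(1) by (simp add: weight_def linear_scale[OF lin])
    also have "\<dots> = x + prim T (\<lambda>s. weight \<mu> G s + \<mu> *\<^sub>R J (weight \<mu> v s)) t"
      unfolding weight_prim[OF Gi elim(2)] p ..
    finally show ?case .
  qed
qed

text \<open>The displacement in the memory term starts at \<open>u0\<close>; this known part is
  moved to the right-hand side, which leaves \<open>BB\<close> linear in the velocity.\<close>

definition weighted_rhs :: "'v \<Rightarrow> (real \<Rightarrow> 'v) \<Rightarrow> real \<Rightarrow> 'v" where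
  "weighted_rhs u0 F = weight (- \<gamma>) (\<lambda>s. F s - form_op a s u0)"

lemma sq_integrable_weighted_rhs:
  assumes "sq_integrable M F" shows "sq_integrable M (weighted_rhs u0 F)"
  unfolding weighted_rhs_def
  by (intro sq_integrable_weight sq_integrable_diff assms a.sq_integrable_form_op M.sq_integrable_const)

lemma weighted_residual:
  assumes s: "s \<in> {0<..<T}"
  shows "weight (- \<gamma>) (residual u0 F v) s - \<gamma> *\<^sub>R J (weight (- \<gamma>) v s) =
    weighted_rhs u0 F s - BB (weight (- \<gamma>) v) s"
  by (simp add: weighted_rhs_def BB_def weight_weight damped_prim_def)
    (simp add: weight_def residual_def a.form_op_add[OF s] a.form_op_scaleR[OF s] b.form_op_scaleR[OF s] algebra_simps)

lemma velocity_eq_weighted: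
  assumes v: "sq_integrable M v" and F: "sq_integrable M F"
  shows "velocity_eq u0 x F v \<longleftrightarrow> (AE t in M. J (weight (- \<gamma>) v t) =
    x + prim T (\<lambda>s. weighted_rhs u0 F s - BB (weight (- \<gamma>) v) s) t)"
proof
  assume "velocity_eq u0 x F v"
  then have "AE t in M. J (weight (- \<gamma>) v t) =
      x + prim T (\<lambda>s. weight (- \<gamma>) (residual u0 F v) s + (- \<gamma>) *\<^sub>R J (weight (- \<gamma>) v s)) t"
    unfolding velocity_eq_def by (intro weight_eq v sq_integrable_residual F)
  moreover have "prim T (\<lambda>s. weight (- \<gamma>) (residual u0 F v) s + (- \<gamma>) *\<^sub>R J (weight (- \<gamma>) v s)) t =
      prim T (\<lambda>s. weighted_rhs u0 F s - BB (weight (- \<gamma>) v) s) t" for t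
    by (rule prim_cong) (simp add: weighted_residual[symmetric])
  ultimately show "AE t in M. J (weight (- \<gamma>) v t) =
      x + prim T (\<lambda>s. weighted_rhs u0 F s - BB (weight (- \<gamma>) v) s) t" by simp
next
  let ?w = "weight (- \<gamma>) v" and ?G = "\<lambda>s. weighted_rhs u0 F s - BB (weight (- \<gamma>) v) s"
  assume eq: "AE t in M. J (?w t) = x + prim T ?G t"
  have "AE t in M. J (weight \<gamma> ?w t) = x + prim T (\<lambda>s. weight \<gamma> ?G s + \<gamma> *\<^sub>R J (weight \<gamma> ?w s)) t"
    by (intro weight_eq eq sq_integrable_weight sq_integrable_diff v sq_integrable_weighted_rhs F sq_integrable_BB)
  moreover have "prim T (\<lambda>s. weight \<gamma> ?G s + \<gamma> *\<^sub>R J (weight \<gamma> ?w s)) t = prim T (residual u0 F v) t" for t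
  proof (rule prim_cong)
    fix s assume s: "s \<in> {0<..<T}"
    have "weight \<gamma> ?G s = exp (\<gamma> * s) *\<^sub>R (weight (- \<gamma>) (residual u0 F v) s - \<gamma> *\<^sub>R J (?w s))"
      unfolding weighted_residual[OF s] by (simp add: weight_def)
    also have "\<dots> = residual u0 F v s - \<gamma> *\<^sub>R J (v s)"
      by (simp add: weight_def linear_scale[OF bounded_linear.linear[OF bounded_linear_J]]
          scaleR_diff_right exp_add[symmetric])
    finally show "weight \<gamma> ?G s + \<gamma> *\<^sub>R J (weight \<gamma> ?w s) = residual u0 F v s"
      by (simp add: weight_weight)
  qed
  ultimately show "velocity_eq u0 x F v"
    by (simp add: velocity_eq_def weight_weight)
qed

theorem velocity_existence:
  assumes F: "sq_integrable M F"
  shows "\<exists>v. sq_integrable M v \<and> velocity_eq u0 (hilbert_adj j u1) F v"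
proof -
  obtain C where C: "\<And>v. sq_integrable M v \<Longrightarrow> norm_L2 M (BB v) \<le> C * norm_L2 M v"
    by (rule norm_BB) (rule that)
  have "\<exists>w. sq_integrable M w \<and>
    (AE t in M. J (w t) = hilbert_adj j u1 + prim T (\<lambda>s. weighted_rhs u0 F s - BB w s) t)"
    by (rule coercive_existence[OF T, where BB = BB and C = C and \<alpha> = "\<alpha> / 2"])
      (use \<alpha> in \<open>simp_all add: sq_integrable_BB BB_add BB_scaleR C BB_coercive[simplified]
        sq_integrable_weighted_rhs F\<close>)
  then obtain w where w: "sq_integrable M w"
    "AE t in M. J (w t) = hilbert_adj j u1 + prim T (\<lambda>s. weighted_rhs u0 F s - BB w s) t"
    by (elim exE conjE)
  have v: "sq_integrable M (weight \<gamma> w)" by (rule sq_integrable_weight[OF w(1)])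
  have "velocity_eq u0 (hilbert_adj j u1) F (weight \<gamma> w)"
    unfolding velocity_eq_weighted[OF v F] weight_weight by (rule w(2))
  with v show ?thesis by blast
qed

theorem velocity_estimate:
  obtains C where "0 < C" "\<And>u0 u1 F v. sq_integrable M F \<Longrightarrow> sq_integrable M v \<Longrightarrow>
    velocity_eq u0 (hilbert_adj j u1) F v \<Longrightarrow>
    norm_L2 M v \<le> C * (norm u0 + norm u1 + norm_L2 M F)"
proof -
  \<comment> \<open>Bounds both exponential weights on \<open>(0,T)\<close>: one factor
    \<open>E\<close> is paid for weighting the data, a second for returning from \<open>w\<close> to
    \<open>v\<close>. The number \<open>\<alpha> / 2\<close> below is the coercivity constant of
    \<open>BB\<close>.\<close>
  define E where "E = exp (\<gamma> * T)"
  have E: "0 < E" by (simp add: E_def)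
  define C1 where "C1 = E * (1 + Ka * sqrt T) / (\<alpha> / 2)"
  define C where "C = E * (C1 + 1 / sqrt (2 * (\<alpha> / 2)))"
  have p: "0 < 1 + Ka * sqrt T" using a.K_nonneg T by (simp add: add_pos_nonneg)
  have "0 < C1" unfolding C1_def using E \<alpha> p by simp
  then have C0: "0 < C" unfolding C_def using E \<alpha> by (simp add: add_pos_pos)
  have "norm_L2 M v \<le> C * (norm u0 + norm u1 + norm_L2 M F)"
    if F: "sq_integrable M F" and v: "sq_integrable M v" and eq: "velocity_eq u0 (hilbert_adj j u1) F v"
    for u0 u1 F v
  proof -
    define w where "w = weight (- \<gamma>) v"
    have w: "sq_integrable M w" unfolding w_def by (rule sq_integrable_weight[OF v])
    have v_eq: "v = weight \<gamma> w" by (simp add: w_def weight_weight)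
    have "norm_L2 M w \<le> norm_L2 M (weighted_rhs u0 F) / (\<alpha> / 2) + norm u1 / sqrt (2 * (\<alpha> / 2))"
      using eq[unfolded velocity_eq_weighted[OF v F], folded w_def] \<alpha>
      by (intro energy_estimate[OF T dense w sq_integrable_weighted_rhs[OF F] sq_integrable_BB[OF w]] BB_coercive w)
        auto
    also have "norm_L2 M (weighted_rhs u0 F) \<le> E * (norm_L2 M F + Ka * sqrt T * norm u0)"
    proof -
      have c: "sq_integrable M (\<lambda>s. form_op a s u0)"
        "norm_L2 M (\<lambda>s. form_op a s u0) \<le> Ka * norm_L2 M (\<lambda>s. u0)"
        by (rule a.sq_integrable_form_op[OF M.sq_integrable_const])+
      have "norm_L2 M (\<lambda>s. u0) = sqrt T * norm u0"
        using T by (simp add: norm_L2_def measure_restrict_space real_sqrt_mult)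
      then have "norm_L2 M (\<lambda>s. F s - form_op a s u0) \<le> norm_L2 M F + Ka * sqrt T * norm u0"
        using norm_L2_diff[OF F c(1)] c(2) by simp
      then have "E * norm_L2 M (\<lambda>s. F s - form_op a s u0) \<le> E * (norm_L2 M F + Ka * sqrt T * norm u0)"
        using E by (intro mult_left_mono) auto
      moreover have "norm_L2 M (weighted_rhs u0 F) \<le> E * norm_L2 M (\<lambda>s. F s - form_op a s u0)"
        using sq_integrable_weight(2)[OF sq_integrable_diff[OF F c(1)], of "- \<gamma>"] \<gamma>(1)
        by (simp add: weighted_rhs_def E_def)
      ultimately show ?thesis by linarith
    qed
    also have "E * (norm_L2 M F + Ka * sqrt T * norm u0) / (\<alpha> / 2) \<le> C1 * (norm u0 + norm u1 + norm_L2 M F)"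
    proof -
      have "norm_L2 M F + Ka * sqrt T * norm u0 \<le> (1 + Ka * sqrt T) * (norm u0 + norm u1 + norm_L2 M F)"
        using a.K_nonneg T norm_L2_nonneg[of M F] by (simp add: distrib_right distrib_left)
      then have "E / (\<alpha> / 2) * (norm_L2 M F + Ka * sqrt T * norm u0) \<le>
          E / (\<alpha> / 2) * ((1 + Ka * sqrt T) * (norm u0 + norm u1 + norm_L2 M F))"
        using E \<alpha> by (intro mult_left_mono) auto
      then show ?thesis by (simp only: C1_def times_divide_eq_left times_divide_eq_right mult.assoc)
    qed
    also have "norm u1 / sqrt (2 * (\<alpha> / 2)) \<le> 1 / sqrt (2 * (\<alpha> / 2)) * (norm u0 + norm u1 + norm_L2 M F)"
    proof -
      have "norm u1 \<le> norm u0 + norm u1 + norm_L2 M F" by simp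
      then have "1 / sqrt (2 * (\<alpha> / 2)) * norm u1 \<le> 1 / sqrt (2 * (\<alpha> / 2)) * (norm u0 + norm u1 + norm_L2 M F)"
        using \<alpha> by (intro mult_left_mono) auto
      then show ?thesis by simp
    qed
    finally have wle: "norm_L2 M w \<le> (C1 + 1 / sqrt (2 * (\<alpha> / 2))) * (norm u0 + norm u1 + norm_L2 M F)"
      using \<alpha> by (simp add: distrib_right divide_right_mono)
    have "norm_L2 M v \<le> E * norm_L2 M w"
      using sq_integrable_weight(2)[OF w, of \<gamma>] \<gamma>(1) by (simp add: v_eq E_def)
    also have "\<dots> \<le> E * ((C1 + 1 / sqrt (2 * (\<alpha> / 2))) * (norm u0 + norm u1 + norm_L2 M F))"
      using wle E by (intro mult_left_mono) auto
    finally show ?thesis by (simp add: C_def mult.assoc)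
  qed
  with C0 show ?thesis using that by blast
qed

text \<open>The difference of two solutions solves the problem with zero data, because
  \<open>u0\<close>, \<open>x\<close> and the force cancel; the estimate then gives norm
  zero.\<close>

lemma velocity_unique:
  assumes F: "sq_integrable M F" and v: "sq_integrable M v" "sq_integrable M w"
    and eq: "velocity_eq u0 x F v" "velocity_eq u0 x F w"
  shows "AE t in M. v t = w t"
proof -
  obtain C where "0 < C" and C: "\<And>u0 u1 F v. sq_integrable M F \<Longrightarrow> sq_integrable M v \<Longrightarrow>
    velocity_eq u0 (hilbert_adj j u1) F v \<Longrightarrow> norm_L2 M v \<le> C * (norm u0 + norm u1 + norm_L2 M F)"
    by (rule velocity_estimate) (rule that)
  define d where "d t = v t - w t" for t
  have d: "sq_integrable M d" unfolding d_def by (intro sq_integrable_diff v)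
  note lin = bounded_linear.linear[OF bounded_linear_J]
  note i = M.sq_integrable_imp_integrable
  have p: "prim T (residual 0 (\<lambda>_. 0) d) t = prim T (residual u0 F v) t - prim T (residual u0 F w) t" for t
  proof -
    have "prim T (residual 0 (\<lambda>_. 0) d) t = prim T (\<lambda>s. residual u0 F v s - residual u0 F w s) t"
    proof (rule prim_cong)
      fix s assume s: "s \<in> {0<..<T}"
      have "prim T d s = prim T v s - prim T w s"
        unfolding d_def by (intro prim_diff i v)
      then have "0 + prim T d s = (u0 + prim T v s) - (u0 + prim T w s)" by simp
      then show "residual 0 (\<lambda>_. 0) d s = residual u0 F v s - residual u0 F w s"
        unfolding residual_def d_def[of s]
        by (simp only: a.form_op_diff[OF s] b.form_op_diff[OF s]) simp
    qed
    also have "\<dots> = prim T (residual u0 F v) t - prim T (residual u0 F w) t"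
      by (intro prim_diff i sq_integrable_residual F v)
    finally show ?thesis .
  qed
  have "velocity_eq 0 (hilbert_adj j 0) (\<lambda>_. 0) d"
    using eq unfolding velocity_eq_def
  proof eventually_elim
    case (elim t)
    have "hilbert_adj j 0 = 0"
      by (rule linear_0[OF bounded_linear.linear[OF bounded_linear_hilbert_adj[OF bounded_linear_j]]])
    then show ?case
      using elim by (simp add: p) (simp add: d_def linear_diff[OF lin])
  qed
  from C[OF sq_integrable_zero d this] have "norm_L2 M d = 0"
    by (simp add: norm_L2_def order_antisym)
  from norm_L2_eq_0[OF d this] show ?thesis by eventually_elim (simp add: d_def)
qed

end


section \<open>The Riesz isomorphism of the antidual\<close>

text \<open>Representing the real part loses nothing: antilinearity recovers the imaginary part by
  multiplying the argument by the imaginary unit.\<close>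

definition riesz_iso :: "'v::complex_hilbert antidual \<Rightarrow> 'v" where
  "riesz_iso F = riesz_rep (\<lambda>v. Re (pairing F v))"

definition riesz_inv :: "'v::complex_hilbert \<Rightarrow> 'v antidual" where
  "riesz_inv w = antidual_of (cinner w)"

lemma inner_riesz_iso: "inner (riesz_iso F) v = Re (pairing F v)"
  unfolding riesz_iso_def
  by (intro inner_riesz_rep bounded_linear_compose[OF bounded_linear_Re bounded_linear_pairing_right])

lemma pairing_riesz_inv: "pairing (riesz_inv w) v = cinner w v"
  unfolding riesz_inv_def
  by (rule pairing_antidual_of) (auto simp: antilinear_def cinner_add_right cinner_scaleC_right intro: norm_cinner_le)

lemma riesz_iso_inv: "riesz_iso (riesz_inv w) = w"
  by (rule inner_ext) (simp add: inner_riesz_iso pairing_riesz_inv inner_eq_Re_cinner[symmetric])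

lemma riesz_inv_iso: "riesz_inv (riesz_iso F) = F"
proof -
  obtain w where "\<And>v. pairing F v = cinner w v" using riesz_antidual by blast
  then have "F = riesz_inv w" by (intro antidual_eqI) (simp add: pairing_riesz_inv)
  then show ?thesis by (simp add: riesz_iso_inv)
qed

lemma riesz_iso_inj: "riesz_iso F = riesz_iso G \<Longrightarrow> F = G"
  by (metis riesz_inv_iso)

lemma norm_riesz_iso: "norm (riesz_iso F) = norm F"
proof (rule antisym)
  show "norm (riesz_iso F) \<le> norm F"
  proof (cases "riesz_iso F = 0")
    case False
    have "norm (riesz_iso F) * norm (riesz_iso F) = Re (pairing F (riesz_iso F))"
      using inner_riesz_iso[of F "riesz_iso F"] by (simp add: power2_norm_eq_inner[symmetric] flip: power2_eq_square)
    also have "\<dots> \<le> cmod (pairing F (riesz_iso F))" by (rule complex_Re_le_cmod)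
    also have "\<dots> \<le> norm F * norm (riesz_iso F)" by (rule norm_pairing_le)
    finally show ?thesis using False by simp
  qed simp
  have "cmod (pairing F v) \<le> norm (riesz_iso F) * norm v" for v
    using norm_cinner_le[of "riesz_iso F" v] pairing_riesz_inv[of "riesz_iso F" v] by (simp add: riesz_inv_iso)
  then show "norm F \<le> norm (riesz_iso F)" by (intro antidual_norm_bound) auto
qed

lemma bounded_linear_riesz_iso: "bounded_linear riesz_iso"
proof (rule bounded_linear_intro)
  show "riesz_iso (F + G) = riesz_iso F + riesz_iso G" for F G :: "'a antidual"
    by (rule inner_ext) (simp add: inner_riesz_iso inner_add_left pairing_add_left)
  show "riesz_iso (r *\<^sub>R F) = r *\<^sub>R riesz_iso F" for r and F :: "'a antidual"
    by (rule inner_ext) (simp add: inner_riesz_iso pairing_scaleR_left)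
  show "norm (riesz_iso F) \<le> norm F * 1" for F :: "'a antidual" by (simp add: norm_riesz_iso)
qed

lemma bounded_linear_riesz_inv: "bounded_linear (riesz_inv :: 'v::complex_hilbert \<Rightarrow> _)"
proof (rule bounded_linear_intro)
  note lin = bounded_linear.linear[OF bounded_linear_riesz_iso]
  show "riesz_inv (x + y) = riesz_inv x + riesz_inv y" for x y :: 'v
    by (rule riesz_iso_inj) (simp add: riesz_iso_inv linear_add[OF lin])
  show "riesz_inv (r *\<^sub>R x) = r *\<^sub>R riesz_inv x" for r and x :: 'v
    by (rule riesz_iso_inj) (simp add: riesz_iso_inv linear_scale[OF lin])
  show "norm (riesz_inv x) \<le> norm x * 1" for x :: 'v
    using norm_riesz_iso[of "riesz_inv x"] by (simp add: riesz_iso_inv)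
qed


section \<open>Weak derivatives and initial values\<close>

lemma L2_integrable: "L2 T u \<Longrightarrow> integrable (leb T) u"
  unfolding L2_iff by (rule finite_measure.sq_integrable_imp_integrable[OF finite_measure_interval])

lemma H1_wderiv:
  assumes "H1 T u" shows "L2 T (wderiv T u)" "weak_deriv T u (wderiv T u)"
proof -
  have "\<exists>u'. L2 T u' \<and> weak_deriv T u u'" using assms by (simp add: H1_def)
  from someI_ex[OF this] show "L2 T (wderiv T u)" "weak_deriv T u (wderiv T u)"
    by (simp_all add: wderiv_def)
qed

lemma wderiv_eqI:
  assumes "L2 T u" "L2 T g" "weak_deriv T u g"
  shows "H1 T u" "AE t in leb T. wderiv T u t = g t"
proof -
  show "H1 T u" using assms by (auto simp: H1_def)
  from H1_wderiv[OF this] show "AE t in leb T. wderiv T u t = g t"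
    using assms by (intro weak_deriv_unique L2_integrable) auto
qed

lemma L2_bounded_linear: "bounded_linear L \<Longrightarrow> L2 T u \<Longrightarrow> L2 T (\<lambda>t. L (u t))"
  unfolding L2_iff by (rule sq_integrable_bounded_linear)

text \<open>Different values at \<open>0\<close> would separate the functions on a whole interval to
  the right of \<open>0\<close>, which has positive measure.\<close>

lemma continuous_AE_eq_at_0:
  fixes f g :: "real \<Rightarrow> 'a::t2_space"
  assumes T: "0 < T" and f: "continuous_on {0..T} f" and g: "continuous_on {0..T} g"
    and ae: "AE t in leb T. f t = g t"
  shows "f 0 = g 0"
proof (rule ccontr)
  assume ne: "f 0 \<noteq> g 0"
  have lim: "(f \<longlongrightarrow> f 0) (at_right 0)" "(g \<longlongrightarrow> g 0) (at_right 0)"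
    using f g T by (auto simp: continuous_on_Icc_at_rightD)
  have "\<forall>\<^sub>F t in at_right 0. f t \<noteq> g t"
  proof -
    obtain U V where UV: "open U" "open V" "f 0 \<in> U" "g 0 \<in> V" "U \<inter> V = {}"
      using hausdorff[OF ne] by blast
    have "\<forall>\<^sub>F t in at_right 0. f t \<in> U" "\<forall>\<^sub>F t in at_right 0. g t \<in> V"
      using topological_tendstoD[OF lim(1)] topological_tendstoD[OF lim(2)] UV by auto
    then show ?thesis by eventually_elim (use UV in auto)
  qed
  then obtain d where d: "0 < d" "\<And>t. 0 < t \<Longrightarrow> t < d \<Longrightarrow> f t \<noteq> g t"
    by (auto simp: eventually_at_right_field)
  have "AE t in lebesgue. t \<in> {0<..<T} \<longrightarrow> f t = g t"
    using ae by (subst (asm) AE_restrict_space_iff) auto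
  then have "AE t in lebesgue_on {0<..<min d T}. f t = g t"
    by (subst AE_restrict_space_iff) (auto elim: eventually_mono)
  then obtain t where "t \<in> {0<..<min d T}" "f t = g t"
    using AE_interval_ex[of "min d T"] d T by auto
  then show False using d by auto
qed

text \<open>The definition speaks of some continuous representative; this allows any other one to be
  used, in particular a primitive.\<close>

lemma has_initial_value_unique:
  fixes u :: "real \<Rightarrow> 'a::real_normed_vector"
  assumes T: "0 < T" and i: "has_initial_value T u x" and g: "continuous_on {0..T} g"
    and ae: "AE t in leb T. u t = g t"
  shows "g 0 = x"
proof -
  obtain h where h: "continuous_on {0..T} h" "AE t in leb T. u t = h t" "h 0 = x"
    using i by (auto simp: has_initial_value_def)
  have "AE t in leb T. g t = h t" using ae h(2) by eventually_elim simp
  from continuous_AE_eq_at_0[OF T g h(1) this] h(3) show ?thesis by simp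
qed


section \<open>The Cauchy problem\<close>

text \<open>The real theory is instantiated with the real parts of the forms, while the complex
  forms stay available for the operators into the antidual.\<close>

locale cauchy_problem =
  second_order j T "\<lambda>t u w. Re (a t u w)" "\<lambda>t u w. Re (b t u w)" Ka Kb \<alpha> \<omega>
  for j :: "'v::{complex_hilbert, second_countable_topology} \<Rightarrow>
      'h::{complex_hilbert, second_countable_topology}"
    and T :: real and a b :: "real \<Rightarrow> 'v \<Rightarrow> 'v \<Rightarrow> complex" and Ka Kb \<alpha> \<omega> :: real +
  assumes embedding: "dense_embedding j"
    and form_a: "bounded_nonautonomous_form T a" and form_b: "bounded_nonautonomous_form T b"
begin

abbreviation "opa t \<equiv> form_op (\<lambda>t u w. Re (a t u w)) t"
abbreviation "opb t \<equiv> form_op (\<lambda>t u w. Re (b t u w)) t"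
abbreviation "A \<equiv> assoc_operator a"
abbreviation "B \<equiv> assoc_operator b"

lemma riesz_A: "t \<in> {0<..<T} \<Longrightarrow> riesz_iso (A t u) = opa t u"
  by (rule inner_ext) (simp add: inner_riesz_iso a.inner_form_op pairing_assoc_operator[OF form_a])

lemma riesz_B: "t \<in> {0<..<T} \<Longrightarrow> riesz_iso (B t u) = opb t u"
  by (rule inner_ext) (simp add: inner_riesz_iso b.inner_form_op pairing_assoc_operator[OF form_b])

text \<open>Both sides pair with a vector of \<open>V\<close> through the inner product of the
  images under \<open>j\<close>. Weak derivatives in the antidual thereby become statements about
  \<open>J\<close>.\<close>

lemma in_dual_eq: "in_dual j u t = riesz_inv (J (u t))"
  by (rule riesz_iso_inj, rule inner_ext)
    (simp add: riesz_iso_inv inner_riesz_iso in_dual_def pairing_dual_embedding[OF embedding] inner_J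
      inner_eq_Re_cinner[symmetric])

lemma riesz_in_dual: "riesz_iso (in_dual j u t) = J (u t)"
  by (simp add: in_dual_eq riesz_iso_inv)

lemma bounded_linear_riesz_inv_J: "bounded_linear (\<lambda>v. riesz_inv (J v))"
  by (rule bounded_linear_compose[OF bounded_linear_riesz_inv bounded_linear_J])

lemma L2_in_dual: "L2 T u \<Longrightarrow> L2 T (in_dual j u)"
  using L2_bounded_linear[OF bounded_linear_riesz_inv_J] by (simp add: in_dual_eq[abs_def])

lemma wderiv_in_dual:
  assumes u: "L2 T u" and v: "L2 T v" and w: "weak_deriv T u v"
  shows "H1 T (in_dual j u)" "AE t in M. wderiv T (in_dual j u) t = in_dual j v t"
proof -
  have "weak_deriv T (in_dual j u) (in_dual j v)"
    using weak_deriv_bounded_linear[OF bounded_linear_riesz_inv_J w L2_integrable[OF u] L2_integrable[OF v]]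
    by (simp add: in_dual_eq[abs_def])
  from wderiv_eqI[OF L2_in_dual[OF u] L2_in_dual[OF v] this]
  show "H1 T (in_dual j u)" "AE t in M. wderiv T (in_dual j u) t = in_dual j v t" .
qed

abbreviation "second_deriv u \<equiv> wderiv T (wderiv T (in_dual j u))"

text \<open>Weak derivatives turn into primitives up to unknown constants. The initial conditions
  determine the two constants, the second one through the continuous \<open>H\<close>-valued
  representative supplied by the continuity theorem.\<close>

lemma solution_velocity:
  assumes f: "L2 T f" and MR: "MR T j u" and sol: "solves_cauchy_problem T j A B f u0 u1 u"
  shows "sq_integrable M (wderiv T u)"
    and "AE t in M. u t = u0 + prim T (wderiv T u) t"
    and "AE t in M. riesz_iso (second_deriv u t) = residual u0 (\<lambda>t. riesz_iso (f t)) (wderiv T u) t"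
    and "velocity_eq u0 (hilbert_adj j u1) (\<lambda>t. riesz_iso (f t)) (wderiv T u)"
proof -
  define v where "v = wderiv T u"
  have H1: "H1 T u" and H2: "H2 T (in_dual j u)" using MR by (auto simp: MR_def)
  note wv = H1_wderiv[OF H1, folded v_def]
  have u: "L2 T u" using H1 by (simp add: H1_def)
  show "sq_integrable M (wderiv T u)" using wv(1) by (simp add: L2_iff v_def)
  note iv = L2_integrable[OF wv(1)]
  have v: "sq_integrable M v" using wv(1) by (simp add: L2_iff)
  have F: "sq_integrable M (\<lambda>t. riesz_iso (f t))"
    using L2_bounded_linear[OF bounded_linear_riesz_iso f] by (simp add: L2_iff)
  obtain x where x: "AE t in M. u t = x + prim T v t"
    using weak_deriv_imp_prim[OF T L2_integrable[OF u] iv wv(2)] by blast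
  have "x = u0"
    using has_initial_value_unique[OF T, of u u0 "\<lambda>t. x + prim T v t"] sol x
    by (simp add: solves_cauchy_problem_def prim_0 continuous_on_prim[OF iv] continuous_on_add)
  with x show ux: "AE t in M. u t = u0 + prim T (wderiv T u) t" by (simp add: v_def)
  define g where "g t = riesz_iso (second_deriv u t)" for t
  have H1': "H1 T (wderiv T (in_dual j u))" using H2 by (simp add: H2_def)
  note ww = H1_wderiv[OF H1']
  have U': "L2 T (wderiv T (in_dual j u))" using H1' by (simp add: H1_def)
  have g: "sq_integrable M g"
    using L2_bounded_linear[OF bounded_linear_riesz_iso ww(1)] by (simp add: L2_iff g_def[abs_def])
  obtain c where c: "AE t in M. wderiv T (in_dual j u) t = c + prim T (second_deriv u) t"
    using weak_deriv_imp_prim[OF T L2_integrable[OF U'] L2_integrable[OF ww(1)] ww(2)] by blast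
  have pg: "riesz_iso (prim T (second_deriv u) t) = prim T g t" for t
    unfolding g_def by (rule prim_bounded_linear[OF bounded_linear_riesz_iso L2_integrable[OF ww(1)], symmetric])
  have Jv: "AE t in M. J (v t) = riesz_iso c + prim T g t"
    using c wderiv_in_dual(2)[OF u wv]
  proof eventually_elim
    case (elim t)
    have "J (v t) = riesz_iso (in_dual j v t)" by (simp add: riesz_in_dual)
    also have "\<dots> = riesz_iso (c + prim T (second_deriv u) t)" using elim by simp
    also have "\<dots> = riesz_iso c + prim T g t"
      by (simp only: linear_add[OF bounded_linear.linear[OF bounded_linear_riesz_iso]] pg)
    finally show ?case .
  qed
  obtain z where zc: "continuous_on UNIV z" and zv: "AE t in M. j (v t) = z t"
    and z: "\<And>t. hilbert_adj j (z t) = riesz_iso c + prim T g t"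
    "\<And>t. (norm (z t))\<^sup>2 = (norm (z 0))\<^sup>2 + 2 * prim T (\<lambda>s. inner (g s) (v s)) t"
    by (rule Lions_continuity[OF T v g Jv]) (rule that)
  \<comment> \<open>Both \<open>z\<close> and the function in the definition of the initial value
    represent \<open>j v\<close> continuously, so they agree at \<open>0\<close>; this identifies
    the constant \<open>c\<close>.\<close>
  have "z 0 = u1"
    using has_initial_value_unique[OF T, of "\<lambda>t. j (v t)" u1 z] sol zv continuous_on_subset[OF zc]
    by (simp add: solves_cauchy_problem_def v_def)
  then have c1: "riesz_iso c = hilbert_adj j u1" using z(1)[of 0] by (simp add: prim_0)
  have "AE t in M. second_deriv u t + B t (v t) + A t (u t) = f t"
    using sol by (simp add: solves_cauchy_problem_def v_def)
  moreover have "AE t in M. t \<in> {0<..<T}" by (rule AE_lebesgue_onI)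
  ultimately have gr: "AE t in M. g t = residual u0 (\<lambda>t. riesz_iso (f t)) v t"
    using ux
  proof eventually_elim
    case (elim t)
    note lin = bounded_linear.linear[OF bounded_linear_riesz_iso]
    have "riesz_iso (f t) = g t + opb t (v t) + opa t (u t)"
      unfolding elim(1)[symmetric] by (simp add: linear_add[OF lin] g_def riesz_A[OF elim(2)] riesz_B[OF elim(2)])
    then show ?case using elim(3) by (simp add: residual_def v_def)
  qed
  then show "AE t in M. riesz_iso (second_deriv u t) = residual u0 (\<lambda>t. riesz_iso (f t)) (wderiv T u) t"
    by (simp add: g_def v_def)
  have "prim T g t = prim T (residual u0 (\<lambda>t. riesz_iso (f t)) v) t" for t
    using gr M.sq_integrable_imp_integrable[OF g] M.sq_integrable_imp_integrable[OF sq_integrable_residual[OF F v]]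
    by (rule prim_cong_AE)
  then show "velocity_eq u0 (hilbert_adj j u1) (\<lambda>t. riesz_iso (f t)) (wderiv T u)"
    using Jv by (simp add: velocity_eq_def c1 v_def)
qed

text \<open>The integrated equation displays \<open>J v\<close> as a primitive of the residual;
  hence the second weak derivative exists in the antidual and equals the residual under the Riesz
  isomorphism, which is the equation.\<close>

lemma velocity_solution:
  assumes f: "L2 T f" and v: "sq_integrable M v"
    and eq: "velocity_eq u0 (hilbert_adj j u1) (\<lambda>t. riesz_iso (f t)) v"
  defines "u \<equiv> \<lambda>t. u0 + prim T v t"
  shows "MR T j u" "solves_cauchy_problem T j A B f u0 u1 u"
proof -
  define g where "g = residual u0 (\<lambda>t. riesz_iso (f t)) v"
  have F: "sq_integrable M (\<lambda>t. riesz_iso (f t))"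
    using L2_bounded_linear[OF bounded_linear_riesz_iso f] by (simp add: L2_iff)
  have g: "sq_integrable M g" unfolding g_def by (rule sq_integrable_residual[OF F v])
  note iv = M.sq_integrable_imp_integrable[OF v] and ig = M.sq_integrable_imp_integrable[OF g]
  have v2: "L2 T v" using v by (simp add: L2_iff)
  have u2: "L2 T u"
    unfolding L2_iff u_def by (intro sq_integrable_add M.sq_integrable_const sq_integrable_prim_sq v)
  have wu: "weak_deriv T u v" unfolding u_def by (rule weak_deriv_prim[OF iv])
  note du = wderiv_eqI[OF u2 v2 wu]
  note dU = wderiv_in_dual[OF u2 v2 wu]
  have U': "L2 T (wderiv T (in_dual j u))" by (rule H1_wderiv(1)[OF dU(1)])
  define G where "G t = riesz_inv (g t)" for t
  have G2: "L2 T G" unfolding G_def L2_iff by (rule sq_integrable_bounded_linear[OF bounded_linear_riesz_inv g])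
  have Jv: "AE t in M. J (v t) = hilbert_adj j u1 + prim T g t"
    using eq by (simp add: velocity_eq_def g_def)
  have pG: "riesz_inv (prim T g t) = prim T G t" for t
    unfolding G_def by (rule prim_bounded_linear[OF bounded_linear_riesz_inv ig, symmetric])
  \<comment> \<open>\<open>wderiv\<close> returns an arbitrary representative; it is compared with a
    primitive, whose weak derivative is known.\<close>
  have eqU': "AE t in M. riesz_inv (hilbert_adj j u1) + prim T G t = wderiv T (in_dual j u) t"
    using Jv dU(2)
    by eventually_elim
      (simp add: in_dual_eq linear_add[OF bounded_linear.linear[OF bounded_linear_riesz_inv]] pG)
  have iG: "integrable M G" by (rule L2_integrable[OF G2])
  have "weak_deriv T (wderiv T (in_dual j u)) G"
  proof (rule weak_deriv_cong_AE[OF weak_deriv_prim[OF iG] eqU'])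
    show "(\<lambda>t. riesz_inv (hilbert_adj j u1) + prim T G t) \<in> borel_measurable M"
      by (intro borel_measurable_add borel_measurable_const borel_measurable_prim iG)
    show "wderiv T (in_dual j u) \<in> borel_measurable M" using U' by (simp add: L2_def)
  qed
  note ddU = wderiv_eqI[OF U' G2 this]
  show "MR T j u" unfolding MR_def H2_def using du(1) dU(1) ddU(1) by simp
  obtain z where zc: "continuous_on UNIV z" and zv: "AE t in M. j (v t) = z t"
    and z: "\<And>t. hilbert_adj j (z t) = hilbert_adj j u1 + prim T g t"
    "\<And>t. (norm (z t))\<^sup>2 = (norm (z 0))\<^sup>2 + 2 * prim T (\<lambda>s. inner (g s) (v s)) t"
    by (rule Lions_continuity[OF T v g Jv]) (rule that)
  \<comment> \<open>The continuity theorem controls only the adjoint image of \<open>z 0\<close>;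
    density of the range of \<open>j\<close> allows the adjoint to be cancelled.\<close>
  have z0: "z 0 = u1" using z(1)[of 0] by (intro hilbert_adj_inj[OF dense]) (simp add: prim_0)
  show "solves_cauchy_problem T j A B f u0 u1 u"
    unfolding solves_cauchy_problem_def
  proof (intro conjI)
    have "AE t in M. t \<in> {0<..<T}" by (rule AE_lebesgue_onI)
    then show "AE t in M. second_deriv u t + B t (wderiv T u t) + A t (u t) = f t"
      using ddU(2) du(2)
    proof eventually_elim
      case (elim t)
      note lin = bounded_linear.linear[OF bounded_linear_riesz_iso]
      have "riesz_iso (G t + B t (v t) + A t (u t)) = g t + opb t (v t) + opa t (u t)"
        by (simp add: linear_add[OF lin] G_def riesz_iso_inv riesz_A[OF elim(1)] riesz_B[OF elim(1)])
      also have "\<dots> = riesz_iso (f t)" by (simp add: g_def residual_def u_def)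
      finally show ?case using elim(2,3) riesz_iso_inj by simp
    qed
    show "has_initial_value T u u0"
      unfolding has_initial_value_def
      by (rule exI[of _ u]) (simp add: u_def prim_0 continuous_on_prim[OF iv] continuous_on_add)
    show "has_initial_value T (\<lambda>t. j (wderiv T u t)) u1"
      unfolding has_initial_value_def
    proof (intro exI[of _ z] conjI z0)
      show "continuous_on {0..T} z" by (rule continuous_on_subset[OF zc]) simp
      show "AE t in M. j (wderiv T u t) = z t"
        using zv du(2) by eventually_elim simp
    qed
  qed
qed

text \<open>Every solution is \<open>u0\<close> plus the primitive of its velocity, so uniqueness of
  the velocity suffices.\<close>

theorem well_posed:
  assumes f: "L2 T f"
  shows "\<exists>u. MR T j u \<and> solves_cauchy_problem T j A B f u0 u1 u \<and>
    (\<forall>v. MR T j v \<and> solves_cauchy_problem T j A B f u0 u1 v \<longrightarrow> (AE t in M. v t = u t))"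
proof -
  have F: "sq_integrable M (\<lambda>t. riesz_iso (f t))"
    using L2_bounded_linear[OF bounded_linear_riesz_iso f] by (simp add: L2_iff)
  obtain w where w: "sq_integrable M w" "velocity_eq u0 (hilbert_adj j u1) (\<lambda>t. riesz_iso (f t)) w"
    using velocity_existence[OF F] by blast
  define u where "u t = u0 + prim T w t" for t
  have sol: "MR T j u" "solves_cauchy_problem T j A B f u0 u1 u"
    using velocity_solution[OF f w] by (simp_all add: u_def[abs_def])
  have "AE t in M. v t = u t" if v: "MR T j v" "solves_cauchy_problem T j A B f u0 u1 v" for v
  proof -
    note s = solution_velocity[OF f v]
    have "AE t in M. wderiv T v t = w t" by (rule velocity_unique[OF F s(1) w(1) s(4) w(2)])
    then have "prim T (wderiv T v) t = prim T w t" for t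
      by (intro prim_cong_AE M.sq_integrable_imp_integrable s w)
    then show ?thesis using s(2) by (simp add: u_def)
  qed
  with sol show ?thesis by blast
qed

theorem a_priori_estimate:
  "\<exists>C>0. \<forall>u0 u1 f u. L2 T f \<longrightarrow> MR T j u \<longrightarrow> solves_cauchy_problem T j A B f u0 u1 u \<longrightarrow>
    MR_norm T j u \<le> C * (norm u0 + norm u1 + L2_norm T f)"
proof -
  obtain C where C: "0 < C" "\<And>u0 u1 F v. sq_integrable M F \<Longrightarrow> sq_integrable M v \<Longrightarrow>
    velocity_eq u0 (hilbert_adj j u1) F v \<Longrightarrow> norm_L2 M v \<le> C * (norm u0 + norm u1 + norm_L2 M F)"
    by (rule velocity_estimate) (rule that)
  \<comment> \<open>Constant for \<open>u\<close>, which is \<open>u0\<close> plus a primitive: the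
    former has L2 norm \<open>sqrt T * norm u0\<close>, the latter at most \<open>T\<close> times
    that of the velocity.\<close>
  define C1 where "C1 = sqrt T + T * C"
  \<comment> \<open>Constant for the second derivative, read off from the equation: the summands
    belong to \<open>f\<close>, to the term with \<open>b\<close> and to the term with
    \<open>a\<close>.\<close>
  define C2 where "C2 = 1 + Kb * C + Ka * C1"
  have C1: "0 < C1" and C2: "0 < C2"
    using T C(1) a.K_nonneg b.K_nonneg by (auto simp: C1_def C2_def intro!: add_pos_nonneg)
  show ?thesis
  proof (intro exI[of _ "C1 + C + C2"] conjI allI impI)
    show "0 < C1 + C + C2" using C1 C2 C(1) by simp
    fix u0 :: 'v and u1 :: 'h and f u
    assume f: "L2 T f" and u: "MR T j u" "solves_cauchy_problem T j A B f u0 u1 u"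
    note s = solution_velocity[OF f u]
    define v where "v = wderiv T u"
    define N where "N = norm u0 + norm u1 + L2_norm T f"
    have F: "sq_integrable M (\<lambda>t. riesz_iso (f t))"
      using L2_bounded_linear[OF bounded_linear_riesz_iso f] by (simp add: L2_iff)
    have nF: "norm_L2 M (\<lambda>t. riesz_iso (f t)) = L2_norm T f"
      by (simp add: L2_norm_eq norm_L2_def norm_riesz_iso)
    have v: "sq_integrable M v" using s(1) by (simp add: v_def)
    have Nv: "norm_L2 M v \<le> C * N" using C(2)[OF F s(1) s(4)] by (simp add: nF N_def v_def)
    have N: "norm u0 \<le> N" "L2_norm T f \<le> N" by (simp_all add: N_def L2_norm_eq)
    have uL: "L2 T u" using u(1) by (simp add: MR_def H1_def)
    have c: "norm_L2 M (\<lambda>t. x) = sqrt T * norm x" for x :: 'v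
      using T by (simp add: norm_L2_def measure_restrict_space real_sqrt_mult)
    \<comment> \<open>The representative of \<open>u\<close> that occurs in the residual; one bound
      for it serves both \<open>u\<close> and the term with \<open>a\<close>.\<close>
    define u' where "u' t = u0 + prim T v t" for t
    have u': "sq_integrable M u'"
      unfolding u'_def by (intro sq_integrable_add M.sq_integrable_const sq_integrable_prim_sq v)
    have Nu': "norm_L2 M u' \<le> C1 * N"
    proof -
      have "norm_L2 M (prim T v) \<le> \<bar>sqrt T * norm_L2 M v\<bar> * norm_L2 M (\<lambda>_. 1::real)"
      proof (rule sq_integrable_dominated(2)[OF M.sq_integrable_const])
        show "prim T v \<in> borel_measurable M"
          by (rule borel_measurable_prim[OF M.sq_integrable_imp_integrable[OF v]])
        show "AE t in M. norm (prim T v t) \<le> sqrt T * norm_L2 M v * norm (1::real)"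
          using norm_prim_le_L2[OF less_imp_le[OF T] v] by simp
      qed
      also have "\<dots> = T * norm_L2 M v"
        using T by (simp add: norm_L2_def measure_restrict_space abs_mult)
      also have "\<dots> \<le> T * (C * N)" using T Nv by (intro mult_left_mono) auto
      finally have p: "norm_L2 M (prim T v) \<le> T * C * N" by simp
      have "norm_L2 M u' \<le> norm_L2 M (\<lambda>t. u0) + norm_L2 M (prim T v)"
        unfolding u'_def by (intro norm_L2_triangle M.sq_integrable_const sq_integrable_prim_sq v)
      also have "\<dots> \<le> sqrt T * N + T * C * N"
        unfolding c using p N(1) T by (intro add_mono mult_left_mono) auto
      finally show ?thesis by (simp add: C1_def distrib_right)
    qed
    have "norm_L2 M u = norm_L2 M u'"
      by (rule norm_L2_cong_AE)
        (use s(2) uL u' in \<open>auto simp: u'_def[abs_def] v_def L2_def sq_integrable_def\<close>)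
    then have Nu: "L2_norm T u \<le> C1 * N" using Nu' by (simp add: L2_norm_eq)
    define r where "r = residual u0 (\<lambda>t. riesz_iso (f t)) v"
    have r: "sq_integrable M r" unfolding r_def by (rule sq_integrable_residual[OF F v])
    have Nr: "norm_L2 M r \<le> C2 * N"
    proof -
      have "norm_L2 M r \<le> norm_L2 M (\<lambda>s. riesz_iso (f s) - opb s (v s)) + norm_L2 M (\<lambda>s. opa s (u' s))"
        unfolding r_def residual_def u'_def[symmetric]
        by (intro norm_L2_diff sq_integrable_diff F a.sq_integrable_form_op b.sq_integrable_form_op v u')
      moreover have "norm_L2 M (\<lambda>s. riesz_iso (f s) - opb s (v s)) \<le> L2_norm T f + norm_L2 M (\<lambda>s. opb s (v s))"
        using norm_L2_diff[OF F b.sq_integrable_form_op(1)[OF v]] by (simp add: nF)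
      moreover have "norm_L2 M (\<lambda>s. opb s (v s)) \<le> Kb * (C * N)"
        using b.sq_integrable_form_op(2)[OF v] mult_left_mono[OF Nv b.K_nonneg] by linarith
      moreover have "norm_L2 M (\<lambda>s. opa s (u' s)) \<le> Ka * (C1 * N)"
        using a.sq_integrable_form_op(2)[OF u'] mult_left_mono[OF Nu' a.K_nonneg] by linarith
      ultimately show ?thesis using N(2) by (simp add: C2_def distrib_right mult.assoc)
    qed
    have "L2 T (second_deriv u)"
      using u(1) H1_wderiv(1) by (auto simp: MR_def H2_def)
    then have m: "(\<lambda>t. riesz_iso (second_deriv u t)) \<in> borel_measurable M"
      using sq_integrable_measurable[OF sq_integrable_bounded_linear[OF bounded_linear_riesz_iso]] by (simp add: L2_iff)
    have "L2_norm T (second_deriv u) = norm_L2 M (\<lambda>t. riesz_iso (second_deriv u t))"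
      by (simp add: L2_norm_eq norm_L2_def norm_riesz_iso)
    also have "\<dots> = norm_L2 M r"
      by (rule norm_L2_cong_AE[OF _ m sq_integrable_measurable[OF r]]) (use s(3) in \<open>simp add: r_def v_def\<close>)
    finally have Nw: "L2_norm T (second_deriv u) \<le> C2 * N" using Nr by simp
    have nn: "0 \<le> L2_norm T u" "0 \<le> L2_norm T (wderiv T u)" "0 \<le> L2_norm T (second_deriv u)"
      by (simp_all add: L2_norm_eq)
    have "MR_norm T j u \<le> L2_norm T u + L2_norm T (wderiv T u) + L2_norm T (second_deriv u)"
    proof -
      have "sqrt (x\<^sup>2 + y\<^sup>2 + z\<^sup>2) \<le> x + y + z" if "0 \<le> x" "0 \<le> y" "0 \<le> z" for x y z :: real
        using that by (intro real_le_lsqrt) (auto simp: power2_eq_square algebra_simps)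
      then show ?thesis unfolding MR_norm_def using nn by blast
    qed
    also have "\<dots> \<le> C1 * N + C * N + C2 * N"
      using Nu Nv Nw by (simp add: L2_norm_eq v_def)
    finally show "MR_norm T j u \<le> (C1 + C + C2) * (norm u0 + norm u1 + L2_norm T f)"
      by (simp add: N_def distrib_right)
  qed
qed

end

lemma real_form_Re:
  fixes a :: "real \<Rightarrow> 'v::{complex_hilbert, second_countable_topology} \<Rightarrow> 'v \<Rightarrow> complex"
  assumes "bounded_nonautonomous_form T a"
  obtains K where "real_form T (\<lambda>t u w. Re (a t u w)) K"
proof -
  obtain K where K: "\<And>t u v. t \<in> {0..T} \<Longrightarrow> cmod (a t u v) \<le> K * norm u * norm v"
    using assms unfolding bounded_nonautonomous_form_def by blast
  have K': "\<bar>Re (a t u v)\<bar> \<le> \<bar>K\<bar> * norm u * norm v" if "t \<in> {0<..<T}" for t u v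
  proof -
    have "\<bar>Re (a t u v)\<bar> \<le> K * norm u * norm v"
      using K[of t u v] that abs_Re_le_cmod[of "a t u v"] by simp
    \<comment> \<open>The constant of the boundedness condition carries no sign, whereas
      \<open>real_form\<close> asks for a nonnegative one.\<close>
    also have "\<dots> \<le> \<bar>K\<bar> * norm u * norm v" by (intro mult_right_mono) auto
    finally show ?thesis .
  qed
  have "real_form T (\<lambda>t u w. Re (a t u w)) \<bar>K\<bar>"
  proof (rule real_form.intro)
    fix t assume t: "t \<in> {0<..<T}"
    then have s: "sesquilinear (a t)" using assms by (auto simp: bounded_nonautonomous_form_def)
    show "bounded_bilinear (\<lambda>u w. Re (a t u w))"
    proof
      show "\<exists>K. \<forall>u w. norm (Re (a t u w)) \<le> norm u * norm w * K"
        using K'[OF t] by (intro exI[of _ "\<bar>K\<bar>"]) (simp add: mult_ac)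
    qed (use s in \<open>auto simp: sesquilinear_def antilinear_def scaleR_scaleC\<close>)
    show "\<bar>Re (a t u w)\<bar> \<le> \<bar>K\<bar> * norm u * norm w" for u w by (rule K'[OF t])
  next
    fix u w
    have "(\<lambda>t. a t u w) \<in> borel_measurable (lebesgue_on {0..T})"
      using assms by (simp add: bounded_nonautonomous_form_def)
    then have "(\<lambda>t. a t u w) \<in> borel_measurable (restrict_space (lebesgue_on {0..T}) {0<..<T})"
      by (rule measurable_restrict_space1)
    then have [measurable]: "(\<lambda>t. a t u w) \<in> borel_measurable (leb T)"
      by (simp add: restrict_restrict_space Int_absorb2 Int_absorb1 greaterThanLessThan_subseteq_atLeastAtMost_iff)
    show "(\<lambda>t. Re (a t u w)) \<in> borel_measurable (leb T)"
      by measurable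
  qed simp
  then show ?thesis by (rule that)
qed

theorem theorem3p1:
  fixes T :: real
    and j :: "'v::{complex_hilbert, second_countable_topology} \<Rightarrow>
      'h::{complex_hilbert, second_countable_topology}"
    and a b :: "real \<Rightarrow> 'v \<Rightarrow> 'v \<Rightarrow> complex"
  assumes "T > 0"
    and "dense_embedding j"
    and "bounded_nonautonomous_form T a" and "quasi_coercive T j a"
    and "bounded_nonautonomous_form T b" and "quasi_coercive T j b"
  shows
    "(\<forall>u0 u1 f. L2 T f \<longrightarrow>
       (\<exists>u. MR T j u \<and>
          solves_cauchy_problem T j (assoc_operator a) (assoc_operator b) f u0 u1 u \<and>
          (\<forall>v. MR T j v \<and>
               solves_cauchy_problem T j (assoc_operator a) (assoc_operator b) f u0 u1 v \<longrightarrow>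
             (AE t in lebesgue_on {0<..<T}. v t = u t)))) \<and>
     (\<exists>C>0. \<forall>u0 u1 f u. L2 T f \<longrightarrow> MR T j u \<longrightarrow>
        solves_cauchy_problem T j (assoc_operator a) (assoc_operator b) f u0 u1 u \<longrightarrow>
        MR_norm T j u \<le> C * (norm u0 + norm u1 + L2_norm T f))"
proof -
  obtain Ka where "real_form T (\<lambda>t u w. Re (a t u w)) Ka" using real_form_Re[OF assms(3)] .
  then interpret a: real_form T "\<lambda>t u w. Re (a t u w)" Ka .
  obtain Kb where "real_form T (\<lambda>t u w. Re (b t u w)) Kb" using real_form_Re[OF assms(5)] .
  then interpret b: real_form T "\<lambda>t u w. Re (b t u w)" Kb .
  obtain \<alpha> \<omega> where co: "0 < \<alpha>"
    "\<And>t u. t \<in> {0..T} \<Longrightarrow> \<alpha> * (norm u)\<^sup>2 \<le> Re (b t u u) + \<omega> * (norm (j u))\<^sup>2"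
    using assms(6) unfolding quasi_coercive_def by blast
  interpret cauchy_problem j T a b Ka Kb \<alpha> \<omega>
  proof (intro cauchy_problem.intro second_order.intro real_gelfand.intro
      second_order_axioms.intro cauchy_problem_axioms.intro)
    show "bounded_linear j" "inj j" "closure (range j) = UNIV"
      using assms(2) by (simp_all add: dense_embedding_def)
    show "\<alpha> * (norm u)\<^sup>2 \<le> Re (b t u u) + \<omega> * (norm (j u))\<^sup>2" if "t \<in> {0<..<T}" for t u
      using co(2)[of t u] that by simp
  qed (use assms co(1) a.real_form_axioms b.real_form_axioms in simp_all)
  show ?thesis using well_posed a_priori_estimate by blast
qed

end
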